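(* Assume that $m>p$ and that $\mathbf{Z}\sim\mathbb{C}N_{m\times p}(\mathbf{\Xi},\mathbf{I}_m\otimes\mathbf{I}_p)$ with $\mathbf{\Xi}\in\mathbb{C}^{m\times p}$ unknown. Write $\mathbf{Z}^*\mathbf{Z}=\mathbf{U}\mathbf{L}\mathbf{U}^*$ with $\mathbf{U}$ a $p\times p$ unitary matrix and $\mathbf{L}=\mathrm{Diag}(\ell_1,\ldots,\ell_p)$, the $\ell_k$ being the eigenvalues in decreasing order. Let $h_k(\mathbf{L})=-(m+p-2k)/\ell_k$ for $k=1,2,\ldots,p$ and $\mathbf{H}(\mathbf{L})=\mathrm{Diag}(h_1(\mathbf{L}),\ldots,h_p(\mathbf{L}))$. Then the estimator $\mathbf{Z}[\mathbf{I}_p+\mathbf{U}\mathbf{H}(\mathbf{L})\mathbf{U}^*]$ of $\mathbf{\Xi}$ is minimax.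
   Context: $^*$ denotes conjugate transpose. $\mathbf{Z}\sim\mathbb{C}N_{m\times p}(\mathbf{\Xi},\mathbf{I}_m\otimes\mathbf{I}_p)$ means that $\mathbf{Z}$ has density $\pi^{-mp}\exp\{-\mathrm{Tr}((\mathbf{z}-\mathbf{\Xi})(\mathbf{z}-\mathbf{\Xi})^* )\}$ with respect to Lebesgue measure on $\mathbb{C}^{m\times p}$; the eigenvalues $\ell_k$ are distinct and positive with probability one. The risk of an estimator $\widehat{\mathbf{\Xi}}=\widehat{\mathbf{\Xi}}(\mathbf{Z})$ is $\mathcal{R}_0(\widehat{\mathbf{\Xi}},\mathbf{\Xi})=\mathbb{E}[\mathrm{Tr}\{(\widehat{\mathbf{\Xi}}-\mathbf{\Xi})^*(\widehat{\mathbf{\Xi}}-\mathbf{\Xi})\}]$. An estimator is minimax if its supremum risk over all $\mathbf{\Xi}\in\mathbb{C}^{m\times p}$ equals the infimum over all estimators of the supremum risk. *)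

theory Defs
  imports "HOL-Analysis.Analysis"
begin

definition conj_transpose :: "complex^'p^'m \<Rightarrow> complex^'m^'p" where
  "conj_transpose A = (\<chi> i j. cnj (A $ j $ i))"

definition unitary_matrix :: "complex^'n^'n \<Rightarrow> bool" where
  "unitary_matrix U \<longleftrightarrow>
     conj_transpose U ** U = mat 1 \<and> U ** conj_transpose U = mat 1"

text \<open>The index type of a matrix carries no order. An enumeration \<^term>\<open>pos\<close>, a bijection from
  the index type onto \<open>{1..n}\<close>, says which coordinate is the first, the second, and so on, and
  \<^term>\<open>diag_matrix pos d\<close> stands for \<open>Diag(d\<^sub>1, ..., d\<^sub>n)\<close>.\<close>

definition diag_matrix :: "('n \<Rightarrow> nat) \<Rightarrow> (nat \<Rightarrow> real) \<Rightarrow> complex^'n^'n" where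
  "diag_matrix pos d = (\<chi> i j. if i = j then complex_of_real (d (pos i)) else 0)"

text \<open>The trace below is real and nonnegative, as are all traces of products of a matrix with its
  conjugate transpose; \<^term>\<open>Re\<close> only changes the type.\<close>

definition complex_normal :: "complex^'p^'m \<Rightarrow> (complex^'p^'m) measure" where
  "complex_normal \<Xi> = density lebesgue (\<lambda>z.
     ennreal (exp (- Re (trace ((z - \<Xi>) ** conj_transpose (z - \<Xi>))))
                / pi ^ (CARD('m) * CARD('p))))"

text \<open>Measurability is with respect to the Lebesgue sigma-algebra, so altering an estimator on a
  null set gives an estimator again.\<close>

definition estimators :: "(complex^'p^'m \<Rightarrow> complex^'p^'m) set" where
  "estimators = borel_measurable lebesgue"

definition risk :: "(complex^'p^'m \<Rightarrow> complex^'p^'m) \<Rightarrow> complex^'p^'m \<Rightarrow> ennreal" where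
  "risk \<delta> \<Xi> = (\<integral>\<^sup>+ z. ennreal (Re (trace (conj_transpose (\<delta> z - \<Xi>) ** (\<delta> z - \<Xi>))))
                 \<partial>complex_normal \<Xi>)"

definition minimax :: "(complex^'p^'m \<Rightarrow> complex^'p^'m) \<Rightarrow> bool" where
  "minimax \<delta> \<longleftrightarrow> \<delta> \<in> estimators \<and>
     (SUP \<Xi>. risk \<delta> \<Xi>) =
     (INF \<delta>' \<in> (estimators :: (complex^'p^'m \<Rightarrow> complex^'p^'m) set). SUP \<Xi>. risk \<delta>' \<Xi>)"

end

theory Submission
  imports Defs "HOL-Probability.Distributions"
begin

text \<open>The minimax risk of the problem is \<open>m p\<close>. It cannot be smaller: for the Gaussian prior of scale
  \<open>\<tau>\<close> on the mean, the Bayes risk is \<open>m p \<tau>\<^sup>2 / (1 + \<tau>\<^sup>2)\<close>, which tends to \<open>m p\<close>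
  (\<open>sup_risk_ge_complex\<close>). It remains to show that the risk of the estimator is at most \<open>m p\<close> at every mean.

  Put \<open>c\<^sub>k = m + p - 2k\<close>. The correction \<open>Z U H U\<^sup>*\<close> is \<open>-1/2\<close> times the gradient of
  \<open>\<phi> = \<Sum> c\<^sub>k ln l\<^sub>k\<close>, and with summation by parts \<open>\<phi>\<close> is a nonnegative combination of the functions
  \<open>\<psi>\<^sub>k = ln (l\<^sub>1 \<cdots> l\<^sub>k)\<close>. Stein's identity would reduce the claim to
  \<open>\<Delta>\<phi> \<ge> |\<nabla>\<phi>|\<^sup>2 / 2\<close>, and formally \<open>\<Delta>\<psi>\<^sub>k \<ge> c\<^sub>k |\<nabla>\<psi>\<^sub>k|\<^sup>2\<close>, from which the
  inequality for \<open>\<phi>\<close> follows by the arithmetic in \<open>weight_sums\<close>. But eigenvalues that coincide or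
  vanish make these functions singular, and the eigenvectors are arbitrary choices. The proof therefore
  avoids derivatives of eigenvalues. It uses only that near each point \<open>\<psi>\<^sub>k\<close> lies above an
  explicit function that agrees with it at that point and has a large Laplacian.

  This function comes from the variational description of \<open>l\<^sub>1 \<cdots> l\<^sub>k\<close> as the largest value of a ratio of
  \<open>k \<times> k\<close> Gram determinants (\<open>det_weighted_gram_le\<close>), evaluated at a frame that moves with the matrix
  (\<open>log_top_eigenvalues_perturbation\<close>). All \<open>k\<close> are treated as \<open>p \<times> p\<close> matrices that are
  the identity outside a block.

  One-sided bounds are enough for a one-sided form of Stein's identity (\<open>stein_lower_bound\<close>): the mean
  of \<open>\<phi>\<close> under a Gaussian of scale one is compared with that of a slightly smaller scale, once by shrinking the
  variable, which sees the gradient, and once by adding an independent Gaussian, which sees the Laplacian.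
  Measurability of the estimator comes from the same convexity-like bound (\<open>subgradient_AE_borel\<close>).

  All this is done for the regularised eigenvalues \<open>l\<^sub>k + e\<close> with \<open>e > 0\<close>, for which the
  gradients are bounded (\<open>regularized_estimator\<close>). As \<open>e\<close> tends to zero, the regularised estimators converge
  at every \<open>Z\<close>, and Fatou's lemma transfers the bound on the risk.\<close>

section \<open>Complex matrices with the Frobenius norm\<close>

notation conj_transpose ("(_\<^sup>\<dagger>)" [1000] 1000)

definition rdiag :: "('n \<Rightarrow> real) \<Rightarrow> complex^'n^'n" where
  "rdiag d = (\<chi> i j. if i = j then complex_of_real (d i) else 0)"

lemma diag_matrix_eq_rdiag: "diag_matrix pos d = rdiag (\<lambda>i. d (pos i))"
  by (simp add: diag_matrix_def rdiag_def)

lemma ct_nth [simp]: "A\<^sup>\<dagger> $ i $ j = cnj (A $ j $ i)"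
  by (simp add: conj_transpose_def)

lemma ct_ct [simp]: "A\<^sup>\<dagger>\<^sup>\<dagger> = A"
  by (simp add: vec_eq_iff)

lemma ct_mult: "(A ** B)\<^sup>\<dagger> = B\<^sup>\<dagger> ** A\<^sup>\<dagger>"
  by (simp add: vec_eq_iff matrix_matrix_mult_def mult.commute)

lemma ct_add: "(A + B)\<^sup>\<dagger> = A\<^sup>\<dagger> + B\<^sup>\<dagger>"
  by (simp add: vec_eq_iff)

lemma ct_diff: "(A - B)\<^sup>\<dagger> = A\<^sup>\<dagger> - B\<^sup>\<dagger>"
  by (simp add: vec_eq_iff)

lemma ct_scaleR: "(r *\<^sub>R A)\<^sup>\<dagger> = r *\<^sub>R A\<^sup>\<dagger>"
  by (simp add: vec_eq_iff)

lemma ct_mat1 [simp]: "(mat 1)\<^sup>\<dagger> = mat 1"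
  by (auto simp: vec_eq_iff mat_def)

lemma ct_zero [simp]: "0\<^sup>\<dagger> = 0"
  by (simp add: vec_eq_iff)

lemma ct_rdiag [simp]: "(rdiag d)\<^sup>\<dagger> = rdiag d"
  by (simp add: vec_eq_iff rdiag_def)

lemmas ct_simps = ct_mult ct_add ct_diff ct_scaleR

lemma matrix_add_rdistrib_complex: "((A::complex^'n^'m) + B) ** (C::complex^'k^'n) = A ** C + B ** C"
  by (simp add: vec_eq_iff matrix_matrix_mult_def sum.distrib algebra_simps)

lemma matrix_diff_rdistrib: "((A::complex^'n^'m) - B) ** (C::complex^'k^'n) = A ** C - B ** C"
  by (simp add: vec_eq_iff matrix_matrix_mult_def sum_subtractf algebra_simps)

lemma matrix_diff_ldistrib: "(A::complex^'n^'m) ** ((B::complex^'k^'n) - C) = A ** B - A ** C"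
  by (simp add: vec_eq_iff matrix_matrix_mult_def sum_subtractf algebra_simps)

lemma matrix_scaleR_left: "(r *\<^sub>R (A::complex^'n^'m)) ** (B::complex^'k^'n) = r *\<^sub>R (A ** B)"
  by (simp add: scalar_matrix_assoc)

lemma matrix_scaleR_right: "(A::complex^'n^'m) ** (r *\<^sub>R (B::complex^'k^'n)) = r *\<^sub>R (A ** B)"
  by (simp add: matrix_scalar_ac matrix_scaleR_left)

lemmas matrix_distribs = matrix_add_ldistrib matrix_add_rdistrib_complex matrix_diff_ldistrib
  matrix_diff_rdistrib matrix_scaleR_left matrix_scaleR_right

lemma rdiag_add: "rdiag a + rdiag b = rdiag (\<lambda>i. a i + b i)"
  by (auto simp: vec_eq_iff rdiag_def)

lemma rdiag_diff: "rdiag a - rdiag b = rdiag (\<lambda>i. a i - b i)"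
  by (auto simp: vec_eq_iff rdiag_def)

lemma rdiag_scaleR: "r *\<^sub>R rdiag a = rdiag (\<lambda>i. r * a i)"
  by (simp add: vec_eq_iff rdiag_def scaleR_conv_of_real[where 'a=complex])

lemma rdiag_1: "rdiag (\<lambda>i. 1) = mat 1"
  by (auto simp: vec_eq_iff rdiag_def mat_def)

lemma mult_rdiag_nth: "(A ** rdiag d) $ i $ j = A $ i $ j * of_real (d j)"
  by (simp add: rdiag_def matrix_matrix_mult_def if_distrib if_distribR cong: if_cong)

lemma rdiag_mult_nth: "(rdiag d ** A) $ i $ j = of_real (d i) * A $ i $ j"
  by (simp add: rdiag_def matrix_matrix_mult_def if_distrib if_distribR cong: if_cong)

lemma rdiag_mult: "rdiag a ** rdiag b = rdiag (\<lambda>i. a i * b i)"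
  by (simp add: vec_eq_iff mult_rdiag_nth) (simp add: rdiag_def)

lemma det_rdiag: "det (rdiag d) = of_real (\<Prod>i\<in>UNIV. d i)"
proof -
  have "det (rdiag d) = (\<Prod>i\<in>UNIV. rdiag d $ i $ i)"
    by (rule det_diagonal) (simp add: rdiag_def)
  then show ?thesis by (simp add: rdiag_def)
qed

lemma trace_rdiag: "trace (rdiag d) = of_real (\<Sum>i\<in>UNIV. d i)"
  by (simp add: trace_def rdiag_def)

lemma norm_matrix_sq: "(norm (A::complex^'n^'m))\<^sup>2 = (\<Sum>i\<in>UNIV. \<Sum>j\<in>UNIV. (cmod (A $ i $ j))\<^sup>2)"
  by (simp add: norm_vec_def L2_set_def sum_nonneg)

lemma norm_matrix_sq': "(norm (A::complex^'n^'m))\<^sup>2 = (\<Sum>j\<in>UNIV. \<Sum>i\<in>UNIV. (cmod (A $ i $ j))\<^sup>2)"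
  unfolding norm_matrix_sq by (rule sum.swap)

lemma norm_ct [simp]: "norm (A\<^sup>\<dagger>) = norm A"
proof -
  have "(norm (A\<^sup>\<dagger>))\<^sup>2 = (norm A)\<^sup>2"
    by (subst norm_matrix_sq, subst norm_matrix_sq') simp
  then show ?thesis by simp
qed

lemma inner_matrix_trace: "(A::complex^'n^'m) \<bullet> B = Re (trace (A\<^sup>\<dagger> ** B))"
proof -
  have "A \<bullet> B = (\<Sum>i\<in>UNIV. \<Sum>j\<in>UNIV. A $ i $ j \<bullet> B $ i $ j)"
    by (simp add: inner_vec_def)
  also have "\<dots> = (\<Sum>j\<in>UNIV. \<Sum>i\<in>UNIV. A $ i $ j \<bullet> B $ i $ j)"
    by (rule sum.swap)
  finally show ?thesis
    by (simp add: trace_def matrix_matrix_mult_def inner_complex_def)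
qed

lemma inner_matrix_trace': "(A::complex^'n^'m) \<bullet> B = Re (trace (A ** B\<^sup>\<dagger>))"
  unfolding trace_def matrix_matrix_mult_def inner_vec_def
  by (simp add: inner_complex_def sum.distrib)

text \<open>The norm of the library on nested vectors is the Frobenius norm, so submultiplicativity is the
  Cauchy-Schwarz inequality applied entry by entry.\<close>

lemma norm_matrix_mult_le: "norm ((A::complex^'n^'m) ** (B::complex^'k^'n)) \<le> norm A * norm B"
proof -
  have "(norm (A ** B))\<^sup>2 = (\<Sum>i\<in>UNIV. \<Sum>j\<in>UNIV. (cmod (\<Sum>k\<in>UNIV. A $ i $ k * B $ k $ j))\<^sup>2)"
    by (simp add: norm_matrix_sq matrix_matrix_mult_def)
  also have "\<dots> \<le> (\<Sum>i\<in>UNIV. \<Sum>j\<in>UNIV. (\<Sum>k\<in>UNIV. (cmod (A $ i $ k))\<^sup>2) * (\<Sum>k\<in>UNIV. (cmod (B $ k $ j))\<^sup>2))"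
  proof (intro sum_mono)
    fix i j
    have "cmod (\<Sum>k\<in>UNIV. A $ i $ k * B $ k $ j) \<le> (\<Sum>k\<in>UNIV. cmod (A $ i $ k) * cmod (B $ k $ j))"
      by (intro order_trans[OF norm_sum]) (simp add: norm_mult)
    then have "(cmod (\<Sum>k\<in>UNIV. A $ i $ k * B $ k $ j))\<^sup>2 \<le> (\<Sum>k\<in>UNIV. cmod (A $ i $ k) * cmod (B $ k $ j))\<^sup>2"
      by (intro power_mono) auto
    also have "\<dots> \<le> (\<Sum>k\<in>UNIV. (cmod (A $ i $ k))\<^sup>2) * (\<Sum>k\<in>UNIV. (cmod (B $ k $ j))\<^sup>2)"
      by (rule Cauchy_Schwarz_ineq_sum)
    finally show "(cmod (\<Sum>k\<in>UNIV. A $ i $ k * B $ k $ j))\<^sup>2 \<le> \<dots>" .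
  qed
  also have "\<dots> = (norm A)\<^sup>2 * (norm B)\<^sup>2"
    by (subst (2) norm_matrix_sq') (simp add: norm_matrix_sq sum_product)
  finally have "(norm (A ** B))\<^sup>2 \<le> (norm A * norm B)\<^sup>2"
    by (simp add: power_mult_distrib)
  then show ?thesis by (rule power2_le_imp_le) simp
qed

lemma norm_unitary_left:
  assumes "(U::complex^'n^'m)\<^sup>\<dagger> ** U = mat 1"
  shows "norm (U ** (A::complex^'k^'n)) = norm A"
proof -
  have "(norm (U ** A))\<^sup>2 = Re (trace (A\<^sup>\<dagger> ** (U\<^sup>\<dagger> ** U) ** A))"
    by (simp add: power2_norm_eq_inner inner_matrix_trace ct_mult matrix_mul_assoc)
  also have "\<dots> = (norm A)\<^sup>2"
    by (simp add: assms power2_norm_eq_inner inner_matrix_trace)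
  finally show ?thesis by simp
qed

lemma norm_unitary_right:
  assumes "(U::complex^'n^'m) ** U\<^sup>\<dagger> = mat 1"
  shows "norm ((A::complex^'m^'k) ** U) = norm A"
proof -
  have "norm (A ** U) = norm (U\<^sup>\<dagger> ** A\<^sup>\<dagger>)"
    by (metis ct_mult norm_ct)
  also have "\<dots> = norm A"
    by (subst norm_unitary_left) (simp_all add: assms)
  finally show ?thesis .
qed

lemma norm_rdiag_sq: "(norm (rdiag d))\<^sup>2 = (\<Sum>i\<in>UNIV. (d i)\<^sup>2)"
  by (simp add: norm_matrix_sq rdiag_def if_distrib if_distribR cong: if_cong)

lemma tendsto_matrix_mult [tendsto_intros]:
  fixes f :: "'b \<Rightarrow> complex^'n^'m" and g :: "'b \<Rightarrow> complex^'k^'n"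
  assumes "(f \<longlongrightarrow> A) F" "(g \<longlongrightarrow> B) F"
  shows "((\<lambda>x. f x ** g x) \<longlongrightarrow> A ** B) F"
proof (rule vec_tendstoI, rule vec_tendstoI)
  fix i j
  have "((\<lambda>x. \<Sum>k\<in>UNIV. f x $ i $ k * g x $ k $ j) \<longlongrightarrow> (\<Sum>k\<in>UNIV. A $ i $ k * B $ k $ j)) F"
    by (intro tendsto_intros assms)
  then show "((\<lambda>x. (f x ** g x) $ i $ j) \<longlongrightarrow> (A ** B) $ i $ j) F"
    by (simp add: matrix_matrix_mult_def)
qed

lemma det_ct: "det (A\<^sup>\<dagger>) = cnj (det (A::complex^'n^'n))"
proof -
  have "A\<^sup>\<dagger> = transpose (\<chi> i j. cnj (A $ i $ j))"
    by (simp add: vec_eq_iff transpose_def)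
  then have "det (A\<^sup>\<dagger>) = det (\<chi> i j. cnj (A $ i $ j))" by simp
  also have "\<dots> = cnj (det A)" by (simp add: det_def)
  finally show ?thesis .
qed

section \<open>Spectral theorem for Hermitian matrices\<close>

definition cinner :: "complex^'n \<Rightarrow> complex^'n \<Rightarrow> complex" where
  "cinner x y = (\<Sum>i\<in>UNIV. cnj (x $ i) * y $ i)"

lemma Re_cinner: "Re (cinner x y) = x \<bullet> y"
  by (simp add: cinner_def inner_vec_def inner_complex_def)

lemma Im_cinner: "Im (cinner x y) = (\<i> *s x) \<bullet> y"
  by (simp add: cinner_def inner_vec_def inner_complex_def algebra_simps sum_subtractf)

lemma cinner_add: "cinner x (y + z) = cinner x y + cinner x z"
  by (simp add: cinner_def sum.distrib algebra_simps)

lemma cinner_scaleR: "cinner x (r *\<^sub>R y) = of_real r * cinner x y"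
  by (simp add: cinner_def sum_distrib_left mult_ac scaleR_conv_of_real[where 'a=complex])

lemma cinner_diff: "cinner x (y - z) = cinner x y - cinner x z"
  by (simp add: cinner_def sum_subtractf algebra_simps)

lemma cinner_cnj: "cnj (cinner x y) = cinner y x"
  by (simp add: cinner_def mult.commute)

lemma cinner_self: "cinner x x = of_real ((norm x)\<^sup>2)"
proof -
  have "Im (cinner x x) = 0"
    using cinner_cnj[of x x] by (metis Reals_cnj_iff complex_is_Real_iff)
  then show ?thesis
    by (simp add: complex_eq_iff Re_cinner power2_norm_eq_inner)
qed

lemma cinner_matrix: "cinner x (A *v y) = cinner (A\<^sup>\<dagger> *v x) y"
proof -
  have "cinner x (A *v y) = (\<Sum>i\<in>UNIV. \<Sum>j\<in>UNIV. cnj (x $ i) * A $ i $ j * y $ j)"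
    by (simp add: cinner_def matrix_vector_mult_def sum_distrib_left mult_ac)
  also have "\<dots> = (\<Sum>j\<in>UNIV. \<Sum>i\<in>UNIV. cnj (x $ i) * A $ i $ j * y $ j)"
    by (rule sum.swap)
  also have "\<dots> = cinner (A\<^sup>\<dagger> *v x) y"
    by (simp add: cinner_def matrix_vector_mult_def sum_distrib_left sum_distrib_right mult_ac)
  finally show ?thesis .
qed

lemma mv_scaleR: "A *v (r *\<^sub>R x) = r *\<^sub>R (A *v (x::complex^'n))"
  by (rule linear_cmul[OF matrix_vector_mul_linear])

text \<open>The induction step of the spectral theorem. On the orthogonal complement of the eigenvectors
  found so far, which the matrix leaves invariant, the quadratic form attains its maximum over
  the unit sphere by compactness. At a maximiser the residual vector lies in the same
  complement, and the first variation in its direction shows that it vanishes.\<close>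

lemma hermitian_orthonormal_eigenvectors_extend:
  fixes A :: "complex^'n^'n" and d :: "complex^'n \<Rightarrow> real"
  assumes herm: "A\<^sup>\<dagger> = A" and fin: "finite E" and card: "card E < CARD('n)"
    and eig: "\<And>u. u \<in> E \<Longrightarrow> A *v u = d u *\<^sub>R u"
  obtains x \<mu> where "norm x = 1" "\<And>u. u \<in> E \<Longrightarrow> cinner u x = 0" "A *v x = (\<mu>::real) *\<^sub>R x"
proof -
  define F where "F = {x. \<forall>u\<in>E. cinner u x = 0}"
  define q where "q x = x \<bullet> (A *v x)" for x
  have sym: "x \<bullet> (A *v y) = (A *v x) \<bullet> y" for x y
    using cinner_matrix[of x A y] by (metis Re_cinner herm)
  \<comment> \<open>Complex orthogonality to \<open>u\<close> is real orthogonality to \<open>u\<close> and to \<open>\<i> u\<close>.\<close>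
  have "dim (E \<union> (\<lambda>u. \<i> *s u) ` E) \<le> card (E \<union> (\<lambda>u. \<i> *s u) ` E)"
    using fin by (intro dim_le_card') auto
  also have "\<dots> \<le> card E + card E"
    using fin by (intro order_trans[OF card_Un_le] add_mono) (auto intro: card_image_le)
  also have "\<dots> < DIM(complex^'n)" using card by simp
  finally obtain x0 where x0: "x0 \<noteq> 0" "\<And>y. y \<in> span (E \<union> (\<lambda>u. \<i> *s u) ` E) \<Longrightarrow> orthogonal x0 y"
    using orthogonal_to_subspace_exists by blast
  have x0F: "x0 \<in> F"
    unfolding F_def
  proof safe
    fix u assume "u \<in> E"
    then have "orthogonal x0 u" "orthogonal x0 (\<i> *s u)"
      by (auto intro!: x0(2) span_base)
    then show "cinner u x0 = 0"
      by (simp add: complex_eq_iff Re_cinner Im_cinner orthogonal_def inner_commute)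
  qed
  have F_scale: "r *\<^sub>R x \<in> F" if "x \<in> F" for r x
    using that by (simp add: F_def cinner_scaleR)
  have F_add: "x + y \<in> F" if "x \<in> F" "y \<in> F" for x y
    using that by (simp add: F_def cinner_add)
  have closed: "closed F"
  proof -
    have "continuous_on UNIV (cinner u)" for u :: "complex^'n"
      unfolding cinner_def by (intro continuous_intros)
    then have "closed {x. cinner u x = 0}" for u :: "complex^'n"
      by (intro closed_Collect_eq continuous_intros) auto
    moreover have "F = (\<Inter>u\<in>E. {x. cinner u x = 0})" by (auto simp: F_def)
    ultimately show ?thesis by auto
  qed
  have "compact (sphere 0 1 \<inter> F)"
    by (intro compact_Int_closed closed) simp
  moreover have "(1 / norm x0) *\<^sub>R x0 \<in> sphere 0 1 \<inter> F"
    using x0 x0F by (auto intro!: F_scale)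
  moreover have "continuous_on (sphere 0 1 \<inter> F) q"
    unfolding q_def by (intro continuous_intros linear_continuous_on matrix_vector_mul_bounded_linear)
  ultimately obtain x where x: "x \<in> sphere 0 1" "x \<in> F"
    and max: "\<And>y. y \<in> sphere 0 1 \<inter> F \<Longrightarrow> q y \<le> q x"
    using continuous_attains_sup[of "sphere 0 1 \<inter> F" q] by blast
  have nx: "norm x = 1" using x by simp
  then have xx: "x \<bullet> x = 1" by (simp add: norm_eq_1)
  define \<mu> where "\<mu> = q x"
  have bound: "q y \<le> \<mu> * (norm y)\<^sup>2" if "y \<in> F" for y
  proof (cases "y = 0")
    case False
    have "q ((1 / norm y) *\<^sub>R y) \<le> \<mu>"
      unfolding \<mu>_def using False that by (intro max) (auto intro!: F_scale)
    moreover have "q ((1 / norm y) *\<^sub>R y) = q y / (norm y)\<^sup>2"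
      by (simp add: q_def mv_scaleR power2_eq_square)
    ultimately show ?thesis using False by (simp add: field_simps)
  qed (simp add: q_def)
  define y where "y = A *v x - \<mu> *\<^sub>R x"
  have yF: "y \<in> F"
    unfolding F_def
  proof safe
    fix u assume u: "u \<in> E"
    have "cinner u (A *v x) = cinner (d u *\<^sub>R u) x"
      by (simp add: cinner_matrix herm eig u)
    also have "\<dots> = cnj (cinner x (d u *\<^sub>R u))" by (simp add: cinner_cnj)
    also have "\<dots> = 0"
      using x(2) u cinner_cnj[of u x] by (auto simp: cinner_scaleR F_def)
    finally show "cinner u y = 0"
      using x(2) u by (auto simp: y_def cinner_diff cinner_scaleR F_def)
  qed
  have yx: "y \<bullet> x = 0"
    using xx
    by (simp add: y_def inner_diff_left \<mu>_def q_def inner_commute[of "A *v x"])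
  have yA: "y \<bullet> (A *v x) = (norm y)\<^sup>2"
    using yx by (simp add: power2_norm_eq_inner) (simp add: y_def inner_diff_right)
  have "2 * (norm y)\<^sup>2 \<le> t * (\<mu> * (norm y)\<^sup>2 - q y)" if "t > 0" for t
  proof -
    have "q (x + t *\<^sub>R y) = \<mu> + 2 * t * (norm y)\<^sup>2 + t\<^sup>2 * q y"
      using yA sym[of x y]
      by (simp add: q_def \<mu>_def matrix_vector_right_distrib mv_scaleR inner_add_left
          inner_add_right power2_eq_square inner_commute algebra_simps)
    moreover have "(norm (x + t *\<^sub>R y))\<^sup>2 = 1 + t\<^sup>2 * (norm y)\<^sup>2"
      using yx xx unfolding power2_norm_eq_inner
      by (simp add: inner_add_left inner_add_right inner_commute[of x y] power2_eq_square)
    ultimately have "\<mu> + 2 * t * (norm y)\<^sup>2 + t\<^sup>2 * q y \<le> \<mu> * (1 + t\<^sup>2 * (norm y)\<^sup>2)"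
      using bound[OF F_add[OF x(2) F_scale[OF yF, of t]]] by simp
    then have "t * (2 * (norm y)\<^sup>2) \<le> t * (t * (\<mu> * (norm y)\<^sup>2 - q y))"
      by (simp add: algebra_simps power2_eq_square)
    with that show ?thesis by simp
  qed
  note * = this
  have "2 * (norm y)\<^sup>2 \<le> 0"
  proof (rule field_le_epsilon)
    fix e :: real assume "e > 0"
    define b where "b = \<bar>\<mu> * (norm y)\<^sup>2 - q y\<bar> + 1"
    have "2 * (norm y)\<^sup>2 \<le> (e / b) * (\<mu> * (norm y)\<^sup>2 - q y)"
      using \<open>e > 0\<close> by (intro *) (simp add: b_def add_pos_nonneg)
    also have "\<dots> \<le> (e / b) * b" using \<open>e > 0\<close> by (intro mult_left_mono) (auto simp: b_def)
    also have "\<dots> = 0 + e" by (simp add: b_def)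
    finally show "2 * (norm y)\<^sup>2 \<le> 0 + e" .
  qed
  then have "A *v x = \<mu> *\<^sub>R x" by (simp add: y_def)
  then show ?thesis using that nx x(2) by (auto simp: F_def)
qed

theorem hermitian_spectral:
  fixes A :: "complex^'n^'n"
  assumes herm: "A\<^sup>\<dagger> = A"
  obtains U :: "complex^'n^'n" and d where "U\<^sup>\<dagger> ** U = mat 1" "U ** U\<^sup>\<dagger> = mat 1" "A = U ** rdiag d ** U\<^sup>\<dagger>"
proof -
  have "\<exists>E d. finite E \<and> card E = n \<and> (\<forall>u\<in>E. \<forall>v\<in>E. cinner u v = (if u = v then 1 else 0))
      \<and> (\<forall>u\<in>E. A *v u = (d u::real) *\<^sub>R u)" if "n \<le> CARD('n)" for n
    using that
  proof (induction n)
    case 0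
    show ?case by (rule exI[of _ "{}"]) simp
  next
    case (Suc n)
    then obtain E d where E: "finite E" "card E = n"
      "\<And>u v. u \<in> E \<Longrightarrow> v \<in> E \<Longrightarrow> cinner u v = (if u = v then 1 else 0)"
      "\<And>u. u \<in> E \<Longrightarrow> A *v u = (d u::real) *\<^sub>R u" by fastforce
    have "card E < CARD('n)" using E(2) Suc.prems by simp
    from hermitian_orthonormal_eigenvectors_extend[OF herm E(1) this E(4)]
    obtain x \<mu> where x: "norm x = 1" "\<And>u. u \<in> E \<Longrightarrow> cinner u x = 0" "A *v x = (\<mu>::real) *\<^sub>R x"
      by metis
    have "x \<notin> E" using x(1) x(2)[of x] by (auto simp: cinner_self)
    have x': "cinner x u = 0" if "u \<in> E" for u
      using x(2)[OF that] cinner_cnj[of u x] by simp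
    have "finite (insert x E) \<and> card (insert x E) = Suc n"
      using E(1,2) \<open>x \<notin> E\<close> by simp
    moreover have "cinner u v = (if u = v then 1 else 0)" if "u \<in> insert x E" "v \<in> insert x E" for u v
    proof (cases "u = x"; cases "v = x")
      assume "u = x" "v = x"
      then show ?thesis using x(1) by (simp add: cinner_self)
    next
      assume "u = x" "v \<noteq> x"
      then show ?thesis using x'[of v] that by simp
    next
      assume "u \<noteq> x" "v = x"
      then show ?thesis using x(2)[of u] that by simp
    next
      assume "u \<noteq> x" "v \<noteq> x"
      then show ?thesis using E(3)[of u v] that by simp
    qed
    moreover have "A *v u = ((d(x := \<mu>)) u) *\<^sub>R u" if "u \<in> insert x E" for u
      using that E(4) x(3) by (cases "u = x") simp_all
    ultimately show ?case by blast
  qed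
  from this[of "CARD('n)"] obtain E d where E': "finite E" "card E = CARD('n)"
      "\<forall>u\<in>E. \<forall>v\<in>E. cinner u v = (if u = v then 1 else 0)"
      "\<forall>u\<in>E. A *v u = (d u::real) *\<^sub>R u" by blast
  note E = E'(1,2) E'(3)[rule_format] E'(4)[rule_format]
  obtain f :: "'n \<Rightarrow> complex^'n" where f: "bij_betw f UNIV E"
    using E(1,2) by (metis finite_class.finite_UNIV finite_same_card_bij)
  define U :: "complex^'n^'n" where "U = (\<chi> i j. f j $ i)"
  have fE: "f i \<in> E" for i using f by (auto simp: bij_betw_def)
  have inj: "f i = f j \<longleftrightarrow> i = j" for i j using f by (auto simp: bij_betw_def inj_on_def)
  have 1: "U\<^sup>\<dagger> ** U = mat 1"
  proof -
    have "(U\<^sup>\<dagger> ** U) $ i $ j = cinner (f i) (f j)" for i j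
      by (simp add: matrix_matrix_mult_def U_def cinner_def)
    moreover have "cinner (f i) (f j) = (if i = j then 1 else 0)" for i j
      using E(3)[OF fE fE, of i j] by (simp only: inj)
    ultimately show ?thesis
      by (simp add: vec_eq_iff mat_def)
  qed
  then have 2: "U ** U\<^sup>\<dagger> = mat 1" using matrix_left_right_inverse by blast
  have "A ** U = U ** rdiag (\<lambda>j. d (f j))"
  proof -
    have "(A ** U) $ i $ j = (A *v f j) $ i" for i j
      by (simp add: matrix_matrix_mult_def matrix_vector_mult_def U_def)
    then show ?thesis
      by (simp add: vec_eq_iff E(4) fE mult_rdiag_nth U_def scaleR_conv_of_real[where 'a=complex] mult.commute)
  qed
  then have "A ** (U ** U\<^sup>\<dagger>) = U ** rdiag (\<lambda>j. d (f j)) ** U\<^sup>\<dagger>"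
    by (simp add: matrix_mul_assoc)
  then have "A = U ** rdiag (\<lambda>j. d (f j)) ** U\<^sup>\<dagger>" by (simp add: 2)
  with 1 2 show ?thesis by (rule that)
qed

section \<open>Determinant inequalities\<close>

text \<open>Diagonal entries of Gram matrices are column norms; this is how nonnegativity of eigenvalues
  enters everywhere below.\<close>

lemma gram_diag: "(M\<^sup>\<dagger> ** M) $ i $ i = of_real (\<Sum>j\<in>UNIV. (cmod (M $ j $ i))\<^sup>2)"
proof -
  have "(M\<^sup>\<dagger> ** M) $ i $ i = (\<Sum>j\<in>UNIV. cnj (M $ j $ i) * M $ j $ i)"
    by (simp add: matrix_matrix_mult_def)
  also have "\<dots> = (\<Sum>j\<in>UNIV. of_real ((cmod (M $ j $ i))\<^sup>2))"
    by (intro sum.cong refl) (metis complex_norm_square mult.commute)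
  finally show ?thesis by simp
qed

lemma prod_one_plus_ge_sum:
  fixes d :: "'a \<Rightarrow> real"
  assumes "finite I" "\<And>i. i \<in> I \<Longrightarrow> d i \<ge> 0"
  shows "(\<Prod>i\<in>I. 1 + d i) \<ge> 1 + (\<Sum>i\<in>I. d i)"
  using assms
proof (induction I rule: finite_induct)
  case (insert x I)
  have "0 \<le> (\<Sum>i\<in>I. d i)" using insert by (intro sum_nonneg) auto
  then have "1 + d x + (\<Sum>i\<in>I. d i) \<le> (1 + d x) * (1 + (\<Sum>i\<in>I. d i))"
    using insert.prems[of x] by (simp add: algebra_simps)
  also have "\<dots> \<le> (1 + d x) * (\<Prod>i\<in>I. 1 + d i)"
    using insert by (intro mult_left_mono) auto
  finally show ?case using insert by simp
qed simp

lemma cmod_det_unitary_conj: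
  assumes "(U::complex^'n^'n)\<^sup>\<dagger> ** U = mat 1"
  shows "cmod (det (U ** A ** U\<^sup>\<dagger>)) = cmod (det A)"
proof -
  have "det (U\<^sup>\<dagger>) * det U = 1" by (metis assms det_I det_mul)
  then have "det (U ** A ** U\<^sup>\<dagger>) = det A"
    by (simp add: det_mul mult_ac)
  then show ?thesis by simp
qed

text \<open>With eigenvalues \<open>d\<^sub>i \<ge> 0\<close> of the sum of the two Gram matrices, the
  determinant is \<open>\<Prod>(1 + d\<^sub>i) \<ge> 1 + \<Sum>d\<^sub>i\<close>, and the sum of
  the eigenvalues is at least the squared norm of the first factor. The second Gram matrix may
  be any positive semidefinite remainder.\<close>

lemma det_one_plus_gram_ge:
  fixes X :: "complex^'n^'m" and Y :: "complex^'n^'k"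
  shows "cmod (det (mat 1 + X\<^sup>\<dagger> ** X + Y\<^sup>\<dagger> ** Y)) \<ge> 1 + (norm X)\<^sup>2"
proof -
  define T where "T = X\<^sup>\<dagger> ** X + Y\<^sup>\<dagger> ** Y"
  have "T\<^sup>\<dagger> = T" by (simp add: T_def ct_simps)
  then obtain U :: "complex^'n^'n" and d where U: "U\<^sup>\<dagger> ** U = mat 1" "U ** U\<^sup>\<dagger> = mat 1" "T = U ** rdiag d ** U\<^sup>\<dagger>"
    by (rule hermitian_spectral)
  have "rdiag d = (U\<^sup>\<dagger> ** U) ** rdiag d ** (U\<^sup>\<dagger> ** U)" by (simp add: U)
  also have "\<dots> = U\<^sup>\<dagger> ** T ** U" by (simp add: U(3) matrix_mul_assoc)
  also have "\<dots> = (X ** U)\<^sup>\<dagger> ** (X ** U) + (Y ** U)\<^sup>\<dagger> ** (Y ** U)"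
    by (simp add: T_def ct_simps matrix_distribs matrix_mul_assoc)
  finally have D: "rdiag d = (X ** U)\<^sup>\<dagger> ** (X ** U) + (Y ** U)\<^sup>\<dagger> ** (Y ** U)" .
  have d: "d i = (\<Sum>j\<in>UNIV. (cmod ((X ** U) $ j $ i))\<^sup>2) + (\<Sum>j\<in>UNIV. (cmod ((Y ** U) $ j $ i))\<^sup>2)" for i
  proof -
    have "complex_of_real (d i) = rdiag d $ i $ i" by (simp add: rdiag_def)
    also have "\<dots> = of_real ((\<Sum>j\<in>UNIV. (cmod ((X ** U) $ j $ i))\<^sup>2) + (\<Sum>j\<in>UNIV. (cmod ((Y ** U) $ j $ i))\<^sup>2))"
      by (subst D) (simp only: vector_add_component gram_diag of_real_add)
    finally show ?thesis by (simp only: of_real_eq_iff)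
  qed
  have d0: "d i \<ge> (\<Sum>j\<in>UNIV. (cmod ((X ** U) $ j $ i))\<^sup>2)" for i
    by (simp add: d sum_nonneg)
  have "mat 1 + X\<^sup>\<dagger> ** X + Y\<^sup>\<dagger> ** Y = U ** (mat 1 + rdiag d) ** U\<^sup>\<dagger>"
    using U(2,3) by (simp add: T_def matrix_distribs add.assoc)
  then have "cmod (det (mat 1 + X\<^sup>\<dagger> ** X + Y\<^sup>\<dagger> ** Y)) = cmod (det (mat 1 + rdiag d))"
    by (simp add: cmod_det_unitary_conj U(1))
  also have "\<dots> = \<bar>\<Prod>i\<in>UNIV. 1 + d i\<bar>"
    by (simp add: rdiag_add det_rdiag flip: rdiag_1 del: of_real_prod)
  finally have 1: "cmod (det (mat 1 + X\<^sup>\<dagger> ** X + Y\<^sup>\<dagger> ** Y)) = \<bar>\<Prod>i\<in>UNIV. 1 + d i\<bar>" .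
  have d1: "d i \<ge> 0" for i
    by (rule order_trans[OF _ d0]) (simp add: sum_nonneg)
  have 2: "(\<Prod>i\<in>UNIV. 1 + d i) \<ge> 1 + (\<Sum>i\<in>UNIV. d i)"
    by (rule prod_one_plus_ge_sum) (simp_all add: d1)
  have 3: "(norm (X ** U))\<^sup>2 \<le> (\<Sum>i\<in>UNIV. d i)"
    unfolding norm_matrix_sq' by (intro sum_mono d0)
  have 4: "norm (X ** U) = norm X"
    by (rule norm_unitary_right) (rule U)
  show ?thesis using 1 2 3 unfolding 4 by linarith
qed

lemma det_gram_plus_ge:
  fixes X :: "complex^'n^'m" and Y :: "complex^'n^'k" and S :: "complex^'n^'n"
  shows "cmod (det (S\<^sup>\<dagger> ** S + (X ** S)\<^sup>\<dagger> ** (X ** S) + (Y ** S)\<^sup>\<dagger> ** (Y ** S)))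
    \<ge> (cmod (det S))\<^sup>2 * (1 + (norm X)\<^sup>2)"
proof -
  have "S\<^sup>\<dagger> ** S + (X ** S)\<^sup>\<dagger> ** (X ** S) + (Y ** S)\<^sup>\<dagger> ** (Y ** S) = S\<^sup>\<dagger> ** (mat 1 + X\<^sup>\<dagger> ** X + Y\<^sup>\<dagger> ** Y) ** S"
    by (simp add: ct_simps matrix_distribs matrix_mul_assoc)
  then show ?thesis
    using mult_left_mono[OF det_one_plus_gram_ge[of X Y], of "(cmod (det S))\<^sup>2"]
    by (simp add: det_mul det_ct norm_mult power2_eq_square mult_ac)
qed

text \<open>A form of Bessel's inequality: the columns of the two blocks stacked on each other are
  orthonormal, so no row can have norm larger than one.\<close>

lemma row_norm_le_one:
  fixes K :: "complex^'n^'r" and L :: "complex^'n^'s"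
  assumes "K\<^sup>\<dagger> ** K + L\<^sup>\<dagger> ** L = mat 1"
  shows "(\<Sum>i\<in>UNIV. (cmod (K $ j $ i))\<^sup>2) \<le> 1"
proof -
  define r where "r = (\<Sum>i\<in>UNIV. (cmod (K $ j $ i))\<^sup>2)"
  have r: "(K ** K\<^sup>\<dagger>) $ j $ j = of_real r"
    using gram_diag[of "K\<^sup>\<dagger>" j] by (simp add: r_def)
  have "K ** K\<^sup>\<dagger> = K ** (K\<^sup>\<dagger> ** K + L\<^sup>\<dagger> ** L) ** K\<^sup>\<dagger>" by (simp add: assms)
  also have "\<dots> = (K ** K\<^sup>\<dagger>)\<^sup>\<dagger> ** (K ** K\<^sup>\<dagger>) + (L ** K\<^sup>\<dagger>)\<^sup>\<dagger> ** (L ** K\<^sup>\<dagger>)"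
    by (simp add: ct_simps matrix_distribs matrix_mul_assoc)
  finally have "(K ** K\<^sup>\<dagger>) $ j $ j
      = ((K ** K\<^sup>\<dagger>)\<^sup>\<dagger> ** (K ** K\<^sup>\<dagger>)) $ j $ j + ((L ** K\<^sup>\<dagger>)\<^sup>\<dagger> ** (L ** K\<^sup>\<dagger>)) $ j $ j"
    by (metis vector_add_component)
  then have "complex_of_real r = of_real ((\<Sum>i\<in>UNIV. (cmod ((K ** K\<^sup>\<dagger>) $ i $ j))\<^sup>2)
      + (\<Sum>i\<in>UNIV. (cmod ((L ** K\<^sup>\<dagger>) $ i $ j))\<^sup>2))"
    by (simp only: r gram_diag of_real_add)
  then have "r = (\<Sum>i\<in>UNIV. (cmod ((K ** K\<^sup>\<dagger>) $ i $ j))\<^sup>2) + (\<Sum>i\<in>UNIV. (cmod ((L ** K\<^sup>\<dagger>) $ i $ j))\<^sup>2)"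
    by (simp only: of_real_eq_iff)
  moreover have "(\<Sum>i\<in>UNIV. (cmod ((K ** K\<^sup>\<dagger>) $ i $ j))\<^sup>2) \<ge> (cmod ((K ** K\<^sup>\<dagger>) $ j $ j))\<^sup>2"
    by (rule member_le_sum) auto
  moreover have "(\<Sum>i\<in>UNIV. (cmod ((L ** K\<^sup>\<dagger>) $ i $ j))\<^sup>2) \<ge> 0" by (intro sum_nonneg) auto
  moreover have "(cmod ((K ** K\<^sup>\<dagger>) $ j $ j))\<^sup>2 = r\<^sup>2" by (simp only: r norm_of_real power2_abs)
  ultimately have "r\<^sup>2 \<le> r" by linarith
  then have "r * (r - 1) \<le> 0" by (simp add: power2_eq_square algebra_simps)
  then show ?thesis
    unfolding r_def[symmetric] by (auto simp: mult_le_0_iff)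
qed

lemma inverse_sqrt_conj: "x > 0 \<Longrightarrow> 1 / sqrt x * x * (1 / sqrt x) = (1::real)"
  by (simp add: field_simps)

text \<open>Jensen's inequality for the logarithm, from \<open>ln x \<le> x - 1\<close>. The weights
  \<open>a\<^sub>j v\<^sub>j / \<theta>\<close> and \<open>\<mu> s / \<theta>\<close> sum to
  one, and with respect to them the mean of the reciprocals of \<open>a\<^sub>j\<close> and
  \<open>\<mu>\<close> is \<open>1 / \<theta>\<close>.\<close>

lemma weighted_ln_sum_le:
  fixes v a :: "'r::finite \<Rightarrow> real"
  assumes a: "\<And>j. a j > 0" and \<mu>: "\<mu> > 0" and v: "\<And>j. v j \<ge> 0" and s: "s \<ge> 0"
    and one: "(\<Sum>j\<in>UNIV. v j) + s = 1" and \<theta>: "\<theta> = (\<Sum>j\<in>UNIV. a j * v j) + \<mu> * s"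
  shows "\<theta> > 0" "ln \<theta> - ln \<mu> \<le> (\<Sum>j\<in>UNIV. a j * v j / \<theta> * (ln (max (a j) \<mu>) - ln \<mu>))"
proof -
  have nn: "0 \<le> (\<Sum>j\<in>UNIV. a j * v j)"
    using a v by (intro sum_nonneg mult_nonneg_nonneg) (auto simp: less_imp_le)
  show pos: "\<theta> > 0"
  proof (cases "s = 0")
    case False
    then show ?thesis using \<theta> nn \<mu> s by (simp add: add_nonneg_pos)
  next
    case True
    then obtain j where "v j \<noteq> 0" using one by (metis add.right_neutral one_neq_zero sum.neutral)
    then have "0 < a j * v j" using a v[of j] by (simp add: less_le)
    also have "\<dots> \<le> (\<Sum>j\<in>UNIV. a j * v j)"
    proof (rule member_le_sum)
      show "0 \<le> a i * v i" for i using a[of i] v[of i] by simp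
    qed auto
    finally show ?thesis using \<theta> True by simp
  qed
  define q where "q j = a j * v j / \<theta>" for j
  have q: "(\<Sum>j\<in>UNIV. q j) + \<mu> * s / \<theta> = 1"
    using pos unfolding q_def sum_divide_distrib[symmetric] add_divide_distrib[symmetric] \<theta>[symmetric]
    by simp
  have lnle: "ln \<theta> - ln b \<le> \<theta> / b - 1" if "b > 0" for b
    using ln_le_minus_one[of "\<theta> / b"] pos that by (simp add: ln_div)
  have "(\<Sum>j\<in>UNIV. q j * (ln \<theta> - ln (a j))) + \<mu> * s / \<theta> * (ln \<theta> - ln \<mu>)
     \<le> (\<Sum>j\<in>UNIV. q j * (\<theta> / a j - 1)) + \<mu> * s / \<theta> * (\<theta> / \<mu> - 1)"
    using pos a \<mu> v s by (intro add_mono sum_mono mult_left_mono lnle) (auto simp: q_def less_imp_le)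
  also have "\<dots> = (\<Sum>j\<in>UNIV. v j - q j) + (s - \<mu> * s / \<theta>)"
  proof -
    have "q j * (\<theta> / a j - 1) = v j - q j" for j
      using pos a[of j] by (simp add: q_def field_simps)
    then show ?thesis using pos \<mu> by (simp add: field_simps)
  qed
  also have "\<dots> = 0" using q one by (simp add: sum_subtractf)
  finally have "(\<Sum>j\<in>UNIV. q j * (ln \<theta> - ln (a j))) + \<mu> * s / \<theta> * (ln \<theta> - ln \<mu>) \<le> 0" .
  moreover have "\<mu> * s / \<theta> = 1 - (\<Sum>j\<in>UNIV. q j)" using q by simp
  ultimately have "(\<Sum>j\<in>UNIV. q j * (ln \<theta> - ln (a j))) + (1 - (\<Sum>j\<in>UNIV. q j)) * (ln \<theta> - ln \<mu>) \<le> 0"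
    by simp
  moreover have "(\<Sum>j\<in>UNIV. q j * (ln \<theta> - ln (a j))) - (\<Sum>j\<in>UNIV. q j) * (ln \<theta> - ln \<mu>)
      = - (\<Sum>j\<in>UNIV. q j * (ln (a j) - ln \<mu>))"
    unfolding sum_distrib_right sum_subtractf[symmetric] sum_negf[symmetric]
    by (intro sum.cong) (auto simp: algebra_simps)
  ultimately have "ln \<theta> - ln \<mu> \<le> (\<Sum>j\<in>UNIV. q j * (ln (a j) - ln \<mu>))"
    by (simp add: algebra_simps)
  also have "\<dots> \<le> (\<Sum>j\<in>UNIV. q j * (ln (max (a j) \<mu>) - ln \<mu>))"
    using pos a v \<mu> by (intro sum_mono mult_left_mono) (auto simp: q_def less_imp_le ln_le_cancel_iff max_def)
  finally show "ln \<theta> - ln \<mu> \<le> (\<Sum>j\<in>UNIV. a j * v j / \<theta> * (ln (max (a j) \<mu>) - ln \<mu>))"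
    unfolding q_def .
qed

text \<open>The variational principle for products of the largest eigenvalues. Diagonalise the two
  quadratic forms simultaneously: the ratio of the determinants becomes a product of numbers
  \<open>\<theta>\<^sub>i\<close>, each of them a weighted mean of the \<open>a\<^sub>j\<close>
  and \<open>\<mu>\<close>. Bounding \<open>ln \<theta>\<^sub>i\<close> by Jensen's inequality
  and summing over \<open>i\<close>, every \<open>a\<^sub>j\<close> receives a total weight of
  at most one by Bessel's inequality. If \<open>\<mu>\<close> separates the \<open>k\<close>
  largest \<open>a\<^sub>j\<close> from the others, the right-hand side is, up to a power of
  \<open>\<mu>\<close>, the product of these \<open>k\<close> numbers.\<close>

lemma det_weighted_gram_le:
  fixes V S :: "complex^'n^'n"
  assumes a: "\<And>j. a j > 0" and \<mu>: "\<mu> > 0" and N: "det (V\<^sup>\<dagger> ** V + S\<^sup>\<dagger> ** S) \<noteq> 0"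
  shows "cmod (det (V\<^sup>\<dagger> ** rdiag a ** V + \<mu> *\<^sub>R (S\<^sup>\<dagger> ** S)))
    \<le> (\<Prod>j\<in>UNIV. max (a j) \<mu>) * cmod (det (V\<^sup>\<dagger> ** V + S\<^sup>\<dagger> ** S))"
proof -
  define N where "N = V\<^sup>\<dagger> ** V + S\<^sup>\<dagger> ** S"
  define H where "H = V\<^sup>\<dagger> ** rdiag a ** V + \<mu> *\<^sub>R (S\<^sup>\<dagger> ** S)"
  have "N\<^sup>\<dagger> = N" by (simp add: N_def ct_simps)
  then obtain U :: "complex^'n^'n" and d where U: "U\<^sup>\<dagger> ** U = mat 1" "U ** U\<^sup>\<dagger> = mat 1" "N = U ** rdiag d ** U\<^sup>\<dagger>"
    by (rule hermitian_spectral)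
  have UNU: "U\<^sup>\<dagger> ** N ** U = rdiag d"
  proof -
    have "U\<^sup>\<dagger> ** N ** U = (U\<^sup>\<dagger> ** U) ** rdiag d ** (U\<^sup>\<dagger> ** U)" by (simp add: U(3) matrix_mul_assoc)
    then show ?thesis by (simp add: U)
  qed
  have D: "rdiag d = (V ** U)\<^sup>\<dagger> ** (V ** U) + (S ** U)\<^sup>\<dagger> ** (S ** U)"
    unfolding UNU[symmetric] by (simp add: N_def ct_simps matrix_distribs matrix_mul_assoc)
  have d0: "d i \<ge> 0" for i
  proof -
    have "complex_of_real (d i) = rdiag d $ i $ i" by (simp add: rdiag_def)
    also have "\<dots> = of_real ((\<Sum>j\<in>UNIV. (cmod ((V ** U) $ j $ i))\<^sup>2) + (\<Sum>j\<in>UNIV. (cmod ((S ** U) $ j $ i))\<^sup>2))"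
      by (subst D) (simp only: vector_add_component gram_diag of_real_add)
    finally have "d i = (\<Sum>j\<in>UNIV. (cmod ((V ** U) $ j $ i))\<^sup>2) + (\<Sum>j\<in>UNIV. (cmod ((S ** U) $ j $ i))\<^sup>2)"
      by (simp only: of_real_eq_iff)
    then show ?thesis by (simp add: sum_nonneg)
  qed
  have "cmod (det N) = cmod (det (rdiag d))"
    by (simp add: U(3) cmod_det_unitary_conj U(1))
  then have "det (rdiag d) \<noteq> 0" using N unfolding N_def[symmetric] by auto
  then have dpos: "d i > 0" for i
    using d0[of i] by (auto simp: det_rdiag less_le)
  \<comment> \<open>Simultaneous diagonalisation: normalise \<open>N\<close> to the identity, then diagonalise what \<open>H\<close> becomes.\<close>
  define C where "C = U ** rdiag (\<lambda>i. 1 / sqrt (d i))"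
  have C: "C\<^sup>\<dagger> ** N ** C = mat 1"
  proof -
    have "C\<^sup>\<dagger> ** N ** C = rdiag (\<lambda>i. 1 / sqrt (d i)) ** (U\<^sup>\<dagger> ** N ** U) ** rdiag (\<lambda>i. 1 / sqrt (d i))"
      by (simp add: C_def ct_simps matrix_mul_assoc)
    also have "\<dots> = rdiag (\<lambda>i. 1)"
      unfolding UNU rdiag_mult by (simp only: inverse_sqrt_conj[OF dpos])
    finally show ?thesis by (simp add: rdiag_1)
  qed
  define H' where "H' = C\<^sup>\<dagger> ** H ** C"
  have "H'\<^sup>\<dagger> = H'" by (simp add: H'_def H_def ct_simps matrix_mul_assoc)
  then obtain U2 :: "complex^'n^'n" and \<theta> where U2: "U2\<^sup>\<dagger> ** U2 = mat 1" "U2 ** U2\<^sup>\<dagger> = mat 1" "H' = U2 ** rdiag \<theta> ** U2\<^sup>\<dagger>"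
    by (rule hermitian_spectral)
  define X where "X = C ** U2"
  have XN: "X\<^sup>\<dagger> ** N ** X = mat 1"
  proof -
    have "X\<^sup>\<dagger> ** N ** X = U2\<^sup>\<dagger> ** (C\<^sup>\<dagger> ** N ** C) ** U2" by (simp add: X_def ct_simps matrix_mul_assoc)
    then show ?thesis by (simp add: C U2)
  qed
  have XH: "X\<^sup>\<dagger> ** H ** X = rdiag \<theta>"
  proof -
    have "X\<^sup>\<dagger> ** H ** X = U2\<^sup>\<dagger> ** H' ** U2" by (simp add: X_def H'_def ct_simps matrix_mul_assoc)
    also have "\<dots> = (U2\<^sup>\<dagger> ** U2) ** rdiag \<theta> ** (U2\<^sup>\<dagger> ** U2)" by (simp add: U2(3) matrix_mul_assoc)
    finally show ?thesis by (simp add: U2)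
  qed
  define V' where "V' = V ** X"
  define S' where "S' = S ** X"
  have N1: "V'\<^sup>\<dagger> ** V' + S'\<^sup>\<dagger> ** S' = mat 1"
    unfolding XN[symmetric] by (simp add: V'_def S'_def N_def ct_simps matrix_distribs matrix_mul_assoc)
  have H1: "V'\<^sup>\<dagger> ** rdiag a ** V' + \<mu> *\<^sub>R (S'\<^sup>\<dagger> ** S') = rdiag \<theta>"
    unfolding XH[symmetric] by (simp add: V'_def S'_def H_def ct_simps matrix_distribs matrix_mul_assoc)
  have raa: "rdiag (\<lambda>j. sqrt (a j)) ** rdiag (\<lambda>j. sqrt (a j)) = rdiag a"
    using a by (simp add: rdiag_mult less_imp_le)
  define v where "v j i = (cmod (V' $ j $ i))\<^sup>2" for j i
  define s where "s i = (\<Sum>j\<in>UNIV. (cmod (S' $ j $ i))\<^sup>2)" for i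
  have one: "(\<Sum>j\<in>UNIV. v j i) + s i = 1" for i
  proof -
    have "(V'\<^sup>\<dagger> ** V' + S'\<^sup>\<dagger> ** S') $ i $ i = of_real ((\<Sum>j\<in>UNIV. v j i) + s i)"
      by (simp only: vector_add_component gram_diag of_real_add v_def s_def)
    then have "complex_of_real ((\<Sum>j\<in>UNIV. v j i) + s i) = of_real 1"
      unfolding N1 by (simp add: mat_def)
    then show ?thesis by (simp only: of_real_eq_iff)
  qed
  have \<theta>: "\<theta> i = (\<Sum>j\<in>UNIV. a j * v j i) + \<mu> * s i" for i
  proof -
    have 1: "V'\<^sup>\<dagger> ** rdiag a ** V' = (rdiag (\<lambda>j. sqrt (a j)) ** V')\<^sup>\<dagger> ** (rdiag (\<lambda>j. sqrt (a j)) ** V')"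
      by (simp add: ct_simps matrix_mul_assoc) (metis matrix_mul_assoc raa)
    have "complex_of_real (\<theta> i) = rdiag \<theta> $ i $ i" by (simp add: rdiag_def)
    also have "\<dots> = of_real ((\<Sum>j\<in>UNIV. (cmod ((rdiag (\<lambda>j. sqrt (a j)) ** V') $ j $ i))\<^sup>2) + \<mu> * s i)"
      unfolding H1[symmetric] 1
      by (simp only: vector_add_component gram_diag vector_scaleR_component of_real_add of_real_mult s_def
          scaleR_conv_of_real[where 'a=complex])
    finally have "\<theta> i = (\<Sum>j\<in>UNIV. (cmod ((rdiag (\<lambda>j. sqrt (a j)) ** V') $ j $ i))\<^sup>2) + \<mu> * s i"
      by (simp only: of_real_eq_iff)
    then show ?thesis using a
      by (simp add: rdiag_mult_nth norm_mult power_mult_distrib v_def less_imp_le)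
  qed
  have v0: "v j i \<ge> 0" and s0: "s i \<ge> 0" for i j by (simp_all add: v_def s_def sum_nonneg)
  note w = weighted_ln_sum_le[OF a \<mu> v0 s0 one \<theta>]
  define b where "b j = ln (max (a j) \<mu>) - ln \<mu>" for j
  have b0: "b j \<ge> 0" for j using \<mu> by (simp add: b_def max_def)
  define K where "K = rdiag (\<lambda>j. sqrt (a j)) ** V' ** rdiag (\<lambda>i. 1 / sqrt (\<theta> i))"
  define L where "L = sqrt \<mu> *\<^sub>R (S' ** rdiag (\<lambda>i. 1 / sqrt (\<theta> i)))"
  have "K\<^sup>\<dagger> ** K + L\<^sup>\<dagger> ** L = rdiag (\<lambda>i. 1 / sqrt (\<theta> i)) **
      (V'\<^sup>\<dagger> ** (rdiag (\<lambda>j. sqrt (a j)) ** rdiag (\<lambda>j. sqrt (a j))) ** V' + \<mu> *\<^sub>R (S'\<^sup>\<dagger> ** S')) ** rdiag (\<lambda>i. 1 / sqrt (\<theta> i))"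
    using \<mu> by (simp add: K_def L_def ct_simps matrix_distribs matrix_mul_assoc)
  also have "\<dots> = rdiag (\<lambda>i. 1)"
    unfolding raa H1 rdiag_mult by (simp only: inverse_sqrt_conj[OF w(1)])
  finally have KL: "K\<^sup>\<dagger> ** K + L\<^sup>\<dagger> ** L = mat 1" by (simp add: rdiag_1)
  have q: "(cmod (K $ j $ i))\<^sup>2 = a j * v j i / \<theta> i" for j i
    using a[of j] w(1)[of i]
    by (simp add: K_def mult_rdiag_nth rdiag_mult_nth norm_mult norm_divide power_mult_distrib v_def
        power_divide less_imp_le)
  have "(\<Sum>i\<in>UNIV. ln (\<theta> i) - ln \<mu>) \<le> (\<Sum>i\<in>UNIV. \<Sum>j\<in>UNIV. a j * v j i / \<theta> i * b j)"
    unfolding b_def by (intro sum_mono w(2))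
  also have "\<dots> = (\<Sum>j\<in>UNIV. (\<Sum>i\<in>UNIV. (cmod (K $ j $ i))\<^sup>2) * b j)"
    unfolding q by (subst sum.swap) (simp only: sum_distrib_right)
  also have "\<dots> \<le> (\<Sum>j\<in>UNIV. 1 * b j)"
    by (intro sum_mono mult_right_mono row_norm_le_one[OF KL] b0)
  finally have "(\<Sum>i\<in>UNIV. ln (\<theta> i)) \<le> (\<Sum>j\<in>UNIV. ln (max (a j) \<mu>))"
    by (simp add: b_def sum_subtractf)
  moreover have "(\<Sum>i\<in>UNIV. ln (\<theta> i)) = ln (\<Prod>i\<in>UNIV. \<theta> i)"
  proof (rule ln_prod[symmetric])
    show "\<theta> i \<noteq> 0" for i using w(1)[of i] by simp
  qed simp
  moreover have "(\<Sum>i\<in>UNIV. ln (max (a i) \<mu>)) = ln (\<Prod>i\<in>UNIV. max (a i) \<mu>)"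
    using \<mu> by (subst ln_prod) (auto simp: max_def)
  moreover have pp: "0 < (\<Prod>i\<in>UNIV. \<theta> i)" "0 < (\<Prod>i\<in>UNIV. max (a i) \<mu>)"
    using w(1) \<mu> by (auto intro!: prod_pos simp: less_max_iff_disj)
  ultimately have le: "(\<Prod>i\<in>UNIV. \<theta> i) \<le> (\<Prod>i\<in>UNIV. max (a i) \<mu>)" by simp
  have cm: "cmod (det (X\<^sup>\<dagger> ** M ** X)) = cmod (det M) * (cmod (det X))\<^sup>2" for M
    by (simp add: det_mul det_ct norm_mult power2_eq_square)
  have dN: "cmod (det N) * (cmod (det X))\<^sup>2 = 1" using cm[of N] by (simp add: XN)
  have dH: "cmod (det H) * (cmod (det X))\<^sup>2 = (\<Prod>i\<in>UNIV. \<theta> i)"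
  proof -
    have "cmod (det (rdiag \<theta>)) = \<bar>\<Prod>i\<in>UNIV. \<theta> i\<bar>"
      by (simp add: det_rdiag del: of_real_prod)
    then show ?thesis using cm[of H] pp(1) by (simp add: XH)
  qed
  have "cmod (det H) = cmod (det H) * (cmod (det N) * (cmod (det X))\<^sup>2)" by (simp add: dN)
  also have "\<dots> = (\<Prod>i\<in>UNIV. \<theta> i) * cmod (det N)" using dH by (simp add: mult_ac)
  also have "\<dots> \<le> (\<Prod>i\<in>UNIV. max (a i) \<mu>) * cmod (det N)" by (intro mult_right_mono le) simp
  finally show ?thesis unfolding H_def N_def .
qed

lemma norm_prod_one_plus_expansion:
  "\<exists>C\<ge>0. \<forall>(x :: 'a \<Rightarrow> complex) t. (\<forall>i\<in>I. cmod (x i) \<le> t) \<and> t \<le> 1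
     \<longrightarrow> cmod ((\<Prod>i\<in>I. 1 + x i) - 1 - (\<Sum>i\<in>I. x i)) \<le> C * t\<^sup>2" if "finite I"
  using that
proof (induction I rule: finite_induct)
  case (insert k I)
  then obtain C where C: "C \<ge> 0" "\<And>(x :: 'a \<Rightarrow> complex) t. \<lbrakk>\<forall>i\<in>I. cmod (x i) \<le> t; t \<le> 1\<rbrakk>
     \<Longrightarrow> cmod ((\<Prod>i\<in>I. 1 + x i) - 1 - (\<Sum>i\<in>I. x i)) \<le> C * t\<^sup>2" by blast
  show ?case
  proof (intro exI[of _ "C + (C + card I)"] conjI allI impI)
    fix x :: "'a \<Rightarrow> complex" and t assume A: "(\<forall>i\<in>insert k I. cmod (x i) \<le> t) \<and> t \<le> 1"
    then have t: "0 \<le> t" "t \<le> 1" by (auto intro: order_trans[OF norm_ge_zero])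
    define E where "E = (\<Prod>i\<in>I. 1 + x i) - 1 - (\<Sum>i\<in>I. x i)"
    have E: "cmod E \<le> C * t\<^sup>2" unfolding E_def using A by (intro C(2)) auto
    have S: "cmod (\<Sum>i\<in>I. x i) \<le> card I * t" using A by (intro sum_norm_bound) auto
    have "t\<^sup>2 \<le> t" using t by (simp add: power2_eq_square mult_left_le)
    then have "cmod (E + (\<Sum>i\<in>I. x i)) \<le> C * t + card I * t"
      using E S C(1) norm_triangle_ineq[of E "\<Sum>i\<in>I. x i"] mult_left_mono[of "t\<^sup>2" t C] by linarith
    then have "cmod (x k) * cmod (E + (\<Sum>i\<in>I. x i)) \<le> t * (C * t + card I * t)"
      using A t by (intro mult_mono) auto
    then have "cmod (E + x k * (E + (\<Sum>i\<in>I. x i))) \<le> C * t\<^sup>2 + t * (C * t + card I * t)"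
      using E by (intro norm_triangle_mono) (auto simp: norm_mult)
    moreover have "(\<Prod>i\<in>insert k I. 1 + x i) - 1 - (\<Sum>i\<in>insert k I. x i) = E + x k * (E + (\<Sum>i\<in>I. x i))"
      using insert(1,2) by (simp add: E_def algebra_simps)
    ultimately show "cmod ((\<Prod>i\<in>insert k I. 1 + x i) - 1 - (\<Sum>i\<in>insert k I. x i)) \<le> (C + (C + card I)) * t\<^sup>2"
      by (simp add: algebra_simps power2_eq_square)
  qed (use C in auto)
qed (auto intro!: exI[of _ 0])

lemma cmod_entry_le: "cmod ((X::complex^'n^'m) $ i $ j) \<le> norm X"
  using Finite_Cartesian_Product.norm_nth_le[where x = "X $ i" and i = j] Finite_Cartesian_Product.norm_nth_le[where x = X and i = i] by linarith

lemma cmod_trace_le: "cmod (trace (X::complex^'n^'n)) \<le> CARD('n) * norm X"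
  unfolding trace_def by (rule sum_norm_bound) (rule cmod_entry_le)

text \<open>In the Leibniz formula the identity contributes one plus the trace up to second order; every
  other permutation moves at least two indices and therefore picks up two small factors.\<close>

lemma det_one_plus_expansion:
  "\<exists>C\<ge>0. \<forall>X::complex^'n^'n. norm X \<le> 1 \<longrightarrow> cmod (det (mat 1 + X) - 1 - trace X) \<le> C * (norm X)\<^sup>2"
proof -
  obtain C where C: "C \<ge> 0" "\<And>(x :: 'n \<Rightarrow> complex) t. \<lbrakk>\<forall>i\<in>UNIV. cmod (x i) \<le> t; t \<le> 1\<rbrakk>
     \<Longrightarrow> cmod ((\<Prod>i\<in>UNIV. 1 + x i) - 1 - (\<Sum>i\<in>UNIV. x i)) \<le> C * t\<^sup>2"
    using norm_prod_one_plus_expansion[of "UNIV :: 'n set"] by auto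
  define P where "P = {p. p permutes (UNIV :: 'n set)}"
  have fP: "finite P" unfolding P_def by (rule finite_permutations) simp
  have idP: "id \<in> P" by (simp add: P_def permutes_id)
  show ?thesis
  proof (intro exI[of _ "C + card P * 2 ^ CARD('n)"] conjI allI impI)
    fix X :: "complex^'n^'n" assume X: "norm X \<le> 1"
    define t where "t = norm X"
    define A where "A = mat 1 + X"
    have entry: "cmod (A $ i $ j) \<le> 2" for i j
    proof -
      have "cmod (A $ i $ j) \<le> cmod (mat 1 $ i $ j :: complex) + cmod (X $ i $ j)"
        by (simp add: A_def norm_triangle_ineq)
      also have "\<dots> \<le> 1 + 1" using cmod_entry_le[of X i j] X by (intro add_mono) (auto simp: mat_def)
      finally show ?thesis by simp
    qed
    have off: "cmod (A $ i $ j) \<le> t" if "i \<noteq> j" for i j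
      using that cmod_entry_le[of X i j] by (simp add: A_def mat_def t_def)
    have perm: "cmod (of_int (sign p) * (\<Prod>i\<in>UNIV. A $ i $ p i)) \<le> 2 ^ CARD('n) * t\<^sup>2" if p: "p \<in> P - {id}" for p
    proof -
      from p obtain i where i: "p i \<noteq> i" by (auto simp: fun_eq_iff)
      have "inj p" using p by (auto simp: P_def intro: permutes_inj)
      then have i2: "p (p i) \<noteq> p i" using i by (auto dest: injD)
      have "(\<Prod>j\<in>UNIV. cmod (A $ j $ p j)) = cmod (A $ i $ p i) * (cmod (A $ p i $ p (p i)) * (\<Prod>j\<in>UNIV - {i} - {p i}. cmod (A $ j $ p j)))"
        using i by (subst prod.remove[of _ i]) (simp_all, subst prod.remove[of _ "p i"], simp_all)
      also have "\<dots> \<le> t * (t * 2 ^ card (UNIV - {i} - {p i}))"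
      proof (intro mult_mono off)
        have "(\<Prod>j\<in>UNIV - {i} - {p i}. cmod (A $ j $ p j)) \<le> (\<Prod>j\<in>UNIV - {i} - {p i}. 2)"
          by (intro prod_mono) (auto simp: entry)
        then show "(\<Prod>j\<in>UNIV - {i} - {p i}. cmod (A $ j $ p j)) \<le> 2 ^ card (UNIV - {i} - {p i})" by simp
      qed (use i i2 in \<open>auto simp: t_def intro!: prod_nonneg mult_nonneg_nonneg\<close>)
      also have "\<dots> \<le> t * (t * 2 ^ CARD('n))"
        by (intro mult_left_mono power_increasing card_mono) (auto simp: t_def)
      also have "\<dots> = 2 ^ CARD('n) * t\<^sup>2" by (simp add: power2_eq_square)
      finally show ?thesis
        by (simp add: norm_mult sign_def flip: prod_norm)
    qed
    have "det A = (\<Sum>p\<in>P. of_int (sign p) * (\<Prod>i\<in>UNIV. A $ i $ p i))"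
      by (simp add: det_def P_def)
    also have "\<dots> = (\<Prod>i\<in>UNIV. 1 + X $ i $ i) + (\<Sum>p\<in>P - {id}. of_int (sign p) * (\<Prod>i\<in>UNIV. A $ i $ p i))"
      using fP idP by (subst sum.remove[of _ id]) (simp_all add: sign_id A_def mat_def)
    finally have "det A - 1 - trace X = ((\<Prod>i\<in>UNIV. 1 + X $ i $ i) - 1 - (\<Sum>i\<in>UNIV. X $ i $ i))
       + (\<Sum>p\<in>P - {id}. of_int (sign p) * (\<Prod>i\<in>UNIV. A $ i $ p i))"
      by (simp add: trace_def)
    also have "cmod \<dots> \<le> C * t\<^sup>2 + card P * (2 ^ CARD('n) * t\<^sup>2)"
    proof (intro norm_triangle_mono C(2))
      have "cmod (\<Sum>p\<in>P - {id}. of_int (sign p) * (\<Prod>i\<in>UNIV. A $ i $ p i)) \<le> card (P - {id}) * (2 ^ CARD('n) * t\<^sup>2)"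
        by (intro sum_norm_bound perm)
      also have "\<dots> \<le> card P * (2 ^ CARD('n) * t\<^sup>2)"
        using fP by (intro mult_right_mono) (auto intro: card_mono)
      finally show "cmod (\<Sum>p\<in>P - {id}. of_int (sign p) * (\<Prod>i\<in>UNIV. A $ i $ p i)) \<le> card P * (2 ^ CARD('n) * t\<^sup>2)" .
    qed (use X cmod_entry_le in \<open>auto simp: t_def\<close>)
    finally show "cmod (det (mat 1 + X) - 1 - trace X) \<le> (C + card P * 2 ^ CARD('n)) * (norm X)\<^sup>2"
      by (simp add: A_def t_def algebra_simps)
  qed (use C in auto)
qed

lemma ln_det_one_plus_ge:
  "\<exists>C r. C \<ge> 0 \<and> r > 0 \<and> r \<le> 1 \<and> (\<forall>X::complex^'n^'n. norm X \<le> r \<longrightarrow>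
      det (mat 1 + X) \<noteq> 0 \<and> ln (cmod (det (mat 1 + X))) \<ge> Re (trace X) - C * (norm X)\<^sup>2)"
proof -
  obtain C where C: "C \<ge> 0" "\<And>X::complex^'n^'n. norm X \<le> 1 \<Longrightarrow> cmod (det (mat 1 + X) - 1 - trace X) \<le> C * (norm X)\<^sup>2"
    using det_one_plus_expansion by blast
  define D where "D = CARD('n) + C"
  have D: "D > 0" using C(1) by (simp add: D_def add_pos_nonneg)
  define r where "r = min 1 (1 / (2 * D))"
  have r: "r > 0" "r \<le> 1" "D * r \<le> 1 / 2" using D by (auto simp: r_def min_def field_simps)
  show ?thesis
  proof (rule exI[of _ "C + 2 * D\<^sup>2"], rule exI[of _ r], intro conjI allI impI)
    fix X :: "complex^'n^'n" assume X: "norm X \<le> r"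
    define t where "t = norm X"
    have t: "0 \<le> t" "t \<le> r" "t \<le> 1" using X r by (auto simp: t_def)
    then have "t\<^sup>2 \<le> t" by (simp add: power2_eq_square mult_left_le)
    define u where "u = Re (trace X) - C * t\<^sup>2"
    have tr: "\<bar>Re (trace X)\<bar> \<le> CARD('n) * t"
      unfolding t_def using abs_Re_le_cmod cmod_trace_le order_trans by blast
    have "\<bar>u\<bar> \<le> CARD('n) * t + C * t"
      using tr mult_left_mono[OF \<open>t\<^sup>2 \<le> t\<close> C(1)] C(1) zero_le_power2[of t] unfolding u_def
      by (smt (verit) mult_nonneg_nonneg)
    then have u: "\<bar>u\<bar> \<le> D * t" by (simp add: D_def algebra_simps)
    also have "\<dots> \<le> D * r" using D t by (intro mult_left_mono) auto
    finally have u2: "\<bar>u\<bar> \<le> 1 / 2" using r by simp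
    have "\<bar>Re (det (mat 1 + X) - 1 - trace X)\<bar> \<le> C * t\<^sup>2"
      using C(2)[of X] t by (intro order_trans[OF abs_Re_le_cmod]) (auto simp: t_def)
    then have "1 + u \<le> Re (det (mat 1 + X))" unfolding u_def by simp
    also have "\<dots> \<le> cmod (det (mat 1 + X))" by (rule complex_Re_le_cmod)
    finally have le: "1 + u \<le> cmod (det (mat 1 + X))" .
    then show "det (mat 1 + X) \<noteq> 0" using u2 by auto
    have "u - 2 * u\<^sup>2 \<le> ln (1 + u)"
      using abs_ln_one_plus_x_minus_x_bound[OF u2] by linarith
    also have "\<dots> \<le> ln (cmod (det (mat 1 + X)))" using le u2 by (intro ln_mono) auto
    finally have "u - 2 * u\<^sup>2 \<le> ln (cmod (det (mat 1 + X)))" .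
    moreover have "u\<^sup>2 \<le> D\<^sup>2 * t\<^sup>2"
      using power_mono[OF u abs_ge_zero, of 2] by (simp add: power_mult_distrib)
    ultimately show "ln (cmod (det (mat 1 + X))) \<ge> Re (trace X) - (C + 2 * D\<^sup>2) * (norm X)\<^sup>2"
      unfolding u_def t_def by (simp add: algebra_simps)
  qed (use r C in auto)
qed

section \<open>Perturbation of the product of the largest eigenvalues\<close>

text \<open>A lower bound for the norm of a quotient \<open>B P\<^sup>-\<^sup>1\<close>, with
  \<open>X\<close> in the role of the quotient, which does not mention the inverse of
  \<open>P\<close>.\<close>

lemma norm_right_quotient_ge:
  fixes X :: "complex^'n^'m" and P :: "complex^'n^'n"
  shows "norm (X ** P) / (1 + norm (P - mat 1)) \<le> norm X"
proof -
  have "X ** P = X + X ** (P - mat 1)" by (simp add: matrix_distribs)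
  then have "norm (X ** P) \<le> norm X + norm X * norm (P - mat 1)"
    using norm_triangle_ineq[of X "X ** (P - mat 1)"] norm_matrix_mult_le[of X "P - mat 1"] by simp
  moreover have "1 + norm (P - mat 1) > 0" by (simp add: add_pos_nonneg)
  ultimately show ?thesis by (simp add: divide_le_eq algebra_simps)
qed

lemma right_divide_matrix:
  fixes P :: "complex^'n^'n" and B :: "complex^'n^'m"
  assumes "det P \<noteq> 0"
  shows "(B ** matrix_inv P) ** P = B"
proof -
  have "invertible P" using assms by (simp add: invertible_det_nz)
  then have "matrix_inv P ** P = mat 1" unfolding matrix_inv_def invertible_def by (rule someI2_ex) blast
  then show ?thesis by (simp flip: matrix_mul_assoc)
qed

text \<open>Split the columns of the perturbed frame \<open>J + Y\<close> into the component along the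
  original frame and the orthogonal one. The second component only adds to the Gram determinant,
  and this gain is of second order in \<open>Y\<close>.\<close>

lemma det_frame_gram_ge:
  fixes J J' Y :: "complex^'n^'n"
  assumes J: "J\<^sup>\<dagger> = J" "J'\<^sup>\<dagger> = J'" "J ** J = J" "J' ** J' = J'" "J + J' = mat 1"
    and P: "det (mat 1 + J ** Y) \<noteq> 0"
  shows "cmod (det ((J + Y)\<^sup>\<dagger> ** (J + Y) + J'))
    \<ge> (cmod (det (mat 1 + J ** Y)))\<^sup>2 * (1 + (norm (J' ** Y) / (1 + norm (J ** Y)))\<^sup>2)"
proof -
  define P where "P = mat 1 + J ** Y"
  define B where "B = J' ** Y"
  have detP: "det P \<noteq> 0" using assms(6) by (simp add: P_def)
  define X where "X = B ** matrix_inv P"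
  have XP: "X ** P = B" unfolding X_def by (rule right_divide_matrix[OF detP])
  have a1: "A ** J ** J = A ** J" for A :: "complex^'n^'n" by (simp add: J flip: matrix_mul_assoc)
  have a2: "A ** J' ** J' = A ** J'" for A :: "complex^'n^'n" by (simp add: J flip: matrix_mul_assoc)
  have J': "J' = mat 1 - J" using J(5) by (simp add: algebra_simps)
  have eq: "(J + Y)\<^sup>\<dagger> ** (J + Y) + J' = P\<^sup>\<dagger> ** P + B\<^sup>\<dagger> ** B"
    by (simp add: P_def B_def ct_simps matrix_distribs matrix_mul_assoc J a1 a2)
       (simp add: J' matrix_distribs algebra_simps)
  have "cmod (det (P\<^sup>\<dagger> ** P + B\<^sup>\<dagger> ** B)) \<ge> (cmod (det P))\<^sup>2 * (1 + (norm X)\<^sup>2)"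
    using det_gram_plus_ge[of P X "0::complex^'n^'n"] by (simp add: XP)
  moreover have "(norm B / (1 + norm (P - mat 1)))\<^sup>2 \<le> (norm X)\<^sup>2"
    using norm_right_quotient_ge[of X P] by (intro power_mono) (auto simp: XP intro!: divide_nonneg_nonneg)
  ultimately show ?thesis
    unfolding eq using mult_left_mono[of "1 + (norm B / (1 + norm (P - mat 1)))\<^sup>2" "1 + (norm X)\<^sup>2" "(cmod (det P))\<^sup>2"]
    by (simp add: P_def B_def)
qed

text \<open>The compression of \<open>Z\<^sup>* Z + e\<close> to the frame \<open>V\<close> consists of
  the part seen through the unperturbed left singular vectors, which is \<open>N \<Lambda>
  N\<close>, and of two Gram matrices of what these vectors miss. The assumptions on
  \<open>Q\<close> and \<open>V\<close> say that \<open>V\<close> is the image of the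
  unperturbed left singular vectors under the adjoint of the perturbed matrix.\<close>

lemma compressed_gram_decomposition:
  fixes Z Q :: "complex^'n^'m" and J V D \<Lambda> :: "complex^'n^'n" and e :: real
  assumes herm: "J\<^sup>\<dagger> = J" "D\<^sup>\<dagger> = D" "\<Lambda>\<^sup>\<dagger> = \<Lambda>" and JJ: "J ** J = J" and D: "D ** \<Lambda> = J" "\<Lambda> ** D = J"
    and J\<Lambda>: "J ** \<Lambda> = \<Lambda> ** J" and VJ: "V ** J = V"
    and ZQ: "Z\<^sup>\<dagger> ** Q = V - e *\<^sub>R D"
    and QQ: "\<Lambda> ** (Q\<^sup>\<dagger> ** Q) ** \<Lambda> = J ** \<Lambda> - e *\<^sub>R J"
  defines "N \<equiv> V\<^sup>\<dagger> ** V"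
  defines "R \<equiv> Z ** V - Q ** \<Lambda> ** N"
  defines "R2 \<equiv> V - J ** N"
  shows "V\<^sup>\<dagger> ** (Z\<^sup>\<dagger> ** Z) ** V + e *\<^sub>R (V\<^sup>\<dagger> ** V) = N ** \<Lambda> ** N + R\<^sup>\<dagger> ** R + e *\<^sub>R (R2\<^sup>\<dagger> ** R2)"
proof -
  have Nct: "N\<^sup>\<dagger> = N" by (simp add: N_def ct_simps)
  have JV: "J ** V\<^sup>\<dagger> = V\<^sup>\<dagger>" using arg_cong[OF VJ, of conj_transpose] by (simp add: ct_simps herm)
  have NJ: "N ** J = N" by (simp add: N_def VJ flip: matrix_mul_assoc)
  have JN: "J ** N = N" by (simp add: N_def JV matrix_mul_assoc)
  have QZ: "Q\<^sup>\<dagger> ** Z = V\<^sup>\<dagger> - e *\<^sub>R D" using arg_cong[OF ZQ, of conj_transpose] by (simp add: ct_simps herm)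
  have "R\<^sup>\<dagger> ** R = V\<^sup>\<dagger> ** (Z\<^sup>\<dagger> ** Z) ** V - V\<^sup>\<dagger> ** (Z\<^sup>\<dagger> ** Q) ** \<Lambda> ** N
     - N ** \<Lambda> ** (Q\<^sup>\<dagger> ** Z) ** V + N ** (\<Lambda> ** (Q\<^sup>\<dagger> ** Q) ** \<Lambda>) ** N"
    by (simp add: R_def ct_simps matrix_distribs matrix_mul_assoc Nct herm)
  moreover have "V\<^sup>\<dagger> ** (Z\<^sup>\<dagger> ** Q) ** \<Lambda> ** N = N ** \<Lambda> ** N - e *\<^sub>R (V\<^sup>\<dagger> ** J ** N)"
  proof -
    have "V\<^sup>\<dagger> ** (Z\<^sup>\<dagger> ** Q) ** \<Lambda> ** N = (V\<^sup>\<dagger> ** V) ** \<Lambda> ** N - e *\<^sub>R (V\<^sup>\<dagger> ** (D ** \<Lambda>) ** N)"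
      by (simp add: ZQ matrix_distribs matrix_mul_assoc)
    then show ?thesis by (simp add: D N_def)
  qed
  moreover have "N ** \<Lambda> ** (Q\<^sup>\<dagger> ** Z) ** V = N ** \<Lambda> ** N - e *\<^sub>R (N ** J ** V)"
  proof -
    have "N ** \<Lambda> ** (Q\<^sup>\<dagger> ** Z) ** V = N ** \<Lambda> ** (V\<^sup>\<dagger> ** V) - e *\<^sub>R (N ** (\<Lambda> ** D) ** V)"
      by (simp add: QZ matrix_distribs matrix_mul_assoc)
    then show ?thesis by (simp add: D N_def)
  qed
  moreover have "N ** (\<Lambda> ** (Q\<^sup>\<dagger> ** Q) ** \<Lambda>) ** N = N ** \<Lambda> ** N - e *\<^sub>R (N ** N)"
  proof -
    have "N ** (J ** \<Lambda> - e *\<^sub>R J) ** N = (N ** J) ** \<Lambda> ** N - e *\<^sub>R (N ** (J ** N))"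
      by (simp add: matrix_distribs matrix_mul_assoc)
    then show ?thesis by (simp add: QQ NJ JN)
  qed
  moreover have "R2\<^sup>\<dagger> ** R2 = V\<^sup>\<dagger> ** V - V\<^sup>\<dagger> ** J ** N - N ** J ** V + N ** N"
  proof -
    have "R2\<^sup>\<dagger> ** R2 = V\<^sup>\<dagger> ** V - V\<^sup>\<dagger> ** J ** N - N ** J ** V + N ** (J ** J) ** N"
      by (simp add: R2_def ct_simps matrix_distribs matrix_mul_assoc Nct herm)
    then show ?thesis by (simp add: JJ NJ)
  qed
  ultimately show ?thesis by (simp add: scaleR_add_right scaleR_diff_right)
qed

text \<open>The key estimate. Let \<open>\<kappa>\<^sub>i\<close> be the eigenvalues of
  \<open>Z\<^sub>0\<^sup>* Z\<^sub>0 + e\<close> and \<open>a\<^sub>i\<close> those of the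
  perturbed matrix, and let \<open>S\<close> single out the largest ones. The variational
  principle is applied to the frame \<open>J + Y\<close>, obtained from the old right singular
  vectors by one step of a power iteration with the perturbed matrix. The terms on the right
  have separate origins: the determinant is \<open>|det(1 + J Y)|\<^sup>2\<close>, a modulus of
  a polynomial in the complex conjugate of \<open>W\<close>; the two others are the gains from
  rotating the right and the left singular vectors. A fixed frame would only see one of these
  two gains, which is not enough for the final inequality when \<open>p\<close> is large
  compared with \<open>m - p\<close>.\<close>

lemma log_top_eigenvalues_perturbation:
  fixes Z0 W :: "complex^'n^'m" and \<kappa> a :: "'n \<Rightarrow> real" and U :: "complex^'n^'n" and S :: "'n set"
  assumes e: "e > 0" and \<kappa>: "\<And>i. \<kappa> i \<ge> e" and Z0: "Z0\<^sup>\<dagger> ** Z0 = rdiag (\<lambda>i. \<kappa> i - e)"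
    and U: "U\<^sup>\<dagger> ** U = mat 1" "U ** U\<^sup>\<dagger> = mat 1"
    and Z: "(Z0 + W)\<^sup>\<dagger> ** (Z0 + W) = U ** rdiag (\<lambda>i. a i - e) ** U\<^sup>\<dagger>"
    and a: "\<And>i. a i \<ge> e" and \<mu>: "\<mu> > 0" "\<And>i. i \<in> S \<Longrightarrow> \<mu> \<le> a i" "\<And>i. i \<notin> S \<Longrightarrow> a i \<le> \<mu>"
  defines "J \<equiv> rdiag (\<lambda>i. if i \<in> S then 1 else 0)"
  defines "J' \<equiv> rdiag (\<lambda>i. if i \<in> S then 0 else 1)"
  defines "Q \<equiv> Z0 ** rdiag (\<lambda>i. if i \<in> S then 1 / \<kappa> i else 0)"
  defines "Y \<equiv> W\<^sup>\<dagger> ** Q"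
  defines "N \<equiv> (J + Y)\<^sup>\<dagger> ** (J + Y)"
  defines "R \<equiv> (Z0 + W) ** (J + Y) - Q ** rdiag \<kappa> ** N"
  defines "\<Lambda>h \<equiv> rdiag (\<lambda>i. if i \<in> S then sqrt (\<kappa> i) else 1)"
  defines "\<Lambda>hi \<equiv> rdiag (\<lambda>i. if i \<in> S then 1 / sqrt (\<kappa> i) else 1)"
  assumes P: "det (mat 1 + J ** Y) \<noteq> 0"
  shows "(\<Sum>i\<in>S. ln (a i)) \<ge> (\<Sum>i\<in>S. ln (\<kappa> i)) + 2 * ln (cmod (det (mat 1 + J ** Y)))
     + ln (1 + (norm (J' ** Y) / (1 + norm (J ** Y)))\<^sup>2)
     + ln (1 + (norm (R ** \<Lambda>hi) / (1 + norm (\<Lambda>h ** (N + J' - mat 1) ** \<Lambda>hi)))\<^sup>2)"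
proof -
  define D where "D = rdiag (\<lambda>i. if i \<in> S then 1 / \<kappa> i else 0)"
  define V where "V = J + Y"
  define H where "H = V\<^sup>\<dagger> ** ((Z0 + W)\<^sup>\<dagger> ** (Z0 + W)) ** V + e *\<^sub>R (V\<^sup>\<dagger> ** V)"
  have \<kappa>0: "\<kappa> i > 0" and a0: "a i > 0" for i using e \<kappa>[of i] a[of i] by auto
  have \<kappa>n: "\<kappa> i \<noteq> 0" for i using \<kappa>0[of i] by simp
  have J: "J\<^sup>\<dagger> = J" "J'\<^sup>\<dagger> = J'" "J ** J = J" "J' ** J' = J'" "J + J' = mat 1" "J ** J' = 0" "J' ** J = 0"
    by (auto simp: J_def J'_def rdiag_mult rdiag_add if_distrib if_distribR cong: if_cong simp flip: rdiag_1)
       (auto simp: rdiag_def vec_eq_iff)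
  have DJ: "D ** J = D" "D ** rdiag \<kappa> = J" "rdiag \<kappa> ** D = J" "J ** rdiag \<kappa> = rdiag \<kappa> ** J"
    using \<kappa>n by (auto simp: J_def D_def rdiag_mult fun_eq_iff intro!: arg_cong[where f = rdiag])
  have QJ: "Q ** J = Q" by (simp add: Q_def D_def[symmetric] DJ flip: matrix_mul_assoc)
  have YJ: "Y ** J = Y" by (simp add: Y_def QJ flip: matrix_mul_assoc)
  have VJ: "V ** J = V" by (simp add: V_def matrix_distribs J YJ)
  have Z0Q: "Z0\<^sup>\<dagger> ** Q = J - e *\<^sub>R D"
  proof -
    have "Z0\<^sup>\<dagger> ** Q = rdiag (\<lambda>i. \<kappa> i - e) ** D"
      by (simp add: Q_def D_def matrix_mul_assoc Z0)
    also have "\<dots> = J - e *\<^sub>R D"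
      using \<kappa>n by (auto simp: J_def D_def rdiag_mult rdiag_diff rdiag_scaleR fun_eq_iff diff_divide_distrib
          intro!: arg_cong[where f = rdiag])
    finally show ?thesis .
  qed
  have ZQ: "(Z0 + W)\<^sup>\<dagger> ** Q = V - e *\<^sub>R D"
    by (simp add: ct_simps matrix_distribs Z0Q V_def Y_def)
  have QQ: "rdiag \<kappa> ** (Q\<^sup>\<dagger> ** Q) ** rdiag \<kappa> = J ** rdiag \<kappa> - e *\<^sub>R J"
  proof -
    have "rdiag \<kappa> ** (Q\<^sup>\<dagger> ** Q) ** rdiag \<kappa> = rdiag \<kappa> ** (D ** (Z0\<^sup>\<dagger> ** Z0) ** D) ** rdiag \<kappa>"
      by (simp add: Q_def D_def ct_simps matrix_mul_assoc)
    also have "\<dots> = J ** rdiag \<kappa> - e *\<^sub>R J"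
      using \<kappa>n unfolding Z0 by (auto simp: J_def D_def rdiag_mult rdiag_diff rdiag_scaleR fun_eq_iff
          intro!: arg_cong[where f = rdiag])
    finally show ?thesis .
  qed
  define R2 where "R2 = V - J ** N"
  have Nv: "N = V\<^sup>\<dagger> ** V" by (simp add: N_def V_def)
  have Rv: "R = (Z0 + W) ** V - Q ** rdiag \<kappa> ** (V\<^sup>\<dagger> ** V)" by (simp add: R_def Nv V_def)
  have Hdec: "H = N ** rdiag \<kappa> ** N + R\<^sup>\<dagger> ** R + e *\<^sub>R (R2\<^sup>\<dagger> ** R2)"
    unfolding H_def R2_def Nv Rv
    by (rule compressed_gram_decomposition[where D = D]) (use J DJ VJ ZQ QQ in \<open>auto simp: D_def\<close>)
  have Nct: "N\<^sup>\<dagger> = N" by (simp add: N_def ct_simps)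
  have NJ: "N ** J = N" by (simp add: Nv VJ flip: matrix_mul_assoc)
  have JN: "J ** N = N" using arg_cong[OF NJ, of conj_transpose] by (simp add: ct_simps J Nct)
  have NJ': "N ** J' = 0"
    using NJ arg_cong[OF J(5), of "\<lambda>X. N ** X"] by (simp add: matrix_distribs)
  have J'N: "J' ** N = 0" using arg_cong[OF NJ', of conj_transpose] by (simp add: ct_simps J Nct)
  define N1 where "N1 = N + J'"
  have N1ct: "N1\<^sup>\<dagger> = N1" by (simp add: N1_def ct_simps J Nct)
  have hh: "\<Lambda>h ** \<Lambda>h = rdiag (\<lambda>i. if i \<in> S then \<kappa> i else 1)"
    using \<kappa>0 by (auto simp: \<Lambda>h_def rdiag_mult fun_eq_iff less_imp_le intro!: arg_cong[where f = rdiag])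
  have hhi: "\<Lambda>hi ** \<Lambda>h = mat 1" "\<Lambda>h ** \<Lambda>hi = mat 1"
    using \<kappa>n by (auto simp: \<Lambda>h_def \<Lambda>hi_def rdiag_mult fun_eq_iff simp flip: rdiag_1 intro!: arg_cong[where f = rdiag])
  have hct: "\<Lambda>h\<^sup>\<dagger> = \<Lambda>h" by (simp add: \<Lambda>h_def)
  have \<Lambda>split: "rdiag (\<lambda>i. if i \<in> S then \<kappa> i else 1) = J ** rdiag \<kappa> + J'"
    by (auto simp: J_def J'_def rdiag_mult rdiag_add fun_eq_iff intro!: arg_cong[where f = rdiag])
  have gram: "(\<Lambda>h ** N1)\<^sup>\<dagger> ** (\<Lambda>h ** N1) = N ** rdiag \<kappa> ** N + J'"
  proof -
    have "(\<Lambda>h ** N1)\<^sup>\<dagger> ** (\<Lambda>h ** N1) = N1 ** (\<Lambda>h ** \<Lambda>h) ** N1"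
      by (simp add: ct_simps hct N1ct matrix_mul_assoc)
    also have "\<dots> = (N1 ** J) ** rdiag \<kappa> ** N1 + N1 ** J' ** N1"
      by (simp add: hh \<Lambda>split matrix_distribs matrix_mul_assoc)
    also have "N1 ** J = N" by (simp add: N1_def matrix_distribs NJ J)
    also have "N1 ** J' = J'" by (simp add: N1_def matrix_distribs NJ' J)
    also have "J' ** N1 = J'" by (simp add: N1_def matrix_distribs J'N J)
    also have "N ** rdiag \<kappa> ** N1 = N ** rdiag \<kappa> ** N"
    proof -
      have "N ** rdiag \<kappa> ** J' = (N ** J) ** rdiag \<kappa> ** J'" by (simp add: NJ)
      also have "\<dots> = N ** (J ** rdiag \<kappa>) ** J'" by (simp add: matrix_mul_assoc)
      also have "\<dots> = N ** rdiag \<kappa> ** (J ** J')" by (simp add: DJ(4) matrix_mul_assoc)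
      finally show ?thesis by (simp add: J N1_def matrix_distribs)
    qed
    finally show ?thesis .
  qed
  have N1ge: "cmod (det N1) \<ge> (cmod (det (mat 1 + J ** Y)))\<^sup>2 * (1 + (norm (J' ** Y) / (1 + norm (J ** Y)))\<^sup>2)"
    unfolding N1_def N_def by (rule det_frame_gram_ge) (use J P in auto)
  define p where "p = cmod (det (mat 1 + J ** Y))"
  define \<beta> where "\<beta> = norm (J' ** Y) / (1 + norm (J ** Y))"
  define \<rho> where "\<rho> = norm (R ** \<Lambda>hi) / (1 + norm (\<Lambda>h ** (N + J' - mat 1) ** \<Lambda>hi))"
  have p0: "p > 0" using P by (simp add: p_def)
  have b1: "1 + \<beta>\<^sup>2 > 0" "1 + \<rho>\<^sup>2 > 0" by (auto intro: add_pos_nonneg)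
  have N1pos: "cmod (det N1) > 0"
    using N1ge p0 b1 unfolding p_def[symmetric] \<beta>_def[symmetric]
    by (smt (verit) mult_pos_pos zero_less_power)
  define L where "L = (\<Prod>i\<in>S. \<kappa> i)"
  have L0: "L > 0" using \<kappa>0 by (simp add: L_def prod_pos)
  have det\<Lambda>: "(cmod (det \<Lambda>h))\<^sup>2 = L"
  proof -
    have "(cmod (det \<Lambda>h))\<^sup>2 = cmod (det (\<Lambda>h ** \<Lambda>h))" by (simp add: det_mul norm_mult power2_eq_square)
    also have "\<dots> = \<bar>\<Prod>i\<in>UNIV. if i \<in> S then \<kappa> i else 1\<bar>" by (simp add: hh det_rdiag del: of_real_prod)
    also have "(\<Prod>i\<in>UNIV. if i \<in> S then \<kappa> i else 1) = L"
      unfolding L_def by (simp add: prod.If_cases)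
    finally show ?thesis using L0 by simp
  qed
  have detS: "cmod (det (\<Lambda>h ** N1)) \<noteq> 0"
    using det\<Lambda> L0 N1pos by (auto simp: det_mul)
  define X where "X = R ** matrix_inv (\<Lambda>h ** N1)"
  have XS: "X ** (\<Lambda>h ** N1) = R" unfolding X_def using detS by (intro right_divide_matrix) auto
  \<comment> \<open>Factoring \<open>\<Lambda>h ** N1\<close> out of all three Gram matrices leaves the identity plus Gram matrices.\<close>
  define Y2 where "Y2 = (sqrt e *\<^sub>R R2) ** matrix_inv (\<Lambda>h ** N1)"
  have Y2S: "Y2 ** (\<Lambda>h ** N1) = sqrt e *\<^sub>R R2" unfolding Y2_def using detS by (intro right_divide_matrix) auto
  have Hge: "cmod (det (H + J')) \<ge> (cmod (det (\<Lambda>h ** N1)))\<^sup>2 * (1 + (norm X)\<^sup>2)"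
  proof -
    have "H + J' = (\<Lambda>h ** N1)\<^sup>\<dagger> ** (\<Lambda>h ** N1) + R\<^sup>\<dagger> ** R + (sqrt e *\<^sub>R R2)\<^sup>\<dagger> ** (sqrt e *\<^sub>R R2)"
      using e by (simp add: gram Hdec ct_scaleR matrix_scaleR_left matrix_scaleR_right)
    then show ?thesis
      using det_gram_plus_ge[of "\<Lambda>h ** N1" X Y2] by (simp add: XS Y2S)
  qed
  have Xge: "norm X \<ge> \<rho>"
  proof -
    have "(X ** \<Lambda>h) ** (N1 ** \<Lambda>hi) = R ** \<Lambda>hi" by (simp flip: XS add: matrix_mul_assoc)
    moreover have "(X ** \<Lambda>h) ** (N1 ** \<Lambda>hi) = X ** (\<Lambda>h ** N1 ** \<Lambda>hi)" by (simp add: matrix_mul_assoc)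
    ultimately have "X ** (\<Lambda>h ** N1 ** \<Lambda>hi) = R ** \<Lambda>hi" by simp
    moreover have "\<Lambda>h ** N1 ** \<Lambda>hi - mat 1 = \<Lambda>h ** (N + J' - mat 1) ** \<Lambda>hi"
      by (simp add: N1_def matrix_distribs hhi)
    ultimately show ?thesis
      using norm_right_quotient_ge[of X "\<Lambda>h ** N1 ** \<Lambda>hi"] by (simp add: \<rho>_def)
  qed
  have \<rho>0: "\<rho> \<ge> 0" by (simp add: \<rho>_def)
  have lower: "cmod (det (H + J')) \<ge> L * (cmod (det N1))\<^sup>2 * (1 + \<rho>\<^sup>2)"
  proof -
    have "\<rho>\<^sup>2 \<le> (norm X)\<^sup>2" using Xge \<rho>0 by (intro power_mono)
    then have "L * (cmod (det N1))\<^sup>2 * (1 + \<rho>\<^sup>2) \<le> L * (cmod (det N1))\<^sup>2 * (1 + (norm X)\<^sup>2)"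
      using L0 by (intro mult_left_mono) auto
    also have "\<dots> \<le> cmod (det (H + J'))"
      using Hge by (simp add: det_mul norm_mult power_mult_distrib det\<Lambda>)
    finally show ?thesis .
  qed
  define M where "M = rdiag (\<lambda>i. if i \<in> S then 1 else \<mu>)"
  \<comment> \<open>The block outside \<open>S\<close> is rescaled from \<open>1\<close> to \<open>\<mu>\<close>, the value at which the variational principle is sharp.\<close>
  have VJ': "V ** J' = 0"
    using VJ arg_cong[OF J(5), of "\<lambda>X. V ** X"] by (simp add: matrix_distribs)
  have upper: "cmod (det (H + J')) \<le> (\<Prod>i\<in>S. a i) * cmod (det N1)"
  proof -
    have M: "M = J + \<mu> *\<^sub>R J'"
      by (auto simp: M_def J_def J'_def rdiag_scaleR rdiag_add fun_eq_iff intro!: arg_cong[where f = rdiag])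
    have HJ: "H ** J = H" "H ** J' = 0"
    proof -
      define T where "T = V\<^sup>\<dagger> ** ((Z0 + W)\<^sup>\<dagger> ** (Z0 + W)) + e *\<^sub>R V\<^sup>\<dagger>"
      have T: "H = T ** V" by (simp add: T_def H_def matrix_distribs)
      show "H ** J = H" "H ** J' = 0"
        unfolding T matrix_mul_assoc[symmetric] by (simp_all add: VJ VJ')
    qed
    have "(H + J') ** M = H + \<mu> *\<^sub>R J'" by (simp add: M matrix_distribs HJ J)
    then have 1: "cmod (det (H + \<mu> *\<^sub>R J')) = cmod (det (H + J')) * cmod (det M)"
      by (metis det_mul norm_mult)
    have detM: "cmod (det M) = (\<Prod>i\<in>-S. \<mu>)"
    proof -
      have "cmod (det M) = \<bar>\<Prod>i\<in>UNIV. if i \<in> S then 1 else \<mu>\<bar>"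
        by (simp add: M_def det_rdiag del: of_real_prod)
      also have "(\<Prod>i\<in>UNIV. if i \<in> S then 1 else \<mu>) = (\<Prod>i\<in>-S. \<mu>)"
        by (subst prod.If_cases) (simp_all add: Compl_eq)
      finally show ?thesis using \<mu>(1) by simp
    qed
    have "mat 1 = U ** rdiag (\<lambda>i. 1) ** U\<^sup>\<dagger>" by (simp add: rdiag_1 U)
    then have "(Z0 + W)\<^sup>\<dagger> ** (Z0 + W) + e *\<^sub>R mat 1 = U ** rdiag (\<lambda>i. a i - e) ** U\<^sup>\<dagger> + e *\<^sub>R (U ** rdiag (\<lambda>i. 1) ** U\<^sup>\<dagger>)"
      by (simp only: Z)
    also have "\<dots> = U ** (rdiag (\<lambda>i. a i - e) + e *\<^sub>R rdiag (\<lambda>i. 1)) ** U\<^sup>\<dagger>" by (simp add: matrix_distribs)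
    also have "rdiag (\<lambda>i. a i - e) + e *\<^sub>R rdiag (\<lambda>i. 1) = rdiag a" by (simp add: rdiag_scaleR rdiag_add)
    finally have A: "(Z0 + W)\<^sup>\<dagger> ** (Z0 + W) + e *\<^sub>R mat 1 = U ** rdiag a ** U\<^sup>\<dagger>" .
    have "H = V\<^sup>\<dagger> ** ((Z0 + W)\<^sup>\<dagger> ** (Z0 + W) + e *\<^sub>R mat 1) ** V" by (simp add: H_def matrix_distribs)
    then have H: "H = (U\<^sup>\<dagger> ** V)\<^sup>\<dagger> ** rdiag a ** (U\<^sup>\<dagger> ** V)"
      unfolding A by (simp add: ct_mult matrix_mul_assoc)
    have UV: "(U\<^sup>\<dagger> ** V)\<^sup>\<dagger> ** (U\<^sup>\<dagger> ** V) = V\<^sup>\<dagger> ** V"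
    proof -
      have "(U\<^sup>\<dagger> ** V)\<^sup>\<dagger> ** (U\<^sup>\<dagger> ** V) = V\<^sup>\<dagger> ** (U ** U\<^sup>\<dagger>) ** V" by (simp add: ct_simps matrix_mul_assoc)
      then show ?thesis by (simp add: U)
    qed
    have 2: "cmod (det (H + \<mu> *\<^sub>R J')) \<le> (\<Prod>j\<in>UNIV. max (a j) \<mu>) * cmod (det N1)"
      using det_weighted_gram_le[of a \<mu> "U\<^sup>\<dagger> ** V" J'] a0 \<mu>(1) N1pos
      by (simp add: UV H[symmetric] J N1_def Nv)
    have "(\<Prod>j\<in>UNIV. max (a j) \<mu>) = (\<Prod>j\<in>UNIV. if j \<in> S then a j else \<mu>)"
      using \<mu> by (intro prod.cong) (auto simp: max_def intro: antisym)
    also have "\<dots> = (\<Prod>i\<in>S. a i) * (\<Prod>i\<in>-S. \<mu>)"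
      by (subst prod.If_cases) (simp_all add: Compl_eq)
    finally have "cmod (det (H + J')) * (\<Prod>i\<in>-S. \<mu>) \<le> (\<Prod>i\<in>S. a i) * cmod (det N1) * (\<Prod>i\<in>-S. \<mu>)"
      using 1 2 detM by (simp add: mult_ac)
    moreover have "(\<Prod>i\<in>-S. \<mu>) > 0" using \<mu>(1) by (simp add: prod_pos)
    ultimately show ?thesis by (simp only: mult_le_cancel_right_pos)
  qed
  have "L * (cmod (det N1))\<^sup>2 * (1 + \<rho>\<^sup>2) \<le> (\<Prod>i\<in>S. a i) * cmod (det N1)"
    using lower upper by linarith
  then have "L * cmod (det N1) * (1 + \<rho>\<^sup>2) * cmod (det N1) \<le> (\<Prod>i\<in>S. a i) * cmod (det N1)"
    by (simp add: power2_eq_square mult_ac)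
  then have 1: "L * cmod (det N1) * (1 + \<rho>\<^sup>2) \<le> (\<Prod>i\<in>S. a i)"
    using N1pos by (simp only: mult_le_cancel_right_pos)
  have "L * (p\<^sup>2 * (1 + \<beta>\<^sup>2)) * (1 + \<rho>\<^sup>2) \<le> L * cmod (det N1) * (1 + \<rho>\<^sup>2)"
    using N1ge L0 b1 unfolding p_def \<beta>_def by (intro mult_right_mono mult_left_mono) auto
  with 1 have "L * (p\<^sup>2 * (1 + \<beta>\<^sup>2)) * (1 + \<rho>\<^sup>2) \<le> (\<Prod>i\<in>S. a i)" by linarith
  moreover have "0 < L * (p\<^sup>2 * (1 + \<beta>\<^sup>2)) * (1 + \<rho>\<^sup>2)" using L0 p0 b1 by (intro mult_pos_pos) auto
  ultimately have "ln (L * (p\<^sup>2 * (1 + \<beta>\<^sup>2)) * (1 + \<rho>\<^sup>2)) \<le> ln (\<Prod>i\<in>S. a i)" by (intro ln_mono) auto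
  moreover have "ln (L * (p\<^sup>2 * (1 + \<beta>\<^sup>2)) * (1 + \<rho>\<^sup>2)) = ln L + 2 * ln p + ln (1 + \<beta>\<^sup>2) + ln (1 + \<rho>\<^sup>2)"
    using L0 p0 b1 by (simp add: ln_mult ln_realpow)
  moreover have "ln L = (\<Sum>i\<in>S. ln (\<kappa> i))"
    unfolding L_def by (rule ln_prod) (use \<kappa>n in auto)
  moreover have "ln (\<Prod>i\<in>S. a i) = (\<Sum>i\<in>S. ln (a i))"
  proof (rule ln_prod)
    show "a i \<noteq> 0" for i using a0[of i] by simp
  qed simp
  ultimately show ?thesis unfolding p_def \<beta>_def \<rho>_def by simp
qed

section \<open>Local behaviour of the log-product of the largest eigenvalues\<close>

definition cscale :: "complex \<Rightarrow> complex^'n^'m \<Rightarrow> complex^'n^'m" where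
  "cscale c A = (\<chi> i j. c * A $ i $ j)"

lemma cscale_mult_left: "cscale c A ** B = cscale c (A ** B)"
  by (simp add: cscale_def vec_eq_iff matrix_matrix_mult_def sum_distrib_left mult_ac)

lemma cscale_mult_right: "A ** cscale c B = cscale c (A ** B)"
  by (simp add: cscale_def vec_eq_iff matrix_matrix_mult_def sum_distrib_left mult_ac)

lemma cscale_ct: "(cscale c A)\<^sup>\<dagger> = cscale (cnj c) (A\<^sup>\<dagger>)"
  by (simp add: cscale_def vec_eq_iff)

lemma cscale_cscale: "cscale c (cscale d A) = cscale (c * d) A"
  by (simp add: cscale_def vec_eq_iff mult_ac)

lemma cscale_1 [simp]: "cscale 1 A = A"
  by (simp add: cscale_def vec_eq_iff)

lemma cscale_minus: "cscale (- c) A = - cscale c A"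
  by (simp add: cscale_def vec_eq_iff)

lemma cscale_scaleR: "cscale c (r *\<^sub>R A) = r *\<^sub>R cscale c A"
  by (simp add: cscale_def vec_eq_iff)

lemma cscale_add: "cscale c (A + B) = cscale c A + cscale c B"
  by (simp add: cscale_def vec_eq_iff algebra_simps)

lemma cscale_diff: "cscale c (A - B) = cscale c A - cscale c B"
  by (simp add: cscale_def vec_eq_iff algebra_simps)

lemma norm_cscale: "norm (cscale c A) = cmod c * norm A"
proof -
  have "(norm (cscale c A))\<^sup>2 = (cmod c * norm A)\<^sup>2"
    by (simp add: norm_matrix_sq cscale_def norm_mult power_mult_distrib sum_distrib_left)
  then show ?thesis by simp
qed

definition quarter_turn :: "nat \<Rightarrow> complex^'n^'m \<Rightarrow> complex^'n^'m" where
  "quarter_turn j = cscale (\<i> ^ j)"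

lemma norm_quarter_turn [simp]: "norm (quarter_turn j A) = norm A"
  by (simp add: quarter_turn_def norm_cscale norm_power)

lemma sum_lessThan_4: "(\<Sum>j<4. f j) = f 0 + f 1 + f 2 + f (3::nat)"
  by (simp add: eval_nat_numeral)

lemma ipow: "\<i> ^ 0 = 1" "\<i> ^ 1 = \<i>" "\<i> ^ 2 = -1" "\<i> ^ 3 = - \<i>"
  by (simp_all add: eval_nat_numeral)

text \<open>The four factors commute and multiply to \<open>1 - X\<^sup>4\<close>.\<close>

lemma prod_det_quarter_turns:
  fixes X :: "complex^'n^'n"
  shows "det (mat 1 + X) * det (mat 1 + cscale (-\<i>) X) * det (mat 1 - X) * det (mat 1 + cscale \<i> X)
    = det (mat 1 - X ** X ** (X ** X))"
proof -
  have 1: "(mat 1 + X) ** (mat 1 - X) = mat 1 - X ** X" by (simp add: matrix_distribs)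
  have 2: "(mat 1 + cscale (-\<i>) X) ** (mat 1 + cscale \<i> X) = mat 1 + X ** X"
    by (simp add: matrix_distribs cscale_mult_left cscale_mult_right cscale_cscale cscale_minus cscale_diff)
  have 3: "(mat 1 - X ** X) ** (mat 1 + X ** X) = mat 1 - X ** X ** (X ** X)" by (simp add: matrix_distribs)
  have "det (mat 1 - X ** X ** (X ** X)) = det (mat 1 + X) * det (mat 1 - X) * (det (mat 1 + cscale (-\<i>) X) * det (mat 1 + cscale \<i> X))"
    by (simp only: 1[symmetric] 2[symmetric] 3[symmetric] det_mul)
  then show ?thesis by (simp add: mult_ac)
qed

text \<open>A substitute for the mean value property of the pluriharmonic function \<open>ln |det(1 +
  X)|\<close>: averaging over the four quarter turns already removes all terms of order below
  four.\<close>

lemma sum_ln_det_quarter_turns_ge: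
  "\<exists>C r. C \<ge> 0 \<and> r > 0 \<and> (\<forall>X::complex^'n^'n. norm X \<le> r \<longrightarrow>
     (\<Sum>j<4. ln (cmod (det (mat 1 + cscale (cnj (\<i> ^ j)) X)))) \<ge> - C * (norm X) ^ 4)"
proof -
  obtain C r where C: "C \<ge> 0" "r > 0" "r \<le> 1" and *: "\<And>X::complex^'n^'n. norm X \<le> r \<Longrightarrow>
      det (mat 1 + X) \<noteq> 0 \<and> ln (cmod (det (mat 1 + X))) \<ge> Re (trace X) - C * (norm X)\<^sup>2"
    using ln_det_one_plus_ge by blast
  show ?thesis
  proof (rule exI[of _ "CARD('n) + C"], rule exI[of _ r], intro conjI allI impI)
    fix X :: "complex^'n^'n" assume X: "norm X \<le> r"
    define t where "t = norm X"
    have t: "0 \<le> t" "t \<le> r" "t \<le> 1" using X C by (auto simp: t_def)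
    have nz: "det (mat 1 + cscale c X) \<noteq> 0" if "cmod c = 1" for c
      using *[of "cscale c X"] X that by (simp add: norm_cscale)
    define X4 where "X4 = X ** X ** (X ** X)"
    have X2: "norm (X ** X) \<le> t * t" unfolding t_def by (rule norm_matrix_mult_le)
    have "norm X4 \<le> norm (X ** X) * norm (X ** X)" unfolding X4_def by (rule norm_matrix_mult_le)
    also have "\<dots> \<le> (t * t) * (t * t)" by (intro mult_mono X2) (auto simp: t_def)
    also have "\<dots> = t ^ 4" by (simp add: power4_eq_xxxx mult.assoc)
    finally have n4: "norm X4 \<le> t ^ 4" .
    have t4: "t ^ 4 \<le> t" "t ^ 4 \<le> 1" using t power_decreasing[of 1 4 t] by (auto intro: power_le_one)
    then have n4r: "norm (- X4) \<le> r" using n4 t by simp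
    have "(\<Sum>j<4. ln (cmod (det (mat 1 + cscale (cnj (\<i> ^ j)) X))))
      = ln (cmod (det (mat 1 + X))) + ln (cmod (det (mat 1 + cscale (-\<i>) X)))
        + ln (cmod (det (mat 1 - X))) + ln (cmod (det (mat 1 + cscale \<i> X)))"
      unfolding sum_lessThan_4 ipow by (simp add: cscale_minus)
    also have "\<dots> = ln (cmod (det (mat 1 - X4)))"
      unfolding X4_def prod_det_quarter_turns[symmetric]
      using nz[of 1] nz[of "-\<i>"] nz[of "-1"] nz[of \<i>]
      by (simp add: norm_mult ln_mult cscale_minus)
    also have "\<dots> \<ge> Re (trace (- X4)) - C * (norm (- X4))\<^sup>2"
      using *[OF n4r] by simp
    finally have 1: "(\<Sum>j<4. ln (cmod (det (mat 1 + cscale (cnj (\<i> ^ j)) X)))) \<ge> Re (trace (- X4)) - C * (norm (- X4))\<^sup>2" .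
    have "\<bar>Re (trace (- X4))\<bar> \<le> CARD('n) * norm (- X4)"
      using abs_Re_le_cmod cmod_trace_le order_trans by blast
    also have "\<dots> \<le> CARD('n) * t ^ 4" using n4 by (intro mult_left_mono) auto
    finally have 2: "\<bar>Re (trace (- X4))\<bar> \<le> CARD('n) * t ^ 4" .
    have "(norm (- X4))\<^sup>2 \<le> norm X4 * 1" using n4 t4 by (simp add: power2_eq_square mult_left_le)
    also have "\<dots> \<le> t ^ 4" using n4 by simp
    finally have 3: "C * (norm (- X4))\<^sup>2 \<le> C * t ^ 4" using C by (intro mult_left_mono)
    show "(\<Sum>j<4. ln (cmod (det (mat 1 + cscale (cnj (\<i> ^ j)) X)))) \<ge> - (CARD('n) + C) * (norm X) ^ 4"
      using 1 2 3 unfolding t_def by (simp add: algebra_simps)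
  qed (use C in auto)
qed

lemma ln_one_plus_square_ge: "ln (1 + x\<^sup>2) \<ge> x\<^sup>2 - x ^ 4" for x :: real
proof (cases "x\<^sup>2 \<le> 1")
  case True
  have "x ^ 4 = (x\<^sup>2)\<^sup>2" by simp
  then show ?thesis using ln_one_plus_pos_lower_bound[of "x\<^sup>2"] True by simp
next
  case False
  then have "x\<^sup>2 * 1 \<le> x\<^sup>2 * x\<^sup>2" by (intro mult_left_mono) auto
  then have "x\<^sup>2 \<le> x ^ 4" by (simp add: power4_eq_xxxx power2_eq_square mult.assoc)
  moreover have "ln (1 + x\<^sup>2) \<ge> 0" by simp
  ultimately show ?thesis by linarith
qed

text \<open>The base matrix is written in a unitary eigenbasis \<open>U Z\<close> of \<open>Z\<^sup>*
  Z\<close>, with \<open>a Z i\<close> the eigenvalues raised by \<open>e\<close>; the set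
  \<open>S\<close> selects the \<open>card S\<close> largest of them. The basis is an
  arbitrary function of \<open>Z\<close> and may jump where eigenvalues coincide.\<close>

locale top_eigenvalues =
  fixes e :: real and S :: "'n::finite set"
    and U :: "complex^'n^'m::finite \<Rightarrow> complex^'n^'n" and a :: "complex^'n^'m \<Rightarrow> 'n \<Rightarrow> real"
  assumes e: "e > 0"
    and U: "(U Z)\<^sup>\<dagger> ** U Z = mat 1" "U Z ** (U Z)\<^sup>\<dagger> = mat 1"
    and spectral: "Z\<^sup>\<dagger> ** Z = U Z ** rdiag (\<lambda>i. a Z i - e) ** (U Z)\<^sup>\<dagger>"
    and a_ge: "a Z i \<ge> e"
    and top: "i \<in> S \<Longrightarrow> j \<notin> S \<Longrightarrow> a Z j \<le> a Z i"
begin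

definition log_top :: "complex^'n^'m \<Rightarrow> real" where
  "log_top Z = (\<Sum>i\<in>S. ln (a Z i))"

definition inv_top :: "complex^'n^'m \<Rightarrow> complex^'n^'n" where
  "inv_top Z = rdiag (\<lambda>i. if i \<in> S then 1 / a Z i else 0)"

text \<open>The left singular vectors divided by the singular values after regularisation, in the
  eigenbasis: the columns of \<open>Z (Z\<^sup>* Z + e)\<^sup>-\<^sup>1\<close> that belong to
  \<open>S\<close>. Transforming back gives half the gradient of \<open>log_top\<close> wherever
  the latter is differentiable.\<close>

definition rot_gradient :: "complex^'n^'m \<Rightarrow> complex^'n^'m" where
  "rot_gradient Z = Z ** U Z ** inv_top Z"

definition half_gradient :: "complex^'n^'m \<Rightarrow> complex^'n^'m" where
  "half_gradient Z = rot_gradient Z ** (U Z)\<^sup>\<dagger>"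

text \<open>The change of the frame of right singular vectors under one power iteration with the perturbed
  matrix, in the coordinates of the eigenbasis.\<close>

definition frame_shift :: "complex^'n^'m \<Rightarrow> complex^'n^'m \<Rightarrow> complex^'n^'n" where
  "frame_shift Z W = (W ** U Z)\<^sup>\<dagger> ** rot_gradient Z"

definition top_proj :: "complex^'n^'n" where "top_proj = rdiag (\<lambda>i. if i \<in> S then 1 else 0)"
definition rest_proj :: "complex^'n^'n" where "rest_proj = rdiag (\<lambda>i. if i \<in> S then 0 else 1)"

definition sqrt_top :: "complex^'n^'m \<Rightarrow> complex^'n^'n" where
  "sqrt_top Z = rdiag (\<lambda>i. if i \<in> S then sqrt (a Z i) else 1)"
definition inv_sqrt_top :: "complex^'n^'m \<Rightarrow> complex^'n^'n" where
  "inv_sqrt_top Z = rdiag (\<lambda>i. if i \<in> S then 1 / sqrt (a Z i) else 1)"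
definition frame_gram :: "complex^'n^'m \<Rightarrow> complex^'n^'m \<Rightarrow> complex^'n^'n" where
  "frame_gram Z W = (top_proj + frame_shift Z W)\<^sup>\<dagger> ** (top_proj + frame_shift Z W)"
definition residual :: "complex^'n^'m \<Rightarrow> complex^'n^'m \<Rightarrow> complex^'n^'m" where
  "residual Z W = (Z ** U Z + W ** U Z) ** (top_proj + frame_shift Z W) - rot_gradient Z ** rdiag (a Z) ** frame_gram Z W"
definition beta where "beta Z W = norm (rest_proj ** frame_shift Z W) / (1 + norm (top_proj ** frame_shift Z W))"
definition rho where "rho Z W = norm (residual Z W ** inv_sqrt_top Z) / (1 + norm (sqrt_top Z ** (frame_gram Z W + rest_proj - mat 1) ** inv_sqrt_top Z))"

lemma a_pos: "a Z i > 0"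
  using e a_ge[of Z i] by linarith

lemma base_gram: "(Z ** U Z)\<^sup>\<dagger> ** (Z ** U Z) = rdiag (\<lambda>i. a Z i - e)"
proof -
  have "(Z ** U Z)\<^sup>\<dagger> ** (Z ** U Z) = (U Z)\<^sup>\<dagger> ** (Z\<^sup>\<dagger> ** Z) ** U Z"
    by (simp add: ct_mult matrix_mul_assoc)
  also have "\<dots> = ((U Z)\<^sup>\<dagger> ** U Z) ** rdiag (\<lambda>i. a Z i - e) ** ((U Z)\<^sup>\<dagger> ** U Z)"
    unfolding spectral by (simp add: matrix_mul_assoc)
  finally show ?thesis by (simp add: U)
qed

text \<open>The key estimate for an arbitrary base point, which is reduced to the diagonal case by a
  change of the unitary basis. The threshold \<open>\<mu>\<close> between the two groups of
  eigenvalues of the perturbed matrix exists because \<open>S\<close> selects the largest ones.\<close>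

lemma log_top_perturbation:
  assumes "det (mat 1 + top_proj ** frame_shift Z W) \<noteq> 0"
  shows "log_top (Z + W) \<ge> log_top Z + 2 * ln (cmod (det (mat 1 + top_proj ** frame_shift Z W)))
    + ln (1 + (beta Z W)\<^sup>2) + ln (1 + (rho Z W)\<^sup>2)"
proof -
  define V where "V = (U Z)\<^sup>\<dagger> ** U (Z + W)"
  have V: "V\<^sup>\<dagger> ** V = mat 1" "V ** V\<^sup>\<dagger> = mat 1"
  proof -
    have "V\<^sup>\<dagger> ** V = (U (Z + W))\<^sup>\<dagger> ** (U Z ** (U Z)\<^sup>\<dagger>) ** U (Z + W)"
      by (simp add: V_def ct_mult matrix_mul_assoc)
    then show "V\<^sup>\<dagger> ** V = mat 1" by (simp add: U)
    have "V ** V\<^sup>\<dagger> = (U Z)\<^sup>\<dagger> ** (U (Z + W) ** (U (Z + W))\<^sup>\<dagger>) ** U Z"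
      by (simp add: V_def ct_mult matrix_mul_assoc)
    then show "V ** V\<^sup>\<dagger> = mat 1" by (simp add: U)
  qed
  have Zp: "(Z ** U Z + W ** U Z)\<^sup>\<dagger> ** (Z ** U Z + W ** U Z) = V ** rdiag (\<lambda>i. a (Z + W) i - e) ** V\<^sup>\<dagger>"
  proof -
    have "Z ** U Z + W ** U Z = (Z + W) ** U Z" by (simp add: matrix_distribs)
    then have "(Z ** U Z + W ** U Z)\<^sup>\<dagger> ** (Z ** U Z + W ** U Z) = (U Z)\<^sup>\<dagger> ** ((Z + W)\<^sup>\<dagger> ** (Z + W)) ** U Z"
      by (simp only: ct_mult matrix_mul_assoc)
    also have "\<dots> = V ** rdiag (\<lambda>i. a (Z + W) i - e) ** V\<^sup>\<dagger>"
      unfolding spectral[of "Z + W"] by (simp add: V_def ct_mult matrix_mul_assoc)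
    finally show ?thesis .
  qed
  obtain \<mu> where \<mu>: "\<mu> > 0" "\<And>i. i \<in> S \<Longrightarrow> \<mu> \<le> a (Z + W) i" "\<And>i. i \<notin> S \<Longrightarrow> a (Z + W) i \<le> \<mu>"
  proof (cases "S = {}")
    case True
    show ?thesis
      by (rule that[of "Max (range (a (Z + W)))"]) (auto simp: True Max_gr_iff a_pos)
  next
    case False
    show ?thesis
      by (rule that[of "Min (a (Z + W) ` S)"]) (use False top in \<open>auto simp: a_pos\<close>)
  qed
  show ?thesis
    using log_top_eigenvalues_perturbation[OF e a_ge base_gram V Zp a_ge \<mu>, of S] assms
    unfolding log_top_def beta_def rho_def residual_def frame_gram_def frame_shift_def rot_gradient_def inv_top_def top_proj_def rest_proj_def sqrt_top_def inv_sqrt_top_def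
    by simp
qed

lemma norm_sq_eq_sum: "(norm Z)\<^sup>2 = (\<Sum>i\<in>UNIV. a Z i - e)"
proof -
  have "(norm Z)\<^sup>2 = (norm (Z ** U Z))\<^sup>2" by (simp add: norm_unitary_right U)
  also have "\<dots> = Re (trace (rdiag (\<lambda>i. a Z i - e)))"
    by (simp add: power2_norm_eq_inner inner_matrix_trace base_gram)
  finally show ?thesis by (simp add: trace_rdiag del: of_real_sum of_real_diff)
qed

lemma log_top_ge: "log_top Z \<ge> card S * ln e"
proof -
  have "(\<Sum>i\<in>S. ln e) \<le> log_top Z"
    unfolding log_top_def using e a_ge by (intro sum_mono ln_mono) auto
  then show ?thesis by simp
qed

lemma log_top_le: "log_top Z \<le> card S * ln e + (norm Z)\<^sup>2 / e"
proof -
  have "log_top Z \<le> (\<Sum>i\<in>S. ln e + (a Z i - e) / e)"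
    unfolding log_top_def
  proof (intro sum_mono)
    fix i
    have "ln (a Z i / e) \<le> a Z i / e - 1" using a_pos e by (intro ln_le_minus_one) simp
    then show "ln (a Z i) \<le> ln e + (a Z i - e) / e" using a_pos[of Z i] e by (simp add: ln_div field_simps)
  qed
  also have "\<dots> = card S * ln e + (\<Sum>i\<in>S. a Z i - e) / e"
    by (simp add: sum.distrib sum_divide_distrib)
  also have "(\<Sum>i\<in>S. a Z i - e) \<le> (norm Z)\<^sup>2"
    unfolding norm_sq_eq_sum using a_ge by (intro sum_mono2) auto
  finally show ?thesis using e by (simp add: divide_right_mono)
qed

lemma norm_rot_gradient_sq: "(norm (rot_gradient Z))\<^sup>2 = (\<Sum>i\<in>S. (a Z i - e) / (a Z i)\<^sup>2)"
proof -
  have "(rot_gradient Z)\<^sup>\<dagger> ** rot_gradient Z = inv_top Z ** ((Z ** U Z)\<^sup>\<dagger> ** (Z ** U Z)) ** inv_top Z"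
    by (simp add: rot_gradient_def inv_top_def ct_mult matrix_mul_assoc)
  also have "\<dots> = rdiag (\<lambda>i. if i \<in> S then (a Z i - e) / (a Z i)\<^sup>2 else 0)"
    unfolding base_gram by (auto simp: inv_top_def rdiag_mult power2_eq_square intro!: arg_cong[where f = rdiag])
  finally have "(norm (rot_gradient Z))\<^sup>2 = (\<Sum>i\<in>UNIV. if i \<in> S then (a Z i - e) / (a Z i)\<^sup>2 else 0)"
    by (simp add: power2_norm_eq_inner inner_matrix_trace trace_rdiag del: of_real_sum)
  then show ?thesis by (simp add: sum.If_cases)
qed

lemma norm_half_gradient: "norm (half_gradient Z) = norm (rot_gradient Z)"
  unfolding half_gradient_def by (rule norm_unitary_right) (simp add: U)

lemma norm_rot_gradient_le: "norm (rot_gradient Z) \<le> sqrt (CARD('n) / e)"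
proof -
  have "(norm (rot_gradient Z))\<^sup>2 \<le> (\<Sum>i\<in>S. 1 / e)"
    unfolding norm_rot_gradient_sq
  proof (intro sum_mono)
    fix i
    have "(a Z i - e) / (a Z i)\<^sup>2 \<le> a Z i / (a Z i)\<^sup>2"
      using e by (intro divide_right_mono) auto
    also have "\<dots> = 1 / a Z i" using a_pos[of Z i] by (simp add: power2_eq_square)
    also have "\<dots> \<le> 1 / e" using e a_ge[of Z i] by (intro divide_left_mono) auto
    finally show "(a Z i - e) / (a Z i)\<^sup>2 \<le> 1 / e" .
  qed
  also have "\<dots> = card S / e" by simp
  also have "\<dots> \<le> CARD('n) / e" using e by (intro divide_right_mono) (auto intro!: card_mono)
  finally show ?thesis by (rule real_le_rsqrt)
qed

lemma norm_top_proj: "norm top_proj \<le> sqrt (CARD('n))"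
proof -
  have "(norm top_proj)\<^sup>2 = (\<Sum>i\<in>UNIV. if i \<in> S then 1 else 0)"
    unfolding top_proj_def norm_rdiag_sq by (intro sum.cong) auto
  also have "\<dots> = card S" by (simp add: sum.If_cases)
  also have "\<dots> \<le> CARD('n)" by (simp add: card_mono)
  finally show ?thesis by (rule real_le_rsqrt)
qed

definition shift_bound where "shift_bound = sqrt (CARD('n)) * sqrt (CARD('n) / e)"

lemma shift_bound_pos: "shift_bound > 0" using e by (simp add: shift_bound_def)

lemma norm_frame_shift: "norm (top_proj ** frame_shift Z W) \<le> shift_bound * norm W"
proof -
  have "norm (top_proj ** frame_shift Z W) \<le> norm top_proj * (norm (W ** U Z) * norm (rot_gradient Z))"
    unfolding frame_shift_def
    by (intro order_trans[OF norm_matrix_mult_le] mult_left_mono order_trans[OF norm_matrix_mult_le]) auto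
  also have "\<dots> \<le> sqrt (CARD('n)) * (norm W * sqrt (CARD('n) / e))"
    using norm_rot_gradient_le norm_top_proj e by (intro mult_mono) (auto simp: norm_unitary_right U)
  finally show ?thesis by (simp add: shift_bound_def mult_ac)
qed

text \<open>The first-order term of the determinant is the derivative of \<open>log_top / 2\<close>.\<close>

lemma trace_frame_shift: "Re (trace (top_proj ** frame_shift Z W)) = half_gradient Z \<bullet> W"
proof -
  have "inv_top Z ** top_proj = inv_top Z" by (auto simp: inv_top_def top_proj_def rdiag_mult intro!: arg_cong[where f = rdiag])
  then have QJ: "rot_gradient Z ** top_proj = rot_gradient Z" by (simp add: rot_gradient_def flip: matrix_mul_assoc)
  have "trace (top_proj ** frame_shift Z W) = trace (frame_shift Z W ** top_proj)" by (rule trace_mul_sym)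
  also have "\<dots> = trace ((U Z)\<^sup>\<dagger> ** (W\<^sup>\<dagger> ** rot_gradient Z))"
    by (simp add: frame_shift_def ct_mult QJ flip: matrix_mul_assoc)
  also have "\<dots> = trace (W\<^sup>\<dagger> ** (rot_gradient Z ** (U Z)\<^sup>\<dagger>))"
    by (subst trace_mul_sym) (simp add: matrix_mul_assoc)
  finally show ?thesis by (simp add: half_gradient_def inner_matrix_trace[symmetric] inner_commute)
qed

lemma frame_shift_cscale: "frame_shift Z (cscale c W) = cscale (cnj c) (frame_shift Z W)"
  by (simp add: frame_shift_def cscale_mult_left cscale_ct)

lemma frame_shift_scaleR: "frame_shift Z (r *\<^sub>R W) = r *\<^sub>R frame_shift Z W"
  by (simp add: frame_shift_def matrix_distribs ct_scaleR)

text \<open>Away from the base point a trivial bound suffices, because the regularisation keeps the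
  function above \<open>card S * ln e\<close>; the surplus factor makes it polynomially small.\<close>

lemma log_top_far:
  assumes r: "r > 0" and W: "norm W > r"
  shows "log_top (Z + V) \<ge> log_top Z - (norm W) ^ k * (1 + (norm Z)\<^sup>2) / (e * r ^ k)"
proof -
  have "log_top (Z + V) \<ge> log_top Z - (norm Z)\<^sup>2 / e" using log_top_ge[of "Z + V"] log_top_le[of Z] by simp
  moreover have "(norm Z)\<^sup>2 / e \<le> (norm W) ^ k * (1 + (norm Z)\<^sup>2) / (e * r ^ k)"
  proof -
    have "1 \<le> (norm W / r) ^ k" using W r by (intro one_le_power) simp
    then have "1 * ((norm Z)\<^sup>2 / e) \<le> (norm W / r) ^ k * ((1 + (norm Z)\<^sup>2) / e)"
      using e by (intro mult_mono divide_right_mono) auto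
    then show ?thesis by (simp add: power_divide mult_ac)
  qed
  ultimately show ?thesis by linarith
qed

text \<open>The function is semiconvex up to polynomial factors, with subgradient \<open>2 *
  half_gradient\<close>: near the base point by the expansion of the determinant, away from it
  by the trivial bound.\<close>

lemma log_top_subgradient:
  "\<exists>C\<ge>0. \<forall>Z W. log_top (Z + W) \<ge> log_top Z + 2 * (half_gradient Z \<bullet> W) - C * (norm W)\<^sup>2 * (1 + (norm Z)\<^sup>2)"
proof -
  obtain C r where C: "C \<ge> 0" "r > 0" "r \<le> 1" and *: "\<And>X::complex^'n^'n. norm X \<le> r \<Longrightarrow>
      det (mat 1 + X) \<noteq> 0 \<and> ln (cmod (det (mat 1 + X))) \<ge> Re (trace X) - C * (norm X)\<^sup>2"
    using ln_det_one_plus_ge by blast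
  define s where "s = r / shift_bound"
  have s: "s > 0" using C shift_bound_pos by (simp add: s_def)
  define B where "B = 2 * C * shift_bound\<^sup>2 + 1 / (e * s\<^sup>2) + 2 * shift_bound / s"
  have B: "2 * C * shift_bound\<^sup>2 \<le> B" "1 / (e * s\<^sup>2) + 2 * shift_bound / s \<le> B" "B \<ge> 0"
    using C shift_bound_pos s e by (auto simp: B_def)
  show ?thesis
  proof (intro exI[of _ B] conjI allI B)
    fix Z W :: "complex^'n^'m"
    show "log_top (Z + W) \<ge> log_top Z + 2 * (half_gradient Z \<bullet> W) - B * (norm W)\<^sup>2 * (1 + (norm Z)\<^sup>2)"
    proof (cases "norm W \<le> s")
      case True
      have JY: "norm (top_proj ** frame_shift Z W) \<le> r"
        using norm_frame_shift[of Z W] True shift_bound_pos mult_left_mono[OF True, of shift_bound] by (simp add: s_def)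
      have "log_top (Z + W) \<ge> log_top Z + 2 * ln (cmod (det (mat 1 + top_proj ** frame_shift Z W)))"
        using log_top_perturbation[of Z W] *[OF JY] by (smt (verit) ln_ge_zero zero_le_power2)
      moreover have "ln (cmod (det (mat 1 + top_proj ** frame_shift Z W))) \<ge> half_gradient Z \<bullet> W - C * (norm (top_proj ** frame_shift Z W))\<^sup>2"
        using *[OF JY] trace_frame_shift by simp
      moreover have "C * (norm (top_proj ** frame_shift Z W))\<^sup>2 \<le> C * (shift_bound * norm W)\<^sup>2"
        using norm_frame_shift C by (intro mult_left_mono power_mono) auto
      moreover have "2 * C * shift_bound\<^sup>2 * ((norm W)\<^sup>2 * 1) \<le> B * ((norm W)\<^sup>2 * (1 + (norm Z)\<^sup>2))"
        using B by (intro mult_mono) auto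
      ultimately show ?thesis by (simp add: power_mult_distrib mult_ac)
    next
      case False
      then have W: "norm W > s" by simp
      have "half_gradient Z \<bullet> W \<le> norm (half_gradient Z) * norm W" by (rule norm_cauchy_schwarz)
      also have "\<dots> \<le> shift_bound * norm W"
      proof (intro mult_right_mono)
        have "1 * sqrt (CARD('n) / e) \<le> shift_bound" unfolding shift_bound_def using e by (intro mult_right_mono) auto
        then show "norm (half_gradient Z) \<le> shift_bound" using norm_rot_gradient_le[of Z] by (simp add: norm_half_gradient)
      qed auto
      also have "\<dots> \<le> shift_bound * norm W * (norm W / s)"
        using mult_left_mono[of 1 "norm W / s" "shift_bound * norm W"] W s shift_bound_pos by simp
      finally have "2 * (half_gradient Z \<bullet> W) \<le> 2 * shift_bound / s * (norm W)\<^sup>2" by (simp add: power2_eq_square)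
      also have "\<dots> \<le> 2 * shift_bound / s * (norm W)\<^sup>2 * (1 + (norm Z)\<^sup>2)"
        using mult_left_mono[of 1 "1 + (norm Z)\<^sup>2" "2 * shift_bound / s * (norm W)\<^sup>2"] shift_bound_pos s by simp
      finally have 1: "2 * (half_gradient Z \<bullet> W) \<le> 2 * shift_bound / s * (norm W)\<^sup>2 * (1 + (norm Z)\<^sup>2)" .
      have 2: "log_top (Z + W) \<ge> log_top Z - 1 / (e * s\<^sup>2) * (norm W)\<^sup>2 * (1 + (norm Z)\<^sup>2)"
        using log_top_far[OF s W, where Z = Z and V = W and k = 2] by simp
      have "(1 / (e * s\<^sup>2) + 2 * shift_bound / s) * ((norm W)\<^sup>2 * (1 + (norm Z)\<^sup>2)) \<le> B * ((norm W)\<^sup>2 * (1 + (norm Z)\<^sup>2))"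
        using B by (intro mult_right_mono) auto
      then show ?thesis using 1 2 unfolding distrib_right[of "1 / (e * s\<^sup>2)"] mult.assoc by linarith
    qed
  qed
qed

text \<open>Averaged over quarter turns, the determinants contribute only in fourth order, so that the
  nonnegative gains remain.\<close>

lemma log_top_quarter_turns_perturbation:
  "\<exists>C r. C \<ge> 0 \<and> r > 0 \<and> (\<forall>Z W. norm W \<le> r \<longrightarrow>
     (\<Sum>j<4. log_top (Z + quarter_turn j W)) \<ge> 4 * log_top Z - C * norm W ^ 4
       + (\<Sum>j<4. ln (1 + (beta Z (quarter_turn j W))\<^sup>2) + ln (1 + (rho Z (quarter_turn j W))\<^sup>2)))"
proof -
  obtain C1 r1 :: real where C1: "r1 > 0" "\<And>X::complex^'n^'n. norm X \<le> r1 \<Longrightarrow>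
      det (mat 1 + X) \<noteq> 0 \<and> ln (cmod (det (mat 1 + X))) \<ge> Re (trace X) - C1 * (norm X)\<^sup>2"
    using ln_det_one_plus_ge by blast
  then have 1: "det (mat 1 + X) \<noteq> 0" if "norm X \<le> r1" for X :: "complex^'n^'n" using that by blast
  obtain C r where C: "C \<ge> 0" "r > 0" and *: "\<And>X::complex^'n^'n. norm X \<le> r \<Longrightarrow>
     (\<Sum>j<4. ln (cmod (det (mat 1 + cscale (cnj (\<i> ^ j)) X)))) \<ge> - C * (norm X) ^ 4"
    using sum_ln_det_quarter_turns_ge by blast
  show ?thesis
  proof (rule exI[of _ "2 * C * shift_bound ^ 4"], rule exI[of _ "min r1 r / shift_bound"], intro conjI allI impI)
    fix Z W :: "complex^'n^'m" assume W: "norm W \<le> min r1 r / shift_bound"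
    define X where "X = top_proj ** frame_shift Z W"
    have X: "norm X \<le> shift_bound * norm W" unfolding X_def by (rule norm_frame_shift)
    also have "\<dots> \<le> min r1 r" using W shift_bound_pos by (simp add: field_simps)
    finally have Xr: "norm X \<le> r1" "norm X \<le> r" by auto
    have JY: "top_proj ** frame_shift Z (quarter_turn j W) = cscale (cnj (\<i> ^ j)) X" for j
      by (simp add: quarter_turn_def frame_shift_cscale cscale_mult_right X_def)
    have nz: "det (mat 1 + top_proj ** frame_shift Z (quarter_turn j W)) \<noteq> 0" for j
      unfolding JY using Xr by (intro 1) (simp add: norm_cscale norm_power)
    have "(\<Sum>j<4. log_top (Z + quarter_turn j W)) \<ge> (\<Sum>j<4. log_top Z + 2 * ln (cmod (det (mat 1 + top_proj ** frame_shift Z (quarter_turn j W))))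
       + ln (1 + (beta Z (quarter_turn j W))\<^sup>2) + ln (1 + (rho Z (quarter_turn j W))\<^sup>2))"
      by (intro sum_mono log_top_perturbation nz)
    also have "(\<Sum>j<4. log_top Z + 2 * ln (cmod (det (mat 1 + top_proj ** frame_shift Z (quarter_turn j W))))
       + ln (1 + (beta Z (quarter_turn j W))\<^sup>2) + ln (1 + (rho Z (quarter_turn j W))\<^sup>2))
      = 4 * log_top Z + 2 * (\<Sum>j<4. ln (cmod (det (mat 1 + cscale (cnj (\<i> ^ j)) X))))
        + (\<Sum>j<4. ln (1 + (beta Z (quarter_turn j W))\<^sup>2) + ln (1 + (rho Z (quarter_turn j W))\<^sup>2))"
      unfolding JY by (simp add: sum.distrib sum_distrib_left)
    finally have 2: "(\<Sum>j<4. log_top (Z + quarter_turn j W)) \<ge> 4 * log_top Z + 2 * (\<Sum>j<4. ln (cmod (det (mat 1 + cscale (cnj (\<i> ^ j)) X))))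
        + (\<Sum>j<4. ln (1 + (beta Z (quarter_turn j W))\<^sup>2) + ln (1 + (rho Z (quarter_turn j W))\<^sup>2))" .
    have "C * (norm X) ^ 4 \<le> C * (shift_bound * norm W) ^ 4"
      using X C by (intro mult_left_mono power_mono) auto
    with 2 *[OF Xr(2)] show "(\<Sum>j<4. log_top (Z + quarter_turn j W)) \<ge> 4 * log_top Z - 2 * C * shift_bound ^ 4 * norm W ^ 4
       + (\<Sum>j<4. ln (1 + (beta Z (quarter_turn j W))\<^sup>2) + ln (1 + (rho Z (quarter_turn j W))\<^sup>2))"
      by (simp add: power_mult_distrib mult_ac)
  qed (use C C1(1) shift_bound_pos in \<open>auto simp: less_imp_le\<close>)
qed

text \<open>A global lower bound, uniform in the base point. It makes the integrands nonnegative to which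
  Fatou's lemma is applied later.\<close>

lemma log_top_quarter_turns_ge:
  "\<exists>C\<ge>0. \<forall>Z W. (\<Sum>j<4. log_top (Z + quarter_turn j W)) / 4 \<ge> log_top Z - C * norm W ^ 4 * (1 + (norm Z)\<^sup>2)"
proof -
  obtain C r where C: "C \<ge> 0" "r > 0" and *: "\<And>Z W. norm W \<le> r \<Longrightarrow>
     (\<Sum>j<4. log_top (Z + quarter_turn j W)) \<ge> 4 * log_top Z - C * norm W ^ 4
       + (\<Sum>j<4. ln (1 + (beta Z (quarter_turn j W))\<^sup>2) + ln (1 + (rho Z (quarter_turn j W))\<^sup>2))"
    using log_top_quarter_turns_perturbation by blast
  have er: "1 / (e * r ^ 4) \<ge> 0" using e C by simp
  show ?thesis
  proof (intro exI[of _ "C / 4 + 1 / (e * r ^ 4)"] conjI allI)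
    fix Z W :: "complex^'n^'m"
    show "(\<Sum>j<4. log_top (Z + quarter_turn j W)) / 4 \<ge> log_top Z - (C / 4 + 1 / (e * r ^ 4)) * norm W ^ 4 * (1 + (norm Z)\<^sup>2)"
    proof (cases "norm W \<le> r")
      case True
      have "(\<Sum>j<4. ln (1 + (beta Z (quarter_turn j W))\<^sup>2) + ln (1 + (rho Z (quarter_turn j W))\<^sup>2)) \<ge> 0"
        by (intro sum_nonneg add_nonneg_nonneg ln_ge_zero) auto
      then have "(\<Sum>j<4. log_top (Z + quarter_turn j W)) / 4 \<ge> log_top Z - C / 4 * norm W ^ 4"
        using *[OF True, of Z] by simp
      moreover have "C / 4 * (norm W ^ 4 * 1) \<le> (C / 4 + 1 / (e * r ^ 4)) * (norm W ^ 4 * (1 + (norm Z)\<^sup>2))"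
        using C er by (intro mult_mono) auto
      ultimately show ?thesis by (simp add: mult.assoc)
    next
      case False
      then have W: "norm W > r" by simp
      define T where "T = norm W ^ 4 * (1 + (norm Z)\<^sup>2) / (e * r ^ 4)"
      have "(\<Sum>j<4. log_top (Z + quarter_turn j W)) \<ge> (\<Sum>j<(4::nat). log_top Z - T)"
        unfolding T_def by (intro sum_mono log_top_far C W)
      then have "(\<Sum>j<4. log_top (Z + quarter_turn j W)) / 4 \<ge> log_top Z - T"
        by simp
      then have "(\<Sum>j<4. log_top (Z + quarter_turn j W)) / 4 \<ge> log_top Z - 1 / (e * r ^ 4) * (norm W ^ 4 * (1 + (norm Z)\<^sup>2))"
        unfolding T_def by (simp only: times_divide_eq_left mult_1)
      moreover have "1 / (e * r ^ 4) * (norm W ^ 4 * (1 + (norm Z)\<^sup>2)) \<le> (C / 4 + 1 / (e * r ^ 4)) * (norm W ^ 4 * (1 + (norm Z)\<^sup>2))"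
        using C by (intro mult_right_mono) auto
      ultimately show ?thesis unfolding mult.assoc by linarith
    qed
  qed (use C er in auto)
qed

end

context top_eigenvalues
begin

lemma proj_simps: "top_proj\<^sup>\<dagger> = top_proj" "rest_proj\<^sup>\<dagger> = rest_proj" "top_proj ** top_proj = top_proj" "rest_proj ** rest_proj = rest_proj" "top_proj + rest_proj = mat 1"
  by (auto simp: top_proj_def rest_proj_def rdiag_mult rdiag_add if_distrib if_distribR cong: if_cong simp flip: rdiag_1)

text \<open>The parts of first and second order of \<open>residual\<close>, that is, of the image of the
  new frame minus its component along the old left singular vectors.\<close>

definition slopeB :: "complex^'n^'m \<Rightarrow> complex^'n^'m \<Rightarrow> complex^'n^'m" where
  "slopeB Z W = Z ** U Z ** rest_proj ** frame_shift Z W"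

definition slopeA :: "complex^'n^'m \<Rightarrow> complex^'n^'m \<Rightarrow> complex^'n^'m" where
  "slopeA Z W = (mat 1 - rot_gradient Z ** rdiag (a Z) ** (rot_gradient Z)\<^sup>\<dagger>) ** W ** (U Z ** top_proj)"

definition curv :: "complex^'n^'m \<Rightarrow> complex^'n^'m \<Rightarrow> complex^'n^'m" where
  "curv Z W = W ** U Z ** frame_shift Z W - rot_gradient Z ** rdiag (a Z) ** ((frame_shift Z W)\<^sup>\<dagger> ** frame_shift Z W)"

text \<open>The zeroth-order terms cancel because the unperturbed singular vectors satisfy
  \<open>Z v = Q \<Lambda> v\<close>, where \<open>Q\<close> is \<open>rot_gradient Z\<close> and
  \<open>\<Lambda>\<close> holds the raised eigenvalues.\<close>

lemma residual_expand: "residual Z W = slopeB Z W + slopeA Z W + curv Z W"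
proof -
  have DJ: "inv_top Z ** top_proj = inv_top Z" "inv_top Z ** rdiag (a Z) = top_proj"
    using a_pos[of Z] less_imp_neq[OF a_pos[of Z]]
    by (auto simp: inv_top_def top_proj_def rdiag_mult intro!: arg_cong[where f = rdiag])
  have QJ: "rot_gradient Z ** top_proj = rot_gradient Z" by (simp add: rot_gradient_def DJ flip: matrix_mul_assoc)
  have QL: "rot_gradient Z ** rdiag (a Z) = Z ** U Z ** top_proj"
    by (simp add: rot_gradient_def DJ flip: matrix_mul_assoc)
  have QLJ: "Z ** U Z ** top_proj ** top_proj = Z ** U Z ** top_proj" by (simp add: proj_simps flip: matrix_mul_assoc)
  define y where "y = frame_shift Z W"
  have yct: "y\<^sup>\<dagger> = (rot_gradient Z)\<^sup>\<dagger> ** (W ** U Z)" by (simp add: y_def frame_shift_def ct_mult)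
  have J'e: "rest_proj = mat 1 - top_proj" using proj_simps(5) by (simp add: algebra_simps)
  have "residual Z W = (Z ** U Z + W ** U Z) ** (top_proj + y) - Z ** U Z ** top_proj ** (top_proj + y\<^sup>\<dagger>) ** (top_proj + y)"
    unfolding residual_def frame_gram_def QL y_def[symmetric]
    by (simp add: ct_add proj_simps matrix_mul_assoc)
  also have "\<dots> = (Z ** U Z ** y - Z ** U Z ** top_proj ** y) + (W ** U Z ** top_proj - Z ** U Z ** top_proj ** y\<^sup>\<dagger> ** top_proj)
      + (W ** U Z ** y - Z ** U Z ** top_proj ** (y\<^sup>\<dagger> ** y))"
    by (simp add: matrix_distribs matrix_mul_assoc QLJ)
  also have "Z ** U Z ** y - Z ** U Z ** top_proj ** y = slopeB Z W"
    by (simp add: slopeB_def J'e matrix_distribs flip: y_def)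
  also have "W ** U Z ** top_proj - Z ** U Z ** top_proj ** y\<^sup>\<dagger> ** top_proj = slopeA Z W"
    by (simp add: slopeA_def yct QL matrix_distribs matrix_mul_assoc)
  also have "W ** U Z ** y - Z ** U Z ** top_proj ** (y\<^sup>\<dagger> ** y) = curv Z W"
    by (simp add: curv_def QL flip: y_def)
  finally show ?thesis .
qed

lemma slope_scale:
  "slopeB Z (cscale c W) = cscale (cnj c) (slopeB Z W)" "slopeA Z (cscale c W) = cscale c (slopeA Z W)"
  "slopeB Z (r *\<^sub>R W) = r *\<^sub>R slopeB Z W" "slopeA Z (r *\<^sub>R W) = r *\<^sub>R slopeA Z W"
  by (simp_all add: slopeB_def slopeA_def frame_shift_cscale frame_shift_scaleR cscale_mult_left cscale_mult_right matrix_distribs)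

lemma curv_scale: "curv Z (r *\<^sub>R W) = r\<^sup>2 *\<^sub>R curv Z W"
  by (simp add: curv_def frame_shift_scaleR matrix_distribs ct_scaleR scaleR_diff_right power2_eq_square)

definition second_order :: "complex^'n^'m \<Rightarrow> complex^'n^'m \<Rightarrow> real" where
  "second_order Z W = (norm (rest_proj ** frame_shift Z W))\<^sup>2 + (norm (slopeA Z W ** inv_sqrt_top Z))\<^sup>2 + (norm (slopeB Z W ** inv_sqrt_top Z))\<^sup>2"

text \<open>One of the two first-order terms is linear in the perturbation, the other conjugate linear;
  averaging over quarter turns removes their inner product.\<close>

lemma parallelogram_quarter_turns:
  fixes A B :: "complex^'n^'m"
  shows "(\<Sum>j<4. (norm (cscale (cnj (\<i> ^ j)) B + cscale (\<i> ^ j) A))\<^sup>2) = 4 * ((norm A)\<^sup>2 + (norm B)\<^sup>2)"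
proof -
  have 1: "norm (cscale (-\<i>) B + cscale \<i> A) = norm (A - B)"
  proof -
    have "cscale (-\<i>) B + cscale \<i> A = cscale \<i> (A - B)" by (simp add: cscale_minus cscale_diff)
    then show ?thesis by (simp add: norm_cscale)
  qed
  have 2: "norm (cscale (-1) B + cscale (-1) A) = norm (A + B)"
  proof -
    have "cscale (-1) B + cscale (-1) A = cscale (-1) (A + B)" by (simp add: cscale_add)
    then show ?thesis by (simp add: norm_cscale)
  qed
  have 3: "norm (cscale \<i> B + cscale (-\<i>) A) = norm (A - B)"
  proof -
    have "cscale \<i> B + cscale (-\<i>) A = cscale (-\<i>) (A - B)" by (simp add: cscale_minus cscale_diff)
    then show ?thesis by (simp add: norm_cscale)
  qed
  have "(norm (A + B))\<^sup>2 + (norm (A - B))\<^sup>2 = 2 * ((norm A)\<^sup>2 + (norm B)\<^sup>2)"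
    unfolding power2_norm_eq_inner by (simp add: inner_add_left inner_add_right inner_diff_left inner_diff_right)
  then show ?thesis
    unfolding sum_lessThan_4 ipow using 1 2 3 by (simp add: add.commute)
qed

text \<open>The second-order coefficient of the average over quarter turns is at least
  \<open>second_order\<close>. The limit is taken along a fixed direction; the uniform bound is
  a separate statement.\<close>

lemma log_top_second_order:
  "\<exists>f. (f \<longlongrightarrow> second_order Z W) (at_right 0)
     \<and> (\<forall>\<^sub>F \<epsilon> in at_right 0. \<epsilon>\<^sup>2 * f \<epsilon> \<le> (\<Sum>j<4. log_top (Z + quarter_turn j (\<epsilon> *\<^sub>R W))) / 4 - log_top Z)"
proof -
  obtain C r where C: "C \<ge> 0" "r > 0" and *: "\<And>Z W. norm W \<le> r \<Longrightarrow>
     (\<Sum>j<4. log_top (Z + quarter_turn j W)) \<ge> 4 * log_top Z - C * norm W ^ 4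
       + (\<Sum>j<4. ln (1 + (beta Z (quarter_turn j W))\<^sup>2) + ln (1 + (rho Z (quarter_turn j W))\<^sup>2))"
    using log_top_quarter_turns_perturbation by blast
  define y where "y j = frame_shift Z (quarter_turn j W)" for j
  define A where "A j = slopeB Z (quarter_turn j W) + slopeA Z (quarter_turn j W)" for j
  define B where "B j = curv Z (quarter_turn j W)" for j
  define b where "b j \<epsilon> = norm (rest_proj ** y j) / (1 + \<epsilon> * norm (top_proj ** y j))" for j \<epsilon>
  define c where "c j \<epsilon> = norm ((A j + \<epsilon> *\<^sub>R B j) ** inv_sqrt_top Z)
      / (1 + norm (sqrt_top Z ** (\<epsilon> *\<^sub>R (top_proj ** y j + (y j)\<^sup>\<dagger> ** top_proj) + \<epsilon>\<^sup>2 *\<^sub>R ((y j)\<^sup>\<dagger> ** y j)) ** inv_sqrt_top Z))" for j \<epsilon>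
  have qt: "quarter_turn j (\<epsilon> *\<^sub>R W) = \<epsilon> *\<^sub>R quarter_turn j W" for j \<epsilon>
    by (simp add: quarter_turn_def cscale_scaleR)
  have beta: "beta Z (quarter_turn j (\<epsilon> *\<^sub>R W)) = \<epsilon> * b j \<epsilon>" if "\<epsilon> > 0" for j \<epsilon>
    using that by (simp add: beta_def b_def qt frame_shift_scaleR matrix_distribs y_def)
  have rho: "rho Z (quarter_turn j (\<epsilon> *\<^sub>R W)) = \<epsilon> * c j \<epsilon>" if "\<epsilon> > 0" for j \<epsilon>
  proof -
    have "residual Z (quarter_turn j (\<epsilon> *\<^sub>R W)) = \<epsilon> *\<^sub>R (A j + \<epsilon> *\<^sub>R B j)"
      by (simp add: residual_expand qt slope_scale curv_scale A_def B_def scaleR_add_right power2_eq_square)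
    moreover have "frame_gram Z (quarter_turn j (\<epsilon> *\<^sub>R W)) + rest_proj - mat 1 = \<epsilon> *\<^sub>R (top_proj ** y j + (y j)\<^sup>\<dagger> ** top_proj) + \<epsilon>\<^sup>2 *\<^sub>R ((y j)\<^sup>\<dagger> ** y j)"
    proof -
      have "frame_gram Z (quarter_turn j (\<epsilon> *\<^sub>R W)) = top_proj + \<epsilon> *\<^sub>R (top_proj ** y j + (y j)\<^sup>\<dagger> ** top_proj) + \<epsilon>\<^sup>2 *\<^sub>R ((y j)\<^sup>\<dagger> ** y j)"
        by (simp add: frame_gram_def qt frame_shift_scaleR matrix_distribs ct_simps proj_simps y_def scaleR_add_right power2_eq_square)
      then show ?thesis using proj_simps(5) by (simp add: algebra_simps)
    qed
    ultimately show ?thesis using that by (simp add: rho_def c_def matrix_scaleR_left)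
  qed
  define f where "f \<epsilon> = - C / 4 * (\<epsilon>\<^sup>2 * norm W ^ 4)
      + (\<Sum>j<4. ((b j \<epsilon>)\<^sup>2 - \<epsilon>\<^sup>2 * (b j \<epsilon>) ^ 4) + ((c j \<epsilon>)\<^sup>2 - \<epsilon>\<^sup>2 * (c j \<epsilon>) ^ 4)) / 4" for \<epsilon>
  have id: "((\<lambda>\<epsilon>::real. \<epsilon>) \<longlongrightarrow> 0) (at_right 0)" by (rule tendsto_ident_at)
  have b_lim: "(b j \<longlongrightarrow> norm (rest_proj ** y j)) (at_right 0)" for j
  proof -
    have "(b j \<longlongrightarrow> norm (rest_proj ** y j) / (1 + 0 * norm (top_proj ** y j))) (at_right 0)"
      unfolding b_def by (intro tendsto_intros id) auto
    then show ?thesis by simp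
  qed
  have c_lim: "(c j \<longlongrightarrow> norm (A j ** inv_sqrt_top Z)) (at_right 0)" for j
  proof -
    have "(c j \<longlongrightarrow> norm ((A j + 0 *\<^sub>R B j) ** inv_sqrt_top Z)
      / (1 + norm (sqrt_top Z ** (0 *\<^sub>R (top_proj ** y j + (y j)\<^sup>\<dagger> ** top_proj) + 0\<^sup>2 *\<^sub>R ((y j)\<^sup>\<dagger> ** y j)) ** inv_sqrt_top Z))) (at_right 0)"
      unfolding c_def by (intro tendsto_intros id) auto
    then show ?thesis by simp
  qed
  have "(f \<longlongrightarrow> - C / 4 * (0\<^sup>2 * norm W ^ 4)
      + (\<Sum>j<4. ((norm (rest_proj ** y j))\<^sup>2 - 0\<^sup>2 * (norm (rest_proj ** y j)) ^ 4) + ((norm (A j ** inv_sqrt_top Z))\<^sup>2 - 0\<^sup>2 * (norm (A j ** inv_sqrt_top Z)) ^ 4)) / 4) (at_right 0)"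
    unfolding f_def by (intro tendsto_intros id b_lim c_lim) auto
  moreover have "(\<Sum>j<4. ((norm (rest_proj ** y j))\<^sup>2) + ((norm (A j ** inv_sqrt_top Z))\<^sup>2)) / 4 = second_order Z W"
  proof -
    have "norm (rest_proj ** y j) = norm (rest_proj ** frame_shift Z W)" for j
      by (simp add: y_def quarter_turn_def frame_shift_cscale cscale_mult_right norm_cscale norm_power)
    moreover have "A j ** inv_sqrt_top Z = cscale (cnj (\<i> ^ j)) (slopeB Z W ** inv_sqrt_top Z) + cscale (\<i> ^ j) (slopeA Z W ** inv_sqrt_top Z)" for j
      by (simp add: A_def quarter_turn_def slope_scale matrix_distribs cscale_mult_left)
    ultimately show ?thesis
      using parallelogram_quarter_turns[of "slopeB Z W ** inv_sqrt_top Z" "slopeA Z W ** inv_sqrt_top Z"]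
      by (simp add: sum.distrib second_order_def)
  qed
  ultimately have "(f \<longlongrightarrow> second_order Z W) (at_right 0)" by simp
  moreover have "\<forall>\<^sub>F \<epsilon> in at_right 0. \<epsilon>\<^sup>2 * f \<epsilon> \<le> (\<Sum>j<4. log_top (Z + quarter_turn j (\<epsilon> *\<^sub>R W))) / 4 - log_top Z"
  proof -
    have "\<forall>\<^sub>F \<epsilon> in at_right 0. \<epsilon> \<in> {0<..<r / (1 + norm W)}"
      using C by (intro eventually_at_right_real) (simp add: add_pos_nonneg)
    then show ?thesis
    proof eventually_elim
      case (elim \<epsilon>)
      then have \<epsilon>: "\<epsilon> > 0" "\<epsilon> * (1 + norm W) < r" by (auto simp: pos_less_divide_eq add_pos_nonneg)
      then have "norm (\<epsilon> *\<^sub>R W) \<le> r" by (simp add: algebra_simps)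
      from *[OF this, of Z] have 1: "(\<Sum>j<4. log_top (Z + quarter_turn j (\<epsilon> *\<^sub>R W))) \<ge> 4 * log_top Z - C * (\<epsilon> ^ 4 * norm W ^ 4)
       + (\<Sum>j<4. ln (1 + (\<epsilon> * b j \<epsilon>)\<^sup>2) + ln (1 + (\<epsilon> * c j \<epsilon>)\<^sup>2))"
        using \<epsilon> by (simp add: beta rho power_mult_distrib)
      have 2: "(\<Sum>j<4. ln (1 + (\<epsilon> * b j \<epsilon>)\<^sup>2) + ln (1 + (\<epsilon> * c j \<epsilon>)\<^sup>2))
        \<ge> (\<Sum>j<4. ((\<epsilon> * b j \<epsilon>)\<^sup>2 - (\<epsilon> * b j \<epsilon>) ^ 4) + ((\<epsilon> * c j \<epsilon>)\<^sup>2 - (\<epsilon> * c j \<epsilon>) ^ 4))"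
        by (intro sum_mono add_mono ln_one_plus_square_ge)
      have 3: "(\<Sum>j<4. ((\<epsilon> * b j \<epsilon>)\<^sup>2 - (\<epsilon> * b j \<epsilon>) ^ 4) + ((\<epsilon> * c j \<epsilon>)\<^sup>2 - (\<epsilon> * c j \<epsilon>) ^ 4))
        = \<epsilon>\<^sup>2 * (\<Sum>j<4. ((b j \<epsilon>)\<^sup>2 - \<epsilon>\<^sup>2 * (b j \<epsilon>) ^ 4) + ((c j \<epsilon>)\<^sup>2 - \<epsilon>\<^sup>2 * (c j \<epsilon>) ^ 4))"
        unfolding sum_distrib_left
        by (intro sum.cong) (auto simp: power_mult_distrib algebra_simps power4_eq_xxxx power2_eq_square)
      have 4: "\<epsilon>\<^sup>2 * f \<epsilon> = - C / 4 * (\<epsilon> ^ 4 * norm W ^ 4)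
        + \<epsilon>\<^sup>2 * (\<Sum>j<4. ((b j \<epsilon>)\<^sup>2 - \<epsilon>\<^sup>2 * (b j \<epsilon>) ^ 4) + ((c j \<epsilon>)\<^sup>2 - \<epsilon>\<^sup>2 * (c j \<epsilon>) ^ 4)) / 4"
      proof -
        have "\<epsilon>\<^sup>2 * (- C / 4 * (\<epsilon>\<^sup>2 * norm W ^ 4) + T / 4) = - C / 4 * (\<epsilon> ^ 4 * norm W ^ 4) + \<epsilon>\<^sup>2 * T / 4" for T
          by (simp add: field_simps power4_eq_xxxx power2_eq_square)
        then show ?thesis unfolding f_def .
      qed
      show ?case using 1 2 3 4 by (simp add: field_simps)
    qed
  qed
  ultimately show ?thesis by blast
qed

text \<open>The dropped term is the gain through the smaller singular values, whose contribution is
  nonnegative.\<close>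

lemma second_order_ge:
  "second_order Z W \<ge> (norm ((rot_gradient Z)\<^sup>\<dagger> ** W ** (U Z ** rest_proj)))\<^sup>2
     + (norm ((mat 1 - rot_gradient Z ** rdiag (a Z) ** (rot_gradient Z)\<^sup>\<dagger>) ** W ** (U Z ** top_proj ** inv_sqrt_top Z)))\<^sup>2"
proof -
  have "(rest_proj ** frame_shift Z W)\<^sup>\<dagger> = (rot_gradient Z)\<^sup>\<dagger> ** W ** (U Z ** rest_proj)"
    by (simp add: frame_shift_def ct_mult proj_simps matrix_mul_assoc)
  then have "norm (rest_proj ** frame_shift Z W) = norm ((rot_gradient Z)\<^sup>\<dagger> ** W ** (U Z ** rest_proj))" by (metis norm_ct)
  moreover have "slopeA Z W ** inv_sqrt_top Z = (mat 1 - rot_gradient Z ** rdiag (a Z) ** (rot_gradient Z)\<^sup>\<dagger>) ** W ** (U Z ** top_proj ** inv_sqrt_top Z)"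
    by (simp add: slopeA_def matrix_mul_assoc)
  ultimately show ?thesis by (simp add: second_order_def)
qed

text \<open>The left-hand side is the Gaussian mean of the lower bound for \<open>second_order\<close>.
  Writing \<open>t\<^sub>i = l\<^sub>i / a\<^sub>i\<close> for \<open>i \<in> S\<close>, the
  squared norm of the residual operator (the third factor) is \<open>m - card S + \<Sum>(1 -
  t\<^sub>i)\<^sup>2\<close> for an \<open>m \<times> n\<close> matrix, so that right and left singular vectors
  contribute at least \<open>n - card S\<close> and \<open>m - card S\<close>.\<close>

lemma second_order_constant_ge:
  "(norm ((rot_gradient Z)\<^sup>\<dagger>))\<^sup>2 * (norm (U Z ** rest_proj))\<^sup>2
     + (norm (mat 1 - rot_gradient Z ** rdiag (a Z) ** (rot_gradient Z)\<^sup>\<dagger>))\<^sup>2 * (norm (U Z ** top_proj ** inv_sqrt_top Z))\<^sup>2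
   \<ge> (real CARD('n) + real CARD('m) - 2 * real (card S)) * (norm (rot_gradient Z))\<^sup>2"
proof -
  define s where "s = real (card S)"
  have an: "a Z i \<noteq> 0" for i using a_pos[of Z i] by simp
  have rest_proj: "(norm (U Z ** rest_proj))\<^sup>2 = CARD('n) - s"
  proof -
    have "(norm (U Z ** rest_proj))\<^sup>2 = (norm rest_proj)\<^sup>2" by (simp add: norm_unitary_left U)
    also have "\<dots> = (\<Sum>i\<in>UNIV. if i \<in> S then 0 else 1)"
      unfolding rest_proj_def norm_rdiag_sq by (intro sum.cong) auto
    also have "\<dots> = card (- S)" by (simp add: sum.If_cases)
    also have "\<dots> = CARD('n) - s"
      by (simp add: s_def Compl_eq_Diff_UNIV card_Diff_subset of_nat_diff card_mono)
    finally show ?thesis .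
  qed
  have JL: "(norm (U Z ** top_proj ** inv_sqrt_top Z))\<^sup>2 = (\<Sum>i\<in>S. 1 / a Z i)"
  proof -
    have "(norm (U Z ** top_proj ** inv_sqrt_top Z))\<^sup>2 = (norm (top_proj ** inv_sqrt_top Z))\<^sup>2"
      by (simp add: norm_unitary_left U flip: matrix_mul_assoc)
    also have "\<dots> = (\<Sum>i\<in>UNIV. if i \<in> S then 1 / a Z i else 0)"
      unfolding top_proj_def inv_sqrt_top_def rdiag_mult norm_rdiag_sq
      using a_pos by (intro sum.cong) (auto simp: power_divide less_imp_le)
    finally show ?thesis by (simp add: sum.If_cases)
  qed
  have JL': "(norm (U Z ** top_proj ** inv_sqrt_top Z))\<^sup>2 \<ge> (norm (rot_gradient Z))\<^sup>2"
    unfolding JL norm_rot_gradient_sq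
  proof (intro sum_mono)
    fix i
    have "(a Z i - e) / (a Z i)\<^sup>2 \<le> a Z i / (a Z i)\<^sup>2" using e by (intro divide_right_mono) auto
    then show "(a Z i - e) / (a Z i)\<^sup>2 \<le> 1 / a Z i" using an[of i] by (simp add: power2_eq_square)
  qed
  define T where "T = rot_gradient Z ** rdiag (a Z) ** (rot_gradient Z)\<^sup>\<dagger>"
  define t where "t i = (if i \<in> S then (a Z i - e) / a Z i else 0)" for i
  have LQQ: "rdiag (a Z) ** ((rot_gradient Z)\<^sup>\<dagger> ** rot_gradient Z) = rdiag t"
  proof -
    have "rdiag (a Z) ** ((rot_gradient Z)\<^sup>\<dagger> ** rot_gradient Z) = rdiag (a Z) ** (inv_top Z ** ((Z ** U Z)\<^sup>\<dagger> ** (Z ** U Z)) ** inv_top Z)"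
      by (simp add: rot_gradient_def inv_top_def ct_mult matrix_mul_assoc)
    also have "\<dots> = rdiag t"
      unfolding base_gram using an by (auto simp: inv_top_def rdiag_mult t_def intro!: arg_cong[where f = rdiag])
    finally show ?thesis .
  qed
  have Tct: "T\<^sup>\<dagger> = T" by (simp add: T_def ct_mult matrix_mul_assoc)
  have tr1: "trace T = of_real (\<Sum>i\<in>UNIV. t i)"
  proof -
    have "trace T = trace (rdiag (a Z) ** (rot_gradient Z)\<^sup>\<dagger> ** rot_gradient Z)"
      by (metis T_def matrix_mul_assoc trace_mul_sym)
    then show ?thesis by (simp add: LQQ trace_rdiag del: of_real_sum flip: matrix_mul_assoc)
  qed
  have tr2: "trace (T ** T) = of_real (\<Sum>i\<in>UNIV. (t i)\<^sup>2)"
  proof -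
    have "trace (T ** T) = trace (rot_gradient Z ** (rdiag (a Z) ** ((rot_gradient Z)\<^sup>\<dagger> ** rot_gradient Z) ** rdiag (a Z) ** (rot_gradient Z)\<^sup>\<dagger>))"
      by (simp add: T_def matrix_mul_assoc)
    also have "\<dots> = trace (rdiag (a Z) ** ((rot_gradient Z)\<^sup>\<dagger> ** rot_gradient Z) ** rdiag (a Z) ** (rot_gradient Z)\<^sup>\<dagger> ** rot_gradient Z)"
      by (rule trace_mul_sym)
    also have "\<dots> = trace (rdiag t ** rdiag t)"
      by (simp only: LQQ matrix_mul_assoc[symmetric])
    finally show ?thesis by (simp add: rdiag_mult trace_rdiag power2_eq_square del: of_real_sum)
  qed
  have "(norm (mat 1 - T))\<^sup>2 = Re (trace ((mat 1 - T) ** (mat 1 - T)))"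
    by (simp add: power2_norm_eq_inner inner_matrix_trace ct_diff Tct)
  also have "(mat 1 - T) ** (mat 1 - T) = mat 1 - T - T + T ** T" by (simp add: matrix_distribs)
  also have "Re (trace (mat 1 - T - T + T ** T)) = CARD('m) - 2 * (\<Sum>i\<in>UNIV. t i) + (\<Sum>i\<in>UNIV. (t i)\<^sup>2)"
    unfolding trace_add trace_sub trace_I tr1 tr2 by simp
  also have "\<dots> = CARD('m) - s + (\<Sum>i\<in>S. (1 - t i)\<^sup>2)"
  proof -
    have "(\<Sum>i\<in>UNIV. t i) = (\<Sum>i\<in>S. t i)" "(\<Sum>i\<in>UNIV. (t i)\<^sup>2) = (\<Sum>i\<in>S. (t i)\<^sup>2)"
      by (rule sum.mono_neutral_right; simp add: t_def)+
    then show ?thesis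
      by (simp add: s_def power2_diff sum.distrib sum_subtractf sum_distrib_left)
  qed
  finally have nT: "(norm (mat 1 - T))\<^sup>2 \<ge> CARD('m) - s"
    by (simp add: sum_nonneg)
  have "(CARD('m) - s) * (norm (rot_gradient Z))\<^sup>2 \<le> (norm (mat 1 - T))\<^sup>2 * (norm (rot_gradient Z))\<^sup>2"
    by (intro mult_right_mono nT) auto
  also have "\<dots> \<le> (norm (mat 1 - T))\<^sup>2 * (norm (U Z ** top_proj ** inv_sqrt_top Z))\<^sup>2"
    by (intro mult_left_mono JL') auto
  finally have "(CARD('m) - s) * (norm (rot_gradient Z))\<^sup>2 \<le> (norm (mat 1 - T))\<^sup>2 * (norm (U Z ** top_proj ** inv_sqrt_top Z))\<^sup>2" .
  then show ?thesis unfolding rest_proj T_def[symmetric] s_def[symmetric] by (simp add: algebra_simps)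
qed

end

section \<open>The standard Gaussian measure on a Euclidean space\<close>

text \<open>Each real coordinate has variance \<open>1/2\<close>. With this normalisation the complex
  matrix normal distribution is a translate of this measure on the underlying real space.\<close>

definition gauss :: "'a::euclidean_space measure" where
  "gauss = density lborel (\<lambda>y. ennreal (exp (- (norm y)\<^sup>2) / sqrt pi ^ DIM('a)))"

abbreviation gauss_density :: "'a::euclidean_space \<Rightarrow> ennreal" where
  "gauss_density y \<equiv> ennreal (exp (- (norm y)\<^sup>2) / sqrt pi ^ DIM('a))"

lemma space_gauss [simp]: "space gauss = UNIV"
  and sets_gauss [simp, measurable_cong]: "sets gauss = sets borel"
  by (simp_all add: gauss_def)

lemma nn_integral_gauss:
  "f \<in> borel_measurable borel \<Longrightarrow> (\<integral>\<^sup>+y. f y \<partial>gauss) = (\<integral>\<^sup>+y. gauss_density y * f y \<partial>lborel)"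
  unfolding gauss_def by (rule nn_integral_density) auto

lemma nn_integral_real_gaussian: "(\<integral>\<^sup>+x. ennreal (exp (- x\<^sup>2)) \<partial>lborel) = ennreal (sqrt pi)"
proof -
  have "has_bochner_integral lborel (\<lambda>x::real. exp (- x\<^sup>2)) (2 *\<^sub>R (sqrt pi / 2))"
    using gaussian_moment_0 by (rule has_bochner_integral_even_function) simp
  then show ?thesis
    by (subst nn_integral_eq_integral) (auto simp: has_bochner_integral_iff)
qed

lemma nn_integral_real_gaussian_square: "(\<integral>\<^sup>+x. ennreal (x\<^sup>2 * exp (- x\<^sup>2)) \<partial>lborel) = ennreal (sqrt pi / 2)"
proof -
  have "has_bochner_integral lborel (\<lambda>x::real. exp (- x\<^sup>2) * x ^ (2 * 1)) (2 *\<^sub>R ((sqrt pi / 2) * (fact (2 * 1) / (2 ^ (2 * 1) * fact 1))))"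
    using gaussian_moment_even_pos[of 1] by (rule has_bochner_integral_even_function) simp
  then have "has_bochner_integral lborel (\<lambda>x::real. x\<^sup>2 * exp (- x\<^sup>2)) (sqrt pi / 2)"
    by (simp add: mult.commute)
  then show ?thesis
    by (subst nn_integral_eq_integral) (auto simp: has_bochner_integral_iff)
qed

lemma exp_norm_sq_prod: "exp (- (norm (y::'a::euclidean_space))\<^sup>2) = (\<Prod>b\<in>Basis. exp (- (y \<bullet> b)\<^sup>2))"
proof -
  have "(norm y)\<^sup>2 = (\<Sum>b\<in>Basis. (y \<bullet> b)\<^sup>2)"
    unfolding power2_norm_eq_inner by (subst euclidean_inner) (simp add: power2_eq_square)
  then show ?thesis by (simp add: exp_sum[symmetric] sum_negf)
qed

lemma nn_integral_gaussian:
  "(\<integral>\<^sup>+y. ennreal (exp (- (norm (y::'a::euclidean_space))\<^sup>2)) \<partial>lborel) = ennreal (sqrt pi ^ DIM('a))"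
proof -
  have "(\<integral>\<^sup>+y. ennreal (exp (- (norm (y::'a))\<^sup>2)) \<partial>lborel) = (\<integral>\<^sup>+y. (\<Prod>b\<in>Basis. ennreal (exp (- ((y::'a) \<bullet> b)\<^sup>2))) \<partial>lborel)"
    by (simp add: exp_norm_sq_prod prod_ennreal)
  also have "\<dots> = (\<Prod>b\<in>(Basis::'a set). \<integral>\<^sup>+x. ennreal (exp (- x\<^sup>2)) \<partial>lborel)"
    by (rule nn_integral_lborel_prod) auto
  finally show ?thesis by (simp add: nn_integral_real_gaussian ennreal_power)
qed

lemma prob_space_gauss: "prob_space (gauss :: 'a::euclidean_space measure)"
proof (rule prob_spaceI)
  have "emeasure (gauss :: 'a measure) UNIV = (\<integral>\<^sup>+y. gauss_density (y::'a) \<partial>lborel)"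
    by (simp add: gauss_def emeasure_density)
  also have "\<dots> = (\<integral>\<^sup>+y. ennreal (exp (- (norm (y::'a))\<^sup>2)) / ennreal (sqrt pi ^ DIM('a)) \<partial>lborel)"
    by (intro nn_integral_cong) (simp add: divide_ennreal)
  also have "\<dots> = 1" by (simp add: nn_integral_divide nn_integral_gaussian)
  finally show "emeasure (gauss :: 'a measure) (space gauss) = 1" by simp
qed

interpretation gauss: prob_space "gauss :: 'a::euclidean_space measure" by (rule prob_space_gauss)
interpretation gauss_pair: pair_prob_space "gauss :: 'a::euclidean_space measure" "gauss :: 'b::euclidean_space measure" ..

lemma nn_integral_gauss_square_coordinate:
  assumes "b \<in> Basis"
  shows "(\<integral>\<^sup>+y. ennreal (((y::'a::euclidean_space) \<bullet> b)\<^sup>2) \<partial>gauss) = ennreal (1 / 2)"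
proof -
  define f where "f c = (\<lambda>x. ennreal (if c = b then x\<^sup>2 * exp (- x\<^sup>2) else exp (- x\<^sup>2)))" for c :: 'a
  have "(\<integral>\<^sup>+y. ennreal (((y::'a) \<bullet> b)\<^sup>2) \<partial>gauss) = (\<integral>\<^sup>+y. gauss_density y * ennreal ((y \<bullet> b)\<^sup>2) \<partial>lborel)"
    by (rule nn_integral_gauss) simp
  also have "\<dots> = (\<integral>\<^sup>+y. (\<Prod>c\<in>Basis. f c (y \<bullet> c)) / ennreal (sqrt pi ^ DIM('a)) \<partial>lborel)"
  proof (intro nn_integral_cong)
    fix y :: 'a
    have "(\<Prod>c\<in>Basis. f c (y \<bullet> c)) = ennreal (\<Prod>c\<in>Basis. (if c = b then (y \<bullet> c)\<^sup>2 * exp (- (y \<bullet> c)\<^sup>2) else exp (- (y \<bullet> c)\<^sup>2)))"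
      unfolding f_def by (rule prod_ennreal) auto
    also have "(\<Prod>c\<in>Basis. (if c = b then (y \<bullet> c)\<^sup>2 * exp (- (y \<bullet> c)\<^sup>2) else exp (- (y \<bullet> c)\<^sup>2)))
      = (\<Prod>c\<in>Basis. (if c = b then (y \<bullet> b)\<^sup>2 else 1) * exp (- (y \<bullet> c)\<^sup>2))"
      by (intro prod.cong) auto
    also have "\<dots> = (y \<bullet> b)\<^sup>2 * exp (- (norm y)\<^sup>2)"
      using assms by (simp add: prod.distrib exp_norm_sq_prod)
    finally show "gauss_density y * ennreal ((y \<bullet> b)\<^sup>2) = (\<Prod>c\<in>Basis. f c (y \<bullet> c)) / ennreal (sqrt pi ^ DIM('a))"
      by (simp add: divide_ennreal ennreal_mult[symmetric] mult.commute)
  qed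
  also have "\<dots> = (\<Prod>c\<in>(Basis::'a set). \<integral>\<^sup>+x. f c x \<partial>lborel) / ennreal (sqrt pi ^ DIM('a))"
    by (subst nn_integral_divide, simp add: f_def, subst nn_integral_lborel_prod) (auto simp: f_def)
  also have "(\<Prod>c\<in>(Basis::'a set). \<integral>\<^sup>+x. f c x \<partial>lborel) = (\<Prod>c\<in>(Basis::'a set). ennreal (if c = b then sqrt pi / 2 else sqrt pi))"
    by (intro prod.cong) (auto simp: f_def nn_integral_real_gaussian nn_integral_real_gaussian_square)
  also have "\<dots> = ennreal (\<Prod>c\<in>(Basis::'a set). (if c = b then 1 / 2 else 1) * sqrt pi)"
    by (subst prod_ennreal) (auto intro!: arg_cong[where f = ennreal] prod.cong)
  also have "\<dots> = ennreal (1 / 2 * sqrt pi ^ DIM('a))" using assms by (simp add: prod.distrib)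
  also have "\<dots> / ennreal (sqrt pi ^ DIM('a)) = ennreal (1 / 2)" by (subst divide_ennreal) auto
  finally show ?thesis .
qed

lemma nn_integral_lborel_affine:
  fixes f :: "'a::euclidean_space \<Rightarrow> ennreal"
  assumes [measurable]: "f \<in> borel_measurable borel" and c: "c \<noteq> 0"
  shows "(\<integral>\<^sup>+x. f x \<partial>lborel) = ennreal (\<bar>c\<bar> ^ DIM('a)) * (\<integral>\<^sup>+x. f (t + c *\<^sub>R x) \<partial>lborel)"
  by (subst lborel_affine[OF c, of t]) (simp add: nn_integral_density nn_integral_distr nn_integral_cmult)

text \<open>Two independent standard Gaussian vectors form a rotation invariant pair. The rotation is
  carried out by two affine substitutions, one in each variable, whose Jacobians cancel.\<close>

lemma nn_integral_gauss_rotation: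
  fixes F :: "'a::euclidean_space \<Rightarrow> 'a \<Rightarrow> ennreal"
  assumes F [measurable]: "case_prod F \<in> borel_measurable (borel \<Otimes>\<^sub>M borel)" and s: "s > 0" and se: "s\<^sup>2 + \<epsilon>\<^sup>2 = 1"
  shows "(\<integral>\<^sup>+y. \<integral>\<^sup>+w. F (s *\<^sub>R y - \<epsilon> *\<^sub>R w) (\<epsilon> *\<^sub>R y + s *\<^sub>R w) \<partial>gauss \<partial>gauss) = (\<integral>\<^sup>+y. \<integral>\<^sup>+w. F y w \<partial>gauss \<partial>gauss)"
proof -
  define N where "N = DIM('a)"
  have [measurable]: "(\<lambda>x. F (f x) (g x)) \<in> borel_measurable M" if "f \<in> borel_measurable M" "g \<in> borel_measurable M" for f g and M :: "'b measure"
    using measurable_compose[OF measurable_Pair[OF that] F[unfolded split_def]] by simp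
  have [measurable]: "(\<lambda>x. F (f x) (g x)) \<in> borel_measurable M" if "f \<in> borel_measurable M" "g \<in> borel_measurable M" for f g and M :: "('a \<times> 'a) measure"
    using measurable_compose[OF measurable_Pair[OF that] F[unfolded split_def]] by simp
  have [measurable]: "(\<lambda>x. F (f x) (g x)) \<in> borel_measurable M" if "f \<in> borel_measurable M" "g \<in> borel_measurable M" for f g and M :: "'a measure"
    using measurable_compose[OF measurable_Pair[OF that] F[unfolded split_def]] by simp
  define H where "H y w = gauss_density y * (gauss_density w * F (s *\<^sub>R y - \<epsilon> *\<^sub>R w) (\<epsilon> *\<^sub>R y + s *\<^sub>R w))" for y w
  have sub1: "(\<integral>\<^sup>+y. H y w \<partial>lborel) = ennreal (\<bar>1 / s\<bar> ^ N) * (\<integral>\<^sup>+u. H ((\<epsilon> / s) *\<^sub>R w + (1 / s) *\<^sub>R u) w \<partial>lborel)" for w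
    unfolding N_def using s by (intro nn_integral_lborel_affine) (auto simp: H_def)
  have sub2: "(\<integral>\<^sup>+w. H ((\<epsilon> / s) *\<^sub>R w + (1 / s) *\<^sub>R u) w \<partial>lborel)
     = ennreal (\<bar>s\<bar> ^ N) * (\<integral>\<^sup>+v. gauss_density u * (gauss_density v * F u v) \<partial>lborel)" for u
  proof -
    have "(\<integral>\<^sup>+w. H ((\<epsilon> / s) *\<^sub>R w + (1 / s) *\<^sub>R u) w \<partial>lborel) = ennreal (\<bar>s\<bar> ^ N) *
       (\<integral>\<^sup>+v. H ((\<epsilon> / s) *\<^sub>R (- \<epsilon> *\<^sub>R u + s *\<^sub>R v) + (1 / s) *\<^sub>R u) (- \<epsilon> *\<^sub>R u + s *\<^sub>R v) \<partial>lborel)"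
      unfolding N_def using s by (intro nn_integral_lborel_affine) (auto simp: H_def)
    also have "(\<integral>\<^sup>+v. H ((\<epsilon> / s) *\<^sub>R (- \<epsilon> *\<^sub>R u + s *\<^sub>R v) + (1 / s) *\<^sub>R u) (- \<epsilon> *\<^sub>R u + s *\<^sub>R v) \<partial>lborel)
      = (\<integral>\<^sup>+v. gauss_density u * (gauss_density v * F u v) \<partial>lborel)"
    proof (intro nn_integral_cong)
      fix v :: 'a
      have "\<epsilon> / s * (- \<epsilon>) + 1 / s = s" using s se by (simp add: field_simps power2_eq_square)
      have y: "(\<epsilon> / s) *\<^sub>R (- \<epsilon> *\<^sub>R u + s *\<^sub>R v) + (1 / s) *\<^sub>R u = s *\<^sub>R u + \<epsilon> *\<^sub>R v"
      proof -
        have "(\<epsilon> / s) *\<^sub>R (- \<epsilon> *\<^sub>R u + s *\<^sub>R v) + (1 / s) *\<^sub>R u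
          = (\<epsilon> / s * (- \<epsilon>) + 1 / s) *\<^sub>R u + (\<epsilon> / s * s) *\<^sub>R v"
          by (simp only: scaleR_add_right scaleR_scaleR scaleR_add_left add_ac)
        then show ?thesis using s \<open>\<epsilon> / s * (- \<epsilon>) + 1 / s = s\<close> by simp
      qed
      have 1: "s *\<^sub>R (s *\<^sub>R u + \<epsilon> *\<^sub>R v) - \<epsilon> *\<^sub>R (- \<epsilon> *\<^sub>R u + s *\<^sub>R v) = u"
      proof -
        have "s *\<^sub>R (s *\<^sub>R u + \<epsilon> *\<^sub>R v) - \<epsilon> *\<^sub>R (- \<epsilon> *\<^sub>R u + s *\<^sub>R v) = (s\<^sup>2 + \<epsilon>\<^sup>2) *\<^sub>R u"
          by (simp add: algebra_simps power2_eq_square)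
        then show ?thesis by (simp add: se)
      qed
      have 2: "\<epsilon> *\<^sub>R (s *\<^sub>R u + \<epsilon> *\<^sub>R v) + s *\<^sub>R (- \<epsilon> *\<^sub>R u + s *\<^sub>R v) = v"
      proof -
        have "\<epsilon> *\<^sub>R (s *\<^sub>R u + \<epsilon> *\<^sub>R v) + s *\<^sub>R (- \<epsilon> *\<^sub>R u + s *\<^sub>R v) = (s\<^sup>2 + \<epsilon>\<^sup>2) *\<^sub>R v"
          by (simp add: algebra_simps power2_eq_square)
        then show ?thesis by (simp add: se)
      qed
      have "(norm (s *\<^sub>R u + \<epsilon> *\<^sub>R v))\<^sup>2 + (norm (- \<epsilon> *\<^sub>R u + s *\<^sub>R v))\<^sup>2 = (s\<^sup>2 + \<epsilon>\<^sup>2) * ((norm u)\<^sup>2 + (norm v)\<^sup>2)"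
        unfolding power2_norm_eq_inner
        by (simp add: inner_add_left inner_add_right inner_diff_left inner_diff_right inner_commute power2_eq_square algebra_simps)
      then have "exp (- (norm (s *\<^sub>R u + \<epsilon> *\<^sub>R v))\<^sup>2) * exp (- (norm (- \<epsilon> *\<^sub>R u + s *\<^sub>R v))\<^sup>2) = exp (- (norm u)\<^sup>2) * exp (- (norm v)\<^sup>2)"
        by (simp add: se flip: exp_add)
      then have 3: "gauss_density (s *\<^sub>R u + \<epsilon> *\<^sub>R v) * gauss_density (- \<epsilon> *\<^sub>R u + s *\<^sub>R v) = gauss_density u * gauss_density v"
        by (simp flip: ennreal_mult)
      show "H ((\<epsilon> / s) *\<^sub>R (- \<epsilon> *\<^sub>R u + s *\<^sub>R v) + (1 / s) *\<^sub>R u) (- \<epsilon> *\<^sub>R u + s *\<^sub>R v) = gauss_density u * (gauss_density v * F u v)"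
        unfolding y H_def 1 2 using 3 by (simp only: mult.assoc[symmetric])
    qed
    finally show ?thesis .
  qed
  have "(\<integral>\<^sup>+y. \<integral>\<^sup>+w. F (s *\<^sub>R y - \<epsilon> *\<^sub>R w) (\<epsilon> *\<^sub>R y + s *\<^sub>R w) \<partial>gauss \<partial>gauss) = (\<integral>\<^sup>+y. \<integral>\<^sup>+w. H y w \<partial>lborel \<partial>lborel)"
  proof -
    have "(\<integral>\<^sup>+y. \<integral>\<^sup>+w. F (s *\<^sub>R y - \<epsilon> *\<^sub>R w) (\<epsilon> *\<^sub>R y + s *\<^sub>R w) \<partial>gauss \<partial>gauss)
      = (\<integral>\<^sup>+y. gauss_density y * (\<integral>\<^sup>+w. gauss_density w * F (s *\<^sub>R y - \<epsilon> *\<^sub>R w) (\<epsilon> *\<^sub>R y + s *\<^sub>R w) \<partial>lborel) \<partial>lborel)"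
      by (simp add: nn_integral_gauss)
    also have "\<dots> = (\<integral>\<^sup>+y. \<integral>\<^sup>+w. H y w \<partial>lborel \<partial>lborel)"
      unfolding H_def by (intro nn_integral_cong nn_integral_cmult[symmetric]) simp
    finally show ?thesis .
  qed
  also have "\<dots> = (\<integral>\<^sup>+w. \<integral>\<^sup>+y. H y w \<partial>lborel \<partial>lborel)"
    by (rule lborel_pair.Fubini') (simp add: H_def split_def)
  also have "\<dots> = (\<integral>\<^sup>+w. \<integral>\<^sup>+u. ennreal (\<bar>1 / s\<bar> ^ N) * H ((\<epsilon> / s) *\<^sub>R w + (1 / s) *\<^sub>R u) w \<partial>lborel \<partial>lborel)"
    unfolding sub1 by (intro nn_integral_cong nn_integral_cmult[symmetric]) (simp add: H_def)
  also have "\<dots> = (\<integral>\<^sup>+u. \<integral>\<^sup>+w. ennreal (\<bar>1 / s\<bar> ^ N) * H ((\<epsilon> / s) *\<^sub>R w + (1 / s) *\<^sub>R u) w \<partial>lborel \<partial>lborel)"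
    by (rule lborel_pair.Fubini') (simp add: H_def split_def)
  also have "\<dots> = (\<integral>\<^sup>+u. \<integral>\<^sup>+v. gauss_density u * (gauss_density v * F u v) \<partial>lborel \<partial>lborel)"
  proof (rule nn_integral_cong)
    fix u :: 'a
    have "(\<integral>\<^sup>+w. ennreal (\<bar>1 / s\<bar> ^ N) * H ((\<epsilon> / s) *\<^sub>R w + (1 / s) *\<^sub>R u) w \<partial>lborel)
      = ennreal (\<bar>1 / s\<bar> ^ N) * (ennreal (\<bar>s\<bar> ^ N) * (\<integral>\<^sup>+v. gauss_density u * (gauss_density v * F u v) \<partial>lborel))"
      unfolding sub2[symmetric] by (intro nn_integral_cmult) (simp add: H_def)
    also have "ennreal (\<bar>1 / s\<bar> ^ N) * (ennreal (\<bar>s\<bar> ^ N) * X) = X" for X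
    proof -
      have "\<bar>1 / s\<bar> ^ N * \<bar>s\<bar> ^ N = 1" using s by (simp add: power_divide)
      then have "ennreal (\<bar>1 / s\<bar> ^ N) * ennreal (\<bar>s\<bar> ^ N) = 1" by (simp flip: ennreal_mult)
      then show ?thesis by (simp flip: mult.assoc)
    qed
    finally show "(\<integral>\<^sup>+w. ennreal (\<bar>1 / s\<bar> ^ N) * H ((\<epsilon> / s) *\<^sub>R w + (1 / s) *\<^sub>R u) w \<partial>lborel) = (\<integral>\<^sup>+v. gauss_density u * (gauss_density v * F u v) \<partial>lborel)" .
  qed
  also have "\<dots> = (\<integral>\<^sup>+y. \<integral>\<^sup>+w. F y w \<partial>gauss \<partial>gauss)"
  proof -
    have "(\<integral>\<^sup>+u. \<integral>\<^sup>+v. gauss_density u * (gauss_density v * F u v) \<partial>lborel \<partial>lborel) = (\<integral>\<^sup>+u. gauss_density u * (\<integral>\<^sup>+v. gauss_density v * F u v \<partial>lborel) \<partial>lborel)"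
      by (intro nn_integral_cong nn_integral_cmult) simp
    also have "\<dots> = (\<integral>\<^sup>+y. \<integral>\<^sup>+w. F y w \<partial>gauss \<partial>gauss)"
      by (simp add: nn_integral_gauss)
    finally show ?thesis .
  qed
  finally show ?thesis .
qed

lemma AE_gauss_iff: "(AE y in gauss. P y) \<longleftrightarrow> (AE y in lborel. P (y::'a::euclidean_space))"
proof -
  have "0 < gauss_density y" for y :: 'a by simp
  then show ?thesis unfolding gauss_def by (subst AE_density) auto
qed

lemma distr_gauss_isometry:
  fixes T :: "'a::euclidean_space \<Rightarrow> 'a"
  assumes [measurable]: "T \<in> borel_measurable borel" and T: "distr lborel borel T = lborel"
    and n: "\<And>x. norm (T x) = norm x"
  shows "distr gauss borel T = gauss"
proof (rule measure_eqI)
  fix A assume "A \<in> sets (distr gauss borel T)"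
  then have [measurable]: "A \<in> sets borel" by simp
  have "emeasure (distr gauss borel T) A = (\<integral>\<^sup>+y. indicator A (T y) \<partial>gauss)"
  proof -
    have "emeasure (distr gauss borel T) A = (\<integral>\<^sup>+y. indicator A y \<partial>distr gauss borel T)" by simp
    also have "\<dots> = (\<integral>\<^sup>+y. indicator A (T y) \<partial>gauss)" by (rule nn_integral_distr) auto
    finally show ?thesis .
  qed
  also have "\<dots> = (\<integral>\<^sup>+y. gauss_density (T y) * indicator A (T y) \<partial>lborel)"
    by (simp add: nn_integral_gauss n)
  also have "\<dots> = (\<integral>\<^sup>+y. gauss_density y * indicator A y \<partial>distr lborel borel T)"
    by (subst nn_integral_distr) auto
  also have "\<dots> = emeasure gauss A"
    unfolding T by (simp add: gauss_def emeasure_density)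
  finally show "emeasure (distr gauss borel T) A = emeasure gauss A" .
qed simp

lemma distr_lborel_signs:
  fixes c :: "'a::euclidean_space \<Rightarrow> real"
  assumes c: "\<And>j. j \<in> Basis \<Longrightarrow> \<bar>c j\<bar> = 1"
  shows "distr lborel borel (\<lambda>x. \<Sum>j\<in>Basis. (c j * (x \<bullet> j)) *\<^sub>R j) = (lborel :: 'a measure)"
proof -
  have "c j \<noteq> 0" if "j \<in> Basis" for j using c[OF that] by auto
  then have "lborel = density (distr lborel borel (\<lambda>x. 0 + (\<Sum>j\<in>Basis. (c j * (x \<bullet> j)) *\<^sub>R j))) (\<lambda>_. (\<Prod>j\<in>(Basis::'a set). \<bar>c j\<bar>))"
    by (rule lborel_affine_euclidean)
  then show ?thesis by (simp add: c density_1)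
qed

lemma norm_signs:
  fixes c :: "'a::euclidean_space \<Rightarrow> real"
  assumes c: "\<And>j. j \<in> Basis \<Longrightarrow> \<bar>c j\<bar> = 1"
  shows "norm (\<Sum>j\<in>Basis. (c j * (x \<bullet> j)) *\<^sub>R j) = norm x"
proof -
  define T where "T = (\<Sum>j\<in>Basis. (c j * (x \<bullet> j)) *\<^sub>R j)"
  have sq: "(norm y)\<^sup>2 = (\<Sum>b\<in>Basis. (y \<bullet> b)\<^sup>2)" for y :: 'a
    unfolding power2_norm_eq_inner by (subst euclidean_inner) (simp add: power2_eq_square)
  have "(T \<bullet> j)\<^sup>2 = (x \<bullet> j)\<^sup>2" if "j \<in> Basis" for j
  proof -
    have "T \<bullet> j = c j * (x \<bullet> j)"
      unfolding T_def using that by (simp add: inner_sum_left inner_Basis if_distrib cong: if_cong)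
    moreover have "(c j)\<^sup>2 = 1" using c[OF that] by (metis one_power2 power2_abs)
    ultimately show ?thesis by (simp add: power_mult_distrib)
  qed
  then have "(norm T)\<^sup>2 = (norm x)\<^sup>2" unfolding sq by (intro sum.cong) auto
  then show ?thesis by (simp add: T_def)
qed

lemma distr_gauss_signs:
  fixes c :: "'a::euclidean_space \<Rightarrow> real"
  assumes c: "\<And>j. j \<in> Basis \<Longrightarrow> \<bar>c j\<bar> = 1"
  shows "distr gauss borel (\<lambda>x. \<Sum>j\<in>Basis. (c j * (x \<bullet> j)) *\<^sub>R j) = (gauss :: 'a measure)"
  by (rule distr_gauss_isometry) (auto simp: distr_lborel_signs c norm_signs)

lemma distr_gauss_uminus: "distr gauss borel uminus = (gauss :: 'a::euclidean_space measure)"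
proof -
  have "(\<Sum>j\<in>Basis. (-1 * (x \<bullet> j)) *\<^sub>R j) = - x" for x :: 'a
    by (simp add: sum_negf euclidean_representation)
  then show ?thesis using distr_gauss_signs[of "\<lambda>_::'a. -1"] by simp
qed

lemma power_le_exp_half_square:
  fixes x :: real assumes "x \<ge> 0"
  shows "x ^ k \<le> fact k * exp (1 / 2) * exp (x\<^sup>2 / 2)"
proof -
  have "x ^ k /\<^sub>R fact k = (\<Sum>n\<in>{k}. (x ^ n /\<^sub>R fact n))" by simp
  also have "\<dots> \<le> exp x"
    using assms unfolding exp_def by (intro sum_le_suminf summable_exp_generic) auto
  also have "x \<le> 1 / 2 + x\<^sup>2 / 2" using zero_le_power2[of "x - 1"] by (simp add: power2_diff field_simps)
  then have "exp x \<le> exp (1 / 2) * exp (x\<^sup>2 / 2)" by (simp flip: exp_add)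
  finally show ?thesis by (simp add: field_simps)
qed

lemma nn_integral_gauss_exp: "(\<integral>\<^sup>+y. ennreal (exp ((norm (y::'a::euclidean_space))\<^sup>2 / 2)) \<partial>gauss) < \<infinity>"
proof -
  have "(\<integral>\<^sup>+y. ennreal (exp ((norm (y::'a))\<^sup>2 / 2)) \<partial>gauss) = (\<integral>\<^sup>+y. ennreal (exp (- (norm (y::'a))\<^sup>2 / 2) / sqrt pi ^ DIM('a)) \<partial>lborel)"
    by (subst nn_integral_gauss) (auto intro!: nn_integral_cong simp flip: ennreal_mult exp_add)
  also have "\<dots> = ennreal (\<bar>sqrt 2\<bar> ^ DIM('a)) * (\<integral>\<^sup>+y. gauss_density y \<partial>(lborel :: 'a measure))"
    by (subst nn_integral_lborel_affine[of _ "sqrt 2" 0]) (auto simp: power_mult_distrib)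
  also have "(\<integral>\<^sup>+y. gauss_density y \<partial>(lborel :: 'a measure)) = emeasure (gauss :: 'a measure) UNIV"
    by (simp add: gauss_def emeasure_density)
  also have "\<dots> = 1" using gauss.emeasure_space_1 by simp
  finally show ?thesis by simp
qed

lemma integrable_norm_power [simp, intro]: "integrable gauss (\<lambda>y::'a::euclidean_space. norm y ^ k)"
proof (rule integrableI_bounded)
  have "(\<integral>\<^sup>+y. ennreal (norm (norm (y::'a) ^ k)) \<partial>gauss) \<le> (\<integral>\<^sup>+y. ennreal (fact k * exp (1 / 2)) * ennreal (exp ((norm (y::'a))\<^sup>2 / 2)) \<partial>gauss)"
    by (intro nn_integral_mono) (simp flip: ennreal_mult, simp add: power_le_exp_half_square)
  also have "\<dots> = ennreal (fact k * exp (1 / 2)) * (\<integral>\<^sup>+y. ennreal (exp ((norm (y::'a))\<^sup>2 / 2)) \<partial>gauss)"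
    by (intro nn_integral_cmult) simp
  also have "\<dots> < \<infinity>" using nn_integral_gauss_exp[where 'a = 'a] by (simp add: ennreal_mult_less_top)
  finally show "(\<integral>\<^sup>+y. ennreal (norm (norm (y::'a) ^ k)) \<partial>gauss) < \<infinity>" .
qed simp

lemma integrable_gauss_poly:
  fixes f :: "'a::euclidean_space \<Rightarrow> real"
  assumes [measurable]: "f \<in> borel_measurable borel" and f: "\<And>z. \<bar>f z\<bar> \<le> c * (1 + norm z ^ k)"
  shows "integrable gauss f"
proof (rule Bochner_Integration.integrable_bound)
  show "integrable gauss (\<lambda>z::'a. c * (1 + norm z ^ k))" by (intro integrable_mult_right integrable_add) auto
  have "\<bar>f z\<bar> \<le> \<bar>c * (1 + norm z ^ k)\<bar>" for z using f[of z] by linarith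
  then show "AE x in gauss. norm (f x) \<le> norm (c * (1 + norm x ^ k))" by simp
qed simp

lemma integrable_gauss_pair_poly:
  fixes f :: "'a::euclidean_space \<times> 'b::euclidean_space \<Rightarrow> real"
  assumes [measurable]: "f \<in> borel_measurable (borel \<Otimes>\<^sub>M borel)"
    and f: "\<And>w z. \<bar>f (w, z)\<bar> \<le> c * ((1 + norm w ^ k) * (1 + norm z ^ l))"
  shows "integrable (gauss \<Otimes>\<^sub>M gauss) f"
proof (rule integrableI_bounded)
  define A where "A = (\<integral>\<^sup>+z. ennreal (1 + norm (z::'a) ^ k) \<partial>gauss)"
  define B where "B = (\<integral>\<^sup>+z. ennreal (1 + norm (z::'b) ^ l) \<partial>gauss)"
  have "A = ennreal (\<integral>z. 1 + norm (z::'a) ^ k \<partial>gauss)" "B = ennreal (\<integral>z. 1 + norm (z::'b) ^ l \<partial>gauss)"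
    unfolding A_def B_def by (rule nn_integral_eq_integral; simp)+
  then have AB: "A < \<infinity>" "B < \<infinity>" by auto
  have "(\<integral>\<^sup>+x. ennreal (norm (f x)) \<partial>(gauss \<Otimes>\<^sub>M gauss)) = (\<integral>\<^sup>+w. \<integral>\<^sup>+z. ennreal (norm (f (w, z))) \<partial>gauss \<partial>gauss)"
    by (rule gauss.nn_integral_fst[symmetric]) simp
  also have "\<dots> \<le> (\<integral>\<^sup>+w. \<integral>\<^sup>+z. ennreal \<bar>c\<bar> * (ennreal (1 + norm (w::'a) ^ k) * ennreal (1 + norm (z::'b) ^ l)) \<partial>gauss \<partial>gauss)"
  proof (intro nn_integral_mono)
    fix w :: 'a and z :: 'b
    have "\<bar>f (w, z)\<bar> \<le> \<bar>c\<bar> * ((1 + norm w ^ k) * (1 + norm z ^ l))"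
      by (rule order_trans[OF f]) (intro mult_right_mono, auto)
    then show "ennreal (norm (f (w, z))) \<le> ennreal \<bar>c\<bar> * (ennreal (1 + norm w ^ k) * ennreal (1 + norm z ^ l))"
      by (simp del: ennreal_plus add: ennreal_mult[symmetric])
  qed
  also have "\<dots> = ennreal \<bar>c\<bar> * (A * B)"
    by (simp add: nn_integral_cmult nn_integral_multc A_def B_def)
  also have "\<dots> < \<infinity>" using AB by (simp add: ennreal_mult_less_top)
  finally show "(\<integral>\<^sup>+x. ennreal (norm (f x)) \<partial>(gauss \<Otimes>\<^sub>M gauss)) < \<infinity>" .
qed simp

text \<open>Distinct coordinates are uncorrelated because flipping the sign of one of them preserves the
  measure.\<close>

lemma integral_gauss_coordinates:
  fixes b c :: "'a::euclidean_space"
  assumes b: "b \<in> Basis" and c: "c \<in> Basis"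
  shows "integrable gauss (\<lambda>y. (y \<bullet> b) * (y \<bullet> c))"
    and "(\<integral>y. (y \<bullet> b) * (y \<bullet> c) \<partial>gauss) = (if b = c then 1 / 2 else 0)"
proof -
  show I: "integrable gauss (\<lambda>y. (y \<bullet> b) * (y \<bullet> c))"
  proof (rule integrable_gauss_poly[where k = 2 and c = 1])
    fix z :: 'a
    have "\<bar>z \<bullet> b\<bar> * \<bar>z \<bullet> c\<bar> \<le> norm z * norm z" by (intro mult_mono Basis_le_norm b c) auto
    then show "\<bar>(z \<bullet> b) * (z \<bullet> c)\<bar> \<le> 1 * (1 + (norm z)\<^sup>2)" by (simp add: abs_mult power2_eq_square)
  qed simp
  show "(\<integral>y. (y \<bullet> b) * (y \<bullet> c) \<partial>gauss) = (if b = c then 1 / 2 else 0)"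
  proof (cases "b = c")
    case True
    have "ennreal (\<integral>y. (y \<bullet> b)\<^sup>2 \<partial>gauss) = (\<integral>\<^sup>+y. ennreal ((y \<bullet> b)\<^sup>2) \<partial>gauss)"
      using I True by (intro nn_integral_eq_integral[symmetric]) (auto simp: power2_eq_square)
    then have "ennreal (\<integral>y. (y \<bullet> b)\<^sup>2 \<partial>gauss) = ennreal (1 / 2)" by (simp add: nn_integral_gauss_square_coordinate b)
    then have "(\<integral>y. (y \<bullet> b)\<^sup>2 \<partial>gauss) = 1 / 2" by (subst (asm) ennreal_inj) auto
    then show ?thesis using True by (simp add: power2_eq_square)
  next
    case False
    define s where "s j = (if j = b then -1 else 1 :: real)" for j
    define T where "T x = (\<Sum>j\<in>Basis. (s j * (x \<bullet> j)) *\<^sub>R j)" for x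
    have Tj: "T x \<bullet> j = s j * (x \<bullet> j)" if "j \<in> Basis" for x j
      using that by (simp add: T_def inner_sum_left inner_Basis if_distrib cong: if_cong)
    have "gauss = distr gauss borel T"
      unfolding T_def by (rule distr_gauss_signs[symmetric]) (simp add: s_def)
    then have "(\<integral>y. (y \<bullet> b) * (y \<bullet> c) \<partial>gauss) = (\<integral>y. (y \<bullet> b) * (y \<bullet> c) \<partial>distr gauss borel T)" by simp
    also have "\<dots> = (\<integral>y. (T y \<bullet> b) * (T y \<bullet> c) \<partial>gauss)"
      by (rule integral_distr) (auto simp: T_def[abs_def])
    also have "\<dots> = - (\<integral>y. (y \<bullet> b) * (y \<bullet> c) \<partial>gauss)"
      using False by (simp add: Tj b c s_def)
    finally show ?thesis using False by simp
  qed
qed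

lemma gauss_linear_second_moment:
  fixes L :: "'a::euclidean_space \<Rightarrow> 'b::euclidean_space"
  assumes L: "linear L"
  shows "integrable gauss (\<lambda>y. (norm (L y))\<^sup>2)"
    and "(\<integral>y. (norm (L y))\<^sup>2 \<partial>gauss) = (\<Sum>b\<in>Basis. (norm (L b))\<^sup>2) / 2"
proof -
  have eq: "(norm (L y))\<^sup>2 = (\<Sum>b\<in>Basis. \<Sum>c\<in>Basis. ((y \<bullet> b) * (y \<bullet> c)) * (L b \<bullet> L c))" for y
  proof -
    have "L y = L (\<Sum>b\<in>Basis. (y \<bullet> b) *\<^sub>R b)" by (simp add: euclidean_representation)
    also have "\<dots> = (\<Sum>b\<in>Basis. (y \<bullet> b) *\<^sub>R L b)" by (simp add: linear_sum[OF L] linear_scale[OF L])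
    finally show ?thesis
      by (simp add: power2_norm_eq_inner inner_sum_left inner_sum_right sum_distrib_left mult_ac)
         (intro sum.cong refl, simp add: inner_commute)
  qed
  show "integrable gauss (\<lambda>y. (norm (L y))\<^sup>2)"
    unfolding eq by (intro Bochner_Integration.integrable_sum integrable_mult_left integral_gauss_coordinates)
  have "(\<integral>y. (norm (L y))\<^sup>2 \<partial>gauss) = (\<Sum>b\<in>Basis. \<Sum>c\<in>Basis. (if b = c then 1 / 2 else 0) * (L b \<bullet> L c))"
    unfolding eq
    by (simp add: Bochner_Integration.integral_sum integral_gauss_coordinates integrable_mult_left Bochner_Integration.integrable_sum)
  also have "\<dots> = (\<Sum>b\<in>Basis. (norm (L b))\<^sup>2) / 2"
    by (simp add: if_distrib if_distribR power2_norm_eq_inner sum_divide_distrib cong: if_cong)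
  finally show "(\<integral>y. (norm (L y))\<^sup>2 \<partial>gauss) = (\<Sum>b\<in>Basis. (norm (L b))\<^sup>2) / 2" .
qed

lemma distr_gauss_pair:
  fixes s \<epsilon> :: real
  assumes "s > 0" "s\<^sup>2 + \<epsilon>\<^sup>2 = 1"
  shows "distr (gauss \<Otimes>\<^sub>M gauss) borel (\<lambda>(y, w). \<epsilon> *\<^sub>R y + s *\<^sub>R w) = (gauss :: 'a::euclidean_space measure)"
proof (rule measure_eqI)
  fix A assume "A \<in> sets (distr (gauss \<Otimes>\<^sub>M gauss) borel (\<lambda>(y, w). \<epsilon> *\<^sub>R y + s *\<^sub>R w) :: 'a measure)"
  then have [measurable]: "A \<in> sets borel" by simp
  define F where "F u v = (indicator A v :: ennreal)" for u v :: 'a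
  have "emeasure (distr (gauss \<Otimes>\<^sub>M gauss) borel (\<lambda>(y, w). \<epsilon> *\<^sub>R y + s *\<^sub>R w)) A
    = (\<integral>\<^sup>+v. indicator A v \<partial>distr (gauss \<Otimes>\<^sub>M gauss) borel (\<lambda>(y, w). \<epsilon> *\<^sub>R y + s *\<^sub>R w))"
    by (simp add: split_def)
  also have "\<dots> = (\<integral>\<^sup>+x. indicator A (\<epsilon> *\<^sub>R fst x + s *\<^sub>R snd x) \<partial>(gauss \<Otimes>\<^sub>M gauss))"
    by (subst nn_integral_distr) (auto simp: split_def)
  also have "\<dots> = (\<integral>\<^sup>+y. \<integral>\<^sup>+w. F (s *\<^sub>R y - \<epsilon> *\<^sub>R w) (\<epsilon> *\<^sub>R y + s *\<^sub>R w) \<partial>gauss \<partial>gauss)"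
    by (subst gauss.nn_integral_fst[symmetric]) (auto simp: F_def)
  also have "\<dots> = (\<integral>\<^sup>+y. \<integral>\<^sup>+w. F y w \<partial>(gauss :: 'a measure) \<partial>(gauss :: 'a measure))"
    by (rule nn_integral_gauss_rotation) (use assms in \<open>auto simp: F_def split_def\<close>)
  also have "\<dots> = emeasure gauss A" by (simp add: F_def gauss.emeasure_space_1[simplified])
  finally show "emeasure (distr (gauss \<Otimes>\<^sub>M gauss) borel (\<lambda>(y, w). \<epsilon> *\<^sub>R y + s *\<^sub>R w)) A = emeasure gauss A" .
qed simp

text \<open>Scaling the argument is traded for a density that tends to one as the scale does; this keeps
  the base point fixed when Fatou's lemma is applied.\<close>

lemma nn_integral_gauss_scaled:
  fixes h :: "'a::euclidean_space \<Rightarrow> ennreal"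
  assumes [measurable]: "h \<in> borel_measurable borel" and s: "s > 0"
  shows "(\<integral>\<^sup>+y. h (s *\<^sub>R y) \<partial>gauss) = (\<integral>\<^sup>+u. ennreal (exp (- (norm u)\<^sup>2 * (1 / s\<^sup>2 - 1)) / s ^ DIM('a)) * h u \<partial>gauss)"
proof -
  have "(\<integral>\<^sup>+y. h (s *\<^sub>R y) \<partial>gauss) = (\<integral>\<^sup>+y. gauss_density y * h (s *\<^sub>R y) \<partial>lborel)" by (simp add: nn_integral_gauss)
  also have "\<dots> = ennreal (\<bar>1 / s\<bar> ^ DIM('a)) * (\<integral>\<^sup>+u. gauss_density (0 + (1 / s) *\<^sub>R u) * h (s *\<^sub>R (0 + (1 / s) *\<^sub>R u)) \<partial>lborel)"
    using s by (intro nn_integral_lborel_affine) auto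
  also have "\<dots> = (\<integral>\<^sup>+u. ennreal (\<bar>1 / s\<bar> ^ DIM('a)) * (gauss_density ((1 / s) *\<^sub>R u) * h u) \<partial>lborel)"
    using s by (subst nn_integral_cmult) auto
  also have "\<dots> = (\<integral>\<^sup>+u. gauss_density u * (ennreal (exp (- (norm u)\<^sup>2 * (1 / s\<^sup>2 - 1)) / s ^ DIM('a)) * h u) \<partial>lborel)"
  proof (intro nn_integral_cong)
    fix u :: 'a
    have "\<bar>1 / s\<bar> ^ DIM('a) * (exp (- (norm ((1 / s) *\<^sub>R u))\<^sup>2) / sqrt pi ^ DIM('a))
      = exp (- (norm u)\<^sup>2) / sqrt pi ^ DIM('a) * (exp (- (norm u)\<^sup>2 * (1 / s\<^sup>2 - 1)) / s ^ DIM('a))"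
      using s by (simp add: power_divide power_mult_distrib algebra_simps flip: exp_add)
    then show "ennreal (\<bar>1 / s\<bar> ^ DIM('a)) * (gauss_density ((1 / s) *\<^sub>R u) * h u)
      = gauss_density u * (ennreal (exp (- (norm u)\<^sup>2 * (1 / s\<^sup>2 - 1)) / s ^ DIM('a)) * h u)"
      using s by (simp add: mult.assoc[symmetric] ennreal_mult[symmetric])
  qed
  also have "\<dots> = (\<integral>\<^sup>+u. ennreal (exp (- (norm u)\<^sup>2 * (1 / s\<^sup>2 - 1)) / s ^ DIM('a)) * h u \<partial>gauss)"
    by (simp add: nn_integral_gauss)
  finally show ?thesis .
qed

section \<open>Functions with a quadratic lower bound\<close>

lemma AE_lborel_translate:
  assumes "AE z in lborel. P (z::'a::euclidean_space)"
  shows "AE z in lborel. P (x + z)"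
proof -
  obtain N where N: "{z \<in> space lborel. \<not> P z} \<subseteq> N" "emeasure lborel N = 0" "N \<in> sets lborel"
    using assms by (auto elim: AE_E)
  have "emeasure lborel ((+) x -` N) = emeasure (distr lborel borel ((+) x)) N"
    using N by (subst emeasure_distr) auto
  also have "\<dots> = 0" using N by (simp add: lborel_distr_plus)
  finally have "emeasure lborel ((+) x -` N) = 0" .
  moreover have "(+) x -` N \<in> sets lborel"
    using N(3) measurable_sets[of "(+) x" "borel :: 'a measure" "borel :: 'a measure" N] by simp
  ultimately show ?thesis
    by (intro AE_I[of _ _ "(+) x -` N"]) (use N in auto)
qed

text \<open>The hypothesis makes the function lower semicontinuous.\<close>

lemma borel_measurable_quadratic_lower_bound:
  fixes \<phi> :: "'a::euclidean_space \<Rightarrow> real"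
  assumes S1: "\<And>z w. \<phi> (z + w) \<ge> \<phi> z + g z \<bullet> w - C * (norm w)\<^sup>2 * (1 + (norm z)\<^sup>2)"
  shows "\<phi> \<in> borel_measurable borel"
proof (rule borel_measurableI_greater)
  fix a
  have "open {z. a < \<phi> z}"
  proof (subst open_subopen, intro ballI)
    fix z assume "z \<in> {z. a < \<phi> z}"
    then have z: "a < \<phi> z" by simp
    define h where "h y = \<phi> z + g z \<bullet> (y - z) - C * (norm (y - z))\<^sup>2 * (1 + (norm z)\<^sup>2)" for y
    have "continuous_on UNIV h" unfolding h_def by (intro continuous_intros)
    then have "open {y. a < h y}" by (intro open_Collect_less) auto
    moreover have "z \<in> {y. a < h y}" using z by (simp add: h_def)
    moreover have "{y. a < h y} \<subseteq> {z. a < \<phi> z}"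
    proof safe
      fix y assume "a < h y"
      also have "h y \<le> \<phi> y" using S1[of z "y - z"] by (simp add: h_def)
      finally show "a < \<phi> y" .
    qed
    ultimately show "\<exists>T. open T \<and> z \<in> T \<and> T \<subseteq> {z. a < \<phi> z}" by blast
  qed
  then show "{x \<in> space borel. a < \<phi> x} \<in> sets borel" by simp
qed

lemma norm_add_sq_le: "(norm (x + y))\<^sup>2 \<le> 2 * (norm x)\<^sup>2 + 2 * (norm y)\<^sup>2" for x y :: "'a::real_inner"
  using zero_le_power2[of "norm (x - y)"] unfolding power2_norm_eq_inner
  by (simp add: inner_add_left inner_add_right inner_diff_left inner_diff_right inner_commute)

lemma one_add_square_mult_ge:
  fixes a b :: real
  shows "1 + (2 * a\<^sup>2 + 2 * b\<^sup>2) \<le> 2 * ((1 + a\<^sup>2) * (1 + b\<^sup>2))"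
proof -
  have "0 \<le> a\<^sup>2 * b\<^sup>2" by simp
  then show ?thesis by (simp add: algebra_simps)
qed

text \<open>Every selection of subgradients of a semiconvex function agrees almost everywhere with a Borel
  function. By rotation invariance, the Gaussian mean of the symmetric second difference with
  step \<open>t\<close> is an increment of the mean over a centred Gaussian when its scale grows
  from \<open>1\<close> to \<open>\<surd>(1 + t\<^sup>2)\<close>, hence of order
  \<open>t\<^sup>2\<close>. After division by \<open>t\<close> the means are summable along a
  geometric sequence, so for almost every base point and direction the difference quotients
  converge to the directional derivative \<open>g z \<bullet> w\<close>. The directions for
  which this derivative is measurable up to a null set form a subspace; having full measure, it
  is the whole space. This yields the measurability of the estimator although the eigenvectors
  are chosen arbitrarily and possibly in a nonmeasurable way.\<close>

lemma subgradient_AE_borel: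
  fixes \<phi> :: "'a::euclidean_space \<Rightarrow> real" and g :: "'a \<Rightarrow> 'a"
  assumes S1: "\<And>z w. \<phi> (z + w) \<ge> \<phi> z + g z \<bullet> w - C * (norm w)\<^sup>2 * (1 + (norm z)\<^sup>2)"
    and \<phi>0: "\<And>z. \<phi> z \<ge> 0" and \<phi>B: "\<And>z. \<phi> z \<le> B * (1 + (norm z)\<^sup>2)"
    and gK: "\<And>z. norm (g z) \<le> K" and C: "C \<ge> 0"
  shows "\<exists>g0\<in>borel_measurable borel. (AE z in lborel. g z = g0 z) \<and> (\<forall>z. norm (g0 z) \<le> K)"
proof -
  have [measurable]: "\<phi> \<in> borel_measurable borel"
    by (rule borel_measurable_quadratic_lower_bound[OF S1])
  have K: "K \<ge> 0" using gK[of 0] norm_ge_zero order_trans by blast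
  have B: "B \<ge> 0" using \<phi>0[of 0] \<phi>B[of 0] by simp
  define t where "t n = (1 / 2 :: real) ^ n" for n :: nat
  have t: "0 < t n" "t n \<le> 1" for n by (auto simp: t_def power_le_one)
  define D where "D n x = (\<phi> (snd x + t n *\<^sub>R fst x) + \<phi> (snd x - t n *\<^sub>R fst x) - 2 * \<phi> (snd x)) / t n
     + 2 * C * t n * ((norm (fst x))\<^sup>2 * (1 + (norm (snd x))\<^sup>2))" for n and x :: "'a \<times> 'a"
  have D0: "D n (w, z) \<ge> 0" for n w z
  proof -
    have "\<phi> (z + t n *\<^sub>R w) + \<phi> (z - t n *\<^sub>R w) - 2 * \<phi> z \<ge> - 2 * C * (t n)\<^sup>2 * ((norm w)\<^sup>2 * (1 + (norm z)\<^sup>2))"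
      using S1[of z "t n *\<^sub>R w"] S1[of z "- (t n *\<^sub>R w)"] by (simp add: power_mult_distrib algebra_simps)
    then have "(\<phi> (z + t n *\<^sub>R w) + \<phi> (z - t n *\<^sub>R w) - 2 * \<phi> z) / t n \<ge> (- 2 * C * (t n)\<^sup>2 * ((norm w)\<^sup>2 * (1 + (norm z)\<^sup>2))) / t n"
      using t(1)[of n] by (intro divide_right_mono) auto
    then show ?thesis using t(1)[of n] by (simp add: D_def power2_eq_square)
  qed
  have int\<phi>: "integrable (gauss \<Otimes>\<^sub>M gauss) (\<lambda>x. \<phi> (snd x + c *\<^sub>R fst x))" if c: "\<bar>c\<bar> \<le> 1" for c
  proof (rule integrable_gauss_pair_poly[where c = "2 * B" and k = 2 and l = 2])
    fix w z :: 'a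
    have "c\<^sup>2 \<le> 1" using c by (simp add: abs_square_le_1)
    then have "(norm (c *\<^sub>R w))\<^sup>2 \<le> (norm w)\<^sup>2" by (simp add: power_mult_distrib mult_left_le_one_le)
    then have "1 + (norm (z + c *\<^sub>R w))\<^sup>2 \<le> 1 + (2 * (norm w)\<^sup>2 + 2 * (norm z)\<^sup>2)"
      using norm_add_sq_le[of z "c *\<^sub>R w"] by linarith
    also have "\<dots> \<le> 2 * ((1 + (norm w)\<^sup>2) * (1 + (norm z)\<^sup>2))" by (rule one_add_square_mult_ge)
    finally have "B * (1 + (norm (z + c *\<^sub>R w))\<^sup>2) \<le> B * (2 * ((1 + (norm w)\<^sup>2) * (1 + (norm z)\<^sup>2)))"
      using B by (intro mult_left_mono)
    then show "\<bar>\<phi> (snd (w, z) + c *\<^sub>R fst (w, z))\<bar> \<le> 2 * B * ((1 + (norm w)\<^sup>2) * (1 + (norm z)\<^sup>2))"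
      using \<phi>B[of "z + c *\<^sub>R w"] \<phi>0[of "z + c *\<^sub>R w"] by simp
  qed simp
  have intW: "integrable (gauss \<Otimes>\<^sub>M gauss) (\<lambda>x::'a\<times>'a. (norm (fst x))\<^sup>2 * (1 + (norm (snd x))\<^sup>2))"
    by (rule integrable_gauss_pair_poly[where c = 1 and k = 2 and l = 2]) (auto simp: mult_right_mono)
  define M' where "M' = (\<integral>x. (norm (fst x))\<^sup>2 * (1 + (norm (snd x))\<^sup>2) \<partial>(gauss \<Otimes>\<^sub>M gauss :: ('a \<times> 'a) measure))"
  define P where "P v = K * norm v + C * ((norm v)\<^sup>2 * (1 + 4 * (norm v)\<^sup>2))" for v :: 'a
  have intP: "integrable gauss P"
  proof -
    have "P = (\<lambda>v. K * norm v ^ 1 + (C * norm v ^ 2 + (C * 4) * norm v ^ 4))"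
      by (auto simp: P_def fun_eq_iff algebra_simps power4_eq_xxxx power2_eq_square)
    then show ?thesis by (simp only:) (intro Bochner_Integration.integrable_add integrable_mult_right integrable_norm_power)
  qed
  define M where "M = (\<integral>v. P v \<partial>gauss)"
  have conv: "(\<integral>x. \<phi> (snd x + c *\<^sub>R fst x) \<partial>(gauss \<Otimes>\<^sub>M gauss)) \<le> (\<integral>v. \<phi> v \<partial>gauss) + c\<^sup>2 * M" if c: "\<bar>c\<bar> \<le> 1" for c
  proof -
    \<comment> \<open>The sum of a standard Gaussian and \<open>c\<close> times an independent one is \<open>\<sigma>\<close> times a standard Gaussian.\<close>
    define \<sigma> where "\<sigma> = sqrt (1 + c\<^sup>2)"
    have c2: "c\<^sup>2 \<le> 1" using c by (simp add: abs_square_le_1)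
    have \<sigma>2: "\<sigma>\<^sup>2 = 1 + c\<^sup>2" by (simp add: \<sigma>_def)
    have "1 + c\<^sup>2 \<le> (1 + c\<^sup>2)\<^sup>2" by (rule self_le_power) auto
    then have \<sigma>: "1 \<le> \<sigma>" "\<sigma> \<le> 1 + c\<^sup>2" by (auto simp: \<sigma>_def intro!: real_le_lsqrt)
    have int\<sigma>: "integrable gauss (\<lambda>v. \<phi> (\<sigma> *\<^sub>R v))"
    proof (rule integrable_gauss_poly[where k = 2 and c = "4 * B"])
      fix v :: 'a
      have "\<sigma>\<^sup>2 * (norm v)\<^sup>2 \<le> 4 * (norm v)\<^sup>2" using \<sigma>2 c2 by (intro mult_right_mono) auto
      then have "1 + (norm (\<sigma> *\<^sub>R v))\<^sup>2 \<le> 4 * (1 + (norm v)\<^sup>2)" by (simp add: power_mult_distrib)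
      then have "B * (1 + (norm (\<sigma> *\<^sub>R v))\<^sup>2) \<le> B * (4 * (1 + (norm v)\<^sup>2))" using B by (rule mult_left_mono)
      moreover have "B * (4 * (1 + (norm v)\<^sup>2)) = 4 * B * (1 + (norm v)\<^sup>2)" by simp
      ultimately show "\<bar>\<phi> (\<sigma> *\<^sub>R v)\<bar> \<le> 4 * B * (1 + (norm v)\<^sup>2)"
        using \<phi>B[of "\<sigma> *\<^sub>R v"] \<phi>0[of "\<sigma> *\<^sub>R v"] by linarith
    qed simp
    have int1: "integrable gauss \<phi>"
      by (rule integrable_gauss_poly[where k = 2 and c = B]) (use \<phi>B \<phi>0 in auto)
    have "distr (gauss \<Otimes>\<^sub>M gauss) borel (\<lambda>(y, w). (c / \<sigma>) *\<^sub>R y + (1 / \<sigma>) *\<^sub>R w) = (gauss :: 'a measure)"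
      by (rule distr_gauss_pair) (use \<sigma> \<sigma>2 in \<open>auto simp: power_divide field_simps\<close>)
    then have "(\<integral>v. \<phi> (\<sigma> *\<^sub>R v) \<partial>gauss) = (\<integral>v. \<phi> (\<sigma> *\<^sub>R v) \<partial>distr (gauss \<Otimes>\<^sub>M gauss) borel (\<lambda>(y, w). (c / \<sigma>) *\<^sub>R y + (1 / \<sigma>) *\<^sub>R w))"
      by simp
    also have "\<dots> = (\<integral>x. \<phi> (snd x + c *\<^sub>R fst x) \<partial>(gauss \<Otimes>\<^sub>M gauss))"
      using \<sigma> by (subst integral_distr) (auto simp: split_def scaleR_add_right add.commute)
    finally have eq: "(\<integral>x. \<phi> (snd x + c *\<^sub>R fst x) \<partial>(gauss \<Otimes>\<^sub>M gauss)) = (\<integral>v. \<phi> (\<sigma> *\<^sub>R v) \<partial>gauss)" ..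
    have "(\<integral>v. \<phi> (\<sigma> *\<^sub>R v) \<partial>gauss) \<le> (\<integral>v. \<phi> v + c\<^sup>2 * P v \<partial>gauss)"
    proof (intro integral_mono int\<sigma> Bochner_Integration.integrable_add int1 integrable_mult_right intP)
      fix v :: 'a
      have "\<phi> v \<ge> \<phi> (\<sigma> *\<^sub>R v) + g (\<sigma> *\<^sub>R v) \<bullet> (- (\<sigma> - 1) *\<^sub>R v) - C * (norm (- (\<sigma> - 1) *\<^sub>R v))\<^sup>2 * (1 + (norm (\<sigma> *\<^sub>R v))\<^sup>2)"
        using S1[of "\<sigma> *\<^sub>R v" "- (\<sigma> - 1) *\<^sub>R v"] by (simp add: algebra_simps)
      moreover have "g (\<sigma> *\<^sub>R v) \<bullet> (- (\<sigma> - 1) *\<^sub>R v) \<ge> - (c\<^sup>2 * (K * norm v))"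
      proof -
        have "\<bar>g (\<sigma> *\<^sub>R v) \<bullet> (- (\<sigma> - 1) *\<^sub>R v)\<bar> \<le> norm (g (\<sigma> *\<^sub>R v)) * norm (- (\<sigma> - 1) *\<^sub>R v)" by (rule Cauchy_Schwarz_ineq2)
        also have "\<dots> \<le> K * (c\<^sup>2 * norm v)"
          using \<sigma> K by (intro mult_mono gK) (auto intro!: mult_right_mono)
        finally show ?thesis by (simp add: mult_ac)
      qed
      moreover have "C * (norm (- (\<sigma> - 1) *\<^sub>R v))\<^sup>2 * (1 + (norm (\<sigma> *\<^sub>R v))\<^sup>2) \<le> c\<^sup>2 * (C * ((norm v)\<^sup>2 * (1 + 4 * (norm v)\<^sup>2)))"
      proof -
        have "(\<sigma> - 1)\<^sup>2 \<le> c\<^sup>2 * c\<^sup>2" using \<sigma> c2 by (simp add: power2_eq_square mult_mono)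
        also have "\<dots> \<le> c\<^sup>2 * 1" using c2 by (intro mult_left_mono) auto
        finally have 1: "(\<sigma> - 1)\<^sup>2 \<le> c\<^sup>2" by simp
        have "\<sigma>\<^sup>2 * (norm v)\<^sup>2 \<le> 4 * (norm v)\<^sup>2" using \<sigma>2 c2 by (intro mult_right_mono) auto
        then have 2: "1 + (norm (\<sigma> *\<^sub>R v))\<^sup>2 \<le> 1 + 4 * (norm v)\<^sup>2" by (simp add: power_mult_distrib)
        have "(norm (- (\<sigma> - 1) *\<^sub>R v))\<^sup>2 = (\<sigma> - 1)\<^sup>2 * (norm v)\<^sup>2" by (simp add: power_mult_distrib power2_commute)
        also have "\<dots> \<le> c\<^sup>2 * (norm v)\<^sup>2" using 1 by (intro mult_right_mono) auto
        finally have 3: "(norm (- (\<sigma> - 1) *\<^sub>R v))\<^sup>2 \<le> c\<^sup>2 * (norm v)\<^sup>2" .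
        have "C * ((norm (- (\<sigma> - 1) *\<^sub>R v))\<^sup>2 * (1 + (norm (\<sigma> *\<^sub>R v))\<^sup>2)) \<le> C * ((c\<^sup>2 * (norm v)\<^sup>2) * (1 + 4 * (norm v)\<^sup>2))"
          by (intro mult_left_mono mult_mono 2 3 C) auto
        then show ?thesis by (simp only: mult_ac)
      qed
      ultimately show "\<phi> (\<sigma> *\<^sub>R v) \<le> \<phi> v + c\<^sup>2 * P v" unfolding P_def distrib_left by linarith
    qed
    also have "\<dots> = (\<integral>v. \<phi> v \<partial>gauss) + c\<^sup>2 * M"
      unfolding M_def using int1 intP by simp
    finally show ?thesis using eq by simp
  qed
  have snd\<phi>: "(\<integral>x. \<phi> (snd x) \<partial>(gauss \<Otimes>\<^sub>M gauss :: ('a \<times> 'a) measure)) = (\<integral>v. \<phi> v \<partial>gauss)"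
  proof -
    have "distr (gauss \<Otimes>\<^sub>M gauss) borel (\<lambda>(y, w). 0 *\<^sub>R y + 1 *\<^sub>R w) = (gauss :: 'a measure)"
      by (rule distr_gauss_pair) auto
    then have "(\<integral>v. \<phi> v \<partial>gauss) = (\<integral>v. \<phi> v \<partial>distr (gauss \<Otimes>\<^sub>M gauss) borel (\<lambda>(y::'a, w). 0 *\<^sub>R y + 1 *\<^sub>R w))" by simp
    also have "\<dots> = (\<integral>x. \<phi> (snd x) \<partial>(gauss \<Otimes>\<^sub>M gauss :: ('a \<times> 'a) measure))"
      by (subst integral_distr) (auto simp: split_def)
    finally show ?thesis ..
  qed
  have intD: "integrable (gauss \<Otimes>\<^sub>M gauss) (D n)" for n
    unfolding D_def
    using int\<phi>[of "t n"] int\<phi>[of "- t n"] int\<phi>[of 0] intW t[of n] by simp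
  have ID: "(\<integral>x. D n x \<partial>(gauss \<Otimes>\<^sub>M gauss)) \<le> t n * (2 * M + 2 * C * M')" for n
  proof -
    have "(\<integral>x. D n x \<partial>(gauss \<Otimes>\<^sub>M gauss)) = ((\<integral>x. \<phi> (snd x + t n *\<^sub>R fst x) \<partial>(gauss \<Otimes>\<^sub>M gauss)) + (\<integral>x. \<phi> (snd x + (- t n) *\<^sub>R fst x) \<partial>(gauss \<Otimes>\<^sub>M gauss))
      - 2 * (\<integral>x. \<phi> (snd x) \<partial>(gauss \<Otimes>\<^sub>M gauss :: ('a \<times> 'a) measure))) / t n + 2 * C * t n * M'"
      unfolding D_def M'_def
      using int\<phi>[of "t n"] int\<phi>[of "- t n"] int\<phi>[of 0] intW t[of n] by simp
    also have "\<dots> \<le> (2 * ((t n)\<^sup>2 * M)) / t n + 2 * C * t n * M'"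
      using conv[of "t n"] conv[of "- t n"] t[of n] unfolding snd\<phi>
      by (intro add_right_mono divide_right_mono) auto
    also have "\<dots> = t n * (2 * M + 2 * C * M')" using t(1)[of n] by (simp add: power2_eq_square field_simps)
    finally show ?thesis .
  qed
  have meas[measurable]: "D n \<in> borel_measurable (borel \<Otimes>\<^sub>M borel)" for n unfolding D_def by simp
  have D0': "D n x \<ge> 0" for n x using D0[of n "fst x" "snd x"] by simp
  have "(\<integral>\<^sup>+x. (\<Sum>n. ennreal (D n x)) \<partial>(gauss \<Otimes>\<^sub>M gauss)) = (\<Sum>n. \<integral>\<^sup>+x. ennreal (D n x) \<partial>(gauss \<Otimes>\<^sub>M gauss))"
    by (rule nn_integral_suminf) simp
  also have "\<dots> = (\<Sum>n. ennreal (\<integral>x. D n x \<partial>(gauss \<Otimes>\<^sub>M gauss)))"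
    by (intro suminf_cong nn_integral_eq_integral intD) (simp add: D0')
  also have "\<dots> \<le> (\<Sum>n. ennreal (t n * (2 * M + 2 * C * M')))"
    by (intro suminf_le ennreal_leI ID) auto
  also have "\<dots> < top"
  proof -
    have "0 \<le> (\<integral>x. D 0 x \<partial>(gauss \<Otimes>\<^sub>M gauss))" by (intro Bochner_Integration.integral_nonneg) (simp add: D0')
    with ID[of 0] have "2 * M + 2 * C * M' \<ge> 0" by (simp add: t_def)
    moreover have "summable (\<lambda>n. t n * (2 * M + 2 * C * M'))"
      unfolding t_def by (intro summable_mult2 summable_geometric) simp
    ultimately show ?thesis using t by (subst suminf_ennreal2) (auto simp: less_imp_le)
  qed
  finally have fin: "(\<integral>\<^sup>+x. (\<Sum>n. ennreal (D n x)) \<partial>(gauss \<Otimes>\<^sub>M gauss)) \<noteq> \<infinity>" by simp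
  have "AE x in gauss \<Otimes>\<^sub>M gauss. (\<Sum>n. ennreal (D n x)) \<noteq> \<infinity>"
    by (rule nn_integral_PInf_AE[OF _ fin]) simp
  then have "AE x in gauss \<Otimes>\<^sub>M gauss. (\<lambda>n. D n x) \<longlonglongrightarrow> 0"
  proof eventually_elim
    case (elim x)
    then have "summable (\<lambda>n. D n x)" by (intro summable_suminf_not_top) (auto simp: D0')
    then show ?case by (rule summable_LIMSEQ_zero)
  qed
  from gauss_pair.AE_pair[OF this]
  have AEw: "AE w in gauss. AE z in gauss. (\<lambda>n. D n (w, z)) \<longlonglongrightarrow> 0" .
  define W where "W = {w. \<exists>f\<in>borel_measurable borel. AE z in lborel. g z \<bullet> w = f z}"
  have inW: "w \<in> W" if w: "AE z in gauss. (\<lambda>n. D n (w, z)) \<longlonglongrightarrow> 0" for w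
  proof -
    define p where "p n z = (\<phi> (z + t n *\<^sub>R w) - \<phi> z) / t n" for n z
    have [measurable]: "p n \<in> borel_measurable borel" for n unfolding p_def by simp
    have "AE z in lborel. g z \<bullet> w = lim (\<lambda>n. p n z)"
      using w unfolding AE_gauss_iff
    proof eventually_elim
      case (elim z)
      define \<kappa> where "\<kappa> = C * ((norm w)\<^sup>2 * (1 + (norm z)\<^sup>2))"
      have lo: "g z \<bullet> w - t n * \<kappa> \<le> p n z" for n
      proof -
        have "t n * (g z \<bullet> w - t n * \<kappa>) \<le> \<phi> (z + t n *\<^sub>R w) - \<phi> z"
          using S1[of z "t n *\<^sub>R w"] by (simp add: \<kappa>_def power_mult_distrib power2_eq_square algebra_simps)
        then show ?thesis using t(1)[of n] by (simp add: p_def pos_le_divide_eq mult.commute)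
      qed
      have up: "p n z \<le> g z \<bullet> w + D n (w, z)" for n
      proof -
        have "t n * (- (g z \<bullet> w) - t n * \<kappa>) \<le> \<phi> (z - t n *\<^sub>R w) - \<phi> z"
          using S1[of z "- (t n *\<^sub>R w)"] by (simp add: \<kappa>_def power_mult_distrib power2_eq_square algebra_simps)
        then have "- (g z \<bullet> w) - t n * \<kappa> \<le> (\<phi> (z - t n *\<^sub>R w) - \<phi> z) / t n"
          using t(1)[of n] by (simp add: pos_le_divide_eq mult.commute)
        moreover have "D n (w, z) = p n z + (\<phi> (z - t n *\<^sub>R w) - \<phi> z) / t n + 2 * (t n * \<kappa>)"
          by (simp add: D_def p_def \<kappa>_def diff_divide_distrib add_divide_distrib)
        moreover have "t n * \<kappa> \<ge> 0" using t(1)[of n] C by (simp add: \<kappa>_def)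
        ultimately show ?thesis by linarith
      qed
      have t0: "t \<longlonglongrightarrow> 0" unfolding t_def by (rule LIMSEQ_realpow_zero) auto
      have "(\<lambda>n. g z \<bullet> w - t n * \<kappa>) \<longlonglongrightarrow> g z \<bullet> w - 0 * \<kappa>"
        by (intro tendsto_intros t0)
      moreover have "(\<lambda>n. g z \<bullet> w + D n (w, z)) \<longlonglongrightarrow> g z \<bullet> w + 0"
        by (intro tendsto_intros elim)
      ultimately have "(\<lambda>n. p n z) \<longlonglongrightarrow> g z \<bullet> w"
        using lo up by (intro tendsto_sandwich[of "\<lambda>n. g z \<bullet> w - t n * \<kappa>" "\<lambda>n. p n z" _ "\<lambda>n. g z \<bullet> w + D n (w, z)"]) auto
      then show ?case by (simp add: limI)
    qed
    moreover have "(\<lambda>z. lim (\<lambda>n. p n z)) \<in> borel_measurable borel" by simp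
    ultimately show ?thesis unfolding W_def by (intro CollectI bexI[of _ "\<lambda>z. lim (\<lambda>n. p n z)"])
  qed
  have sub: "subspace W"
  proof (rule subspaceI)
    show "0 \<in> W" unfolding W_def by (auto intro!: bexI[of _ "\<lambda>_. 0"])
    fix x y assume "x \<in> W" "y \<in> W"
    then obtain f h where f: "f \<in> borel_measurable borel" "AE z in lborel. g z \<bullet> x = f z"
      and h: "h \<in> borel_measurable borel" "AE z in lborel. g z \<bullet> y = h z" unfolding W_def by blast
    from f(2) h(2) have "AE z in lborel. g z \<bullet> (x + y) = f z + h z" by eventually_elim (simp add: inner_add_right)
    moreover have "(\<lambda>z. f z + h z) \<in> borel_measurable borel" using f h by simp
    ultimately show "x + y \<in> W" unfolding W_def by (intro CollectI bexI[of _ "\<lambda>z. f z + h z"])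
  next
    fix c x assume "x \<in> W"
    then obtain f where f: "f \<in> borel_measurable borel" "AE z in lborel. g z \<bullet> x = f z" unfolding W_def by blast
    from f(2) have "AE z in lborel. g z \<bullet> (c *\<^sub>R x) = c * f z" by eventually_elim simp
    moreover have "(\<lambda>z. c * f z) \<in> borel_measurable borel" using f by simp
    ultimately show "c *\<^sub>R x \<in> W" unfolding W_def by (intro CollectI bexI[of _ "\<lambda>z. c * f z"])
  qed
  have "W = UNIV"
  proof (rule ccontr)
    assume W: "W \<noteq> UNIV"
    have "dim W < DIM('a)"
    proof (rule ccontr)
      assume "\<not> dim W < DIM('a)"
      then have "dim W = DIM('a)" using dim_subset_UNIV[of W] by linarith
      then have "span W = UNIV" using dim_eq_full[of W] by simp
      then show False using W span_eq_iff[of W] sub by auto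
    qed
    then have "negligible W" by (rule negligible_lowdim)
    then have "W \<in> null_sets lebesgue" by (simp add: negligible_iff_null_sets)
    then have "AE w in lebesgue. w \<notin> W" by (rule AE_not_in)
    then have "AE w in gauss. w \<notin> W" by (simp add: AE_completion_iff AE_gauss_iff)
    moreover have "AE w in gauss. w \<in> W" using AEw by eventually_elim (rule inW)
    ultimately have "AE w in (gauss :: 'a measure). False" by eventually_elim auto
    then show False by simp
  qed
  then have "\<forall>b. \<exists>f\<in>borel_measurable borel. AE z in lborel. g z \<bullet> b = f z" unfolding W_def by blast
  then obtain f where f: "\<And>b. f b \<in> borel_measurable borel" "\<And>b. AE z in lborel. g z \<bullet> b = f b z" by metis
  define g1 where "g1 z = (\<Sum>b\<in>Basis. f b z *\<^sub>R b)" for z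
  \<comment> \<open>The truncation only changes a null set and makes the bound on the norm hold everywhere.\<close>
  define g0 where "g0 z = (if norm (g1 z) \<le> K then g1 z else 0)" for z
  have [measurable]: "g1 \<in> borel_measurable borel"
    unfolding g1_def using f(1) by (intro borel_measurable_sum borel_measurable_scaleR) auto
  have "AE z in lborel. \<forall>b\<in>Basis. g z \<bullet> b = f b z" by (intro AE_finite_allI f(2)) simp
  then have "AE z in lborel. g z = g0 z"
  proof eventually_elim
    case (elim z)
    then have "g1 z = (\<Sum>b\<in>Basis. (g z \<bullet> b) *\<^sub>R b)" unfolding g1_def by (intro sum.cong) auto
    then have "g1 z = g z" by (simp add: euclidean_representation)
    then show ?case using gK[of z] by (simp add: g0_def)
  qed
  moreover have "g0 \<in> borel_measurable borel" unfolding g0_def by simp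
  moreover have "norm (g0 z) \<le> K" for z using K by (simp add: g0_def)
  ultimately show ?thesis by blast
qed

section \<open>A one-sided Stein identity\<close>

text \<open>Let \<open>a(s)\<close> be the mean of \<open>\<phi>\<close> under a Gaussian centred at
  \<open>\<Xi>\<close> with scale \<open>s < 1\<close>, and let \<open>s\<^sup>2 +
  \<epsilon>\<^sup>2 = 1\<close>. Shrinking the Gaussian variable and using the subgradient
  bounds \<open>a(1) - a(s)\<close> from above by \<open>(1 - s)\<close> times the mean of
  \<open>g \<bullet> y\<close>, up to a quadratic error. On the other hand the scale
  \<open>1\<close> arises from the scale \<open>s\<close> by adding an independent Gaussian of
  scale \<open>\<epsilon>\<close>, so the second-order lower bound gives at least
  \<open>\<epsilon>\<^sup>2\<close> times the mean of \<open>low\<close>, by Fatou's lemma. As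
  \<open>\<epsilon>\<^sup>2 = (1 - s)(1 + s)\<close>, comparing both as \<open>s\<close> tends
  to \<open>1\<close> gives the claim.\<close>

lemma stein_lower_bound:
  fixes \<phi> :: "'a::euclidean_space \<Rightarrow> real" and g :: "'a \<Rightarrow> 'a" and R :: "nat \<Rightarrow> 'a \<Rightarrow> 'a"
    and q :: "'a \<Rightarrow> 'a \<Rightarrow> real" and low :: "'a \<Rightarrow> real" and \<Xi> :: 'a
  assumes \<phi>[measurable]: "\<phi> \<in> borel_measurable borel" and g[measurable]: "g \<in> borel_measurable borel"
    and \<phi>0: "\<And>z. \<phi> z \<ge> 0" and \<phi>B: "\<And>z. \<phi> z \<le> B * (1 + (norm z)\<^sup>2)"
    and gK: "\<And>z. norm (g z) \<le> K"
    and S1: "AE z in lborel. \<forall>w. \<phi> (z + w) \<ge> \<phi> z + g z \<bullet> w - C * (norm w)\<^sup>2 * (1 + (norm z)\<^sup>2)"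
    and C: "C \<ge> 0"
    and R[measurable]: "\<And>j. R j \<in> borel_measurable borel" and Rd: "\<And>j. distr gauss borel (R j) = gauss"
    and Rn: "\<And>j w. norm (R j w) = norm w" and Rs: "\<And>j c w. R j (c *\<^sub>R w) = c *\<^sub>R R j w"
    and S2: "\<And>z w. (\<Sum>j<(4::nat). \<phi> (z + R j w)) / 4 \<ge> \<phi> z - C2 * norm w ^ 4 * (1 + (norm z)\<^sup>2)"
    and C2: "C2 \<ge> 0"
    and S3: "\<And>z w. \<exists>f. (f \<longlongrightarrow> q z w) (at_right 0)
        \<and> (\<forall>\<^sub>F \<epsilon> in at_right 0. \<epsilon>\<^sup>2 * f \<epsilon> \<le> (\<Sum>j<(4::nat). \<phi> (z + R j (\<epsilon> *\<^sub>R w))) / 4 - \<phi> z)"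
    and low: "\<And>z. ennreal (low z) \<le> (\<integral>\<^sup>+w. ennreal (q z w) \<partial>gauss)"
  shows "(\<integral>\<^sup>+u. ennreal (low (\<Xi> + u)) \<partial>gauss) \<le> ennreal ((\<integral>y. g (\<Xi> + y) \<bullet> y \<partial>gauss) / 2)"
proof -
  define N where "N = DIM('a)"
  define X where "X = 5 + 2 * (norm \<Xi>)\<^sup>2"
  have X: "X \<ge> 1" by (simp add: X_def)
  have B: "B \<ge> 0" using \<phi>0[of 0] \<phi>B[of 0] by simp
  define \<epsilon> where "\<epsilon> n = 1 / (real n + 2)" for n
  define s where "s n = sqrt (1 - (\<epsilon> n)\<^sup>2)" for n
  have \<epsilon>: "\<epsilon> n > 0" "\<epsilon> n \<le> 1 / 2" for n by (auto simp: \<epsilon>_def field_simps)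
  have \<epsilon>2: "(\<epsilon> n)\<^sup>2 \<le> 1 / 4" "(\<epsilon> n)\<^sup>2 > 0" for n
    using power_mono[OF \<epsilon>(2)[of n], of 2] \<epsilon>(1)[of n] by (auto simp: power_divide)
  have s2: "(s n)\<^sup>2 = 1 - (\<epsilon> n)\<^sup>2" for n using \<epsilon>2(1)[of n] by (simp add: s_def)
  have s: "s n > 0" "s n \<le> 1" for n using \<epsilon>2[of n] by (auto simp: s_def)
  have s_ge: "1 - s n \<le> (\<epsilon> n)\<^sup>2" for n
  proof -
    have "(s n)\<^sup>2 \<le> s n" using s[of n] by (simp add: power2_eq_square mult_left_le)
    then show ?thesis using s2[of n] by simp
  qed
  have \<epsilon>_eq: "(\<epsilon> n)\<^sup>2 = (1 - s n) * (1 + s n)" for n using s2[of n] by (simp add: algebra_simps power2_eq_square)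
  have \<epsilon>_lim: "\<epsilon> \<longlonglongrightarrow> 0" 
    using LIMSEQ_ignore_initial_segment[OF lim_1_over_n, of 2] by (simp add: \<epsilon>_def[abs_def] add.commute)
  have \<epsilon>_right: "filterlim \<epsilon> (at_right 0) sequentially"
  proof -
    have "\<epsilon> n \<in> {0<..} \<and> \<epsilon> n \<noteq> 0" for n using \<epsilon>(1)[of n] by simp
    then have "\<forall>\<^sub>F n in sequentially. \<epsilon> n \<in> {0<..} \<and> \<epsilon> n \<noteq> 0" by (intro always_eventually allI)
    then show ?thesis unfolding filterlim_at using \<epsilon>_lim by blast
  qed
  have s_lim: "s \<longlonglongrightarrow> 1"
  proof -
    have "s \<longlonglongrightarrow> sqrt (1 - 0\<^sup>2)" unfolding s_def by (intro tendsto_intros \<epsilon>_lim)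
    then show ?thesis by simp
  qed
  have nb: "1 + (norm (\<Xi> + c *\<^sub>R y + w))\<^sup>2 \<le> X * ((1 + (norm y)\<^sup>2) * (1 + (norm w)\<^sup>2))" if c: "\<bar>c\<bar> \<le> 1" for c and y w :: 'a
  proof -
    have "c\<^sup>2 \<le> 1" using c by (simp add: abs_square_le_1)
    then have "(norm (c *\<^sub>R y))\<^sup>2 \<le> (norm y)\<^sup>2" by (simp add: power_mult_distrib mult_left_le_one_le)
    then have "1 + (norm (\<Xi> + c *\<^sub>R y + w))\<^sup>2 \<le> 1 + 2 * (norm \<Xi>)\<^sup>2 + 4 * (norm y)\<^sup>2 + 4 * (norm w)\<^sup>2"
      using norm_add_sq_le[of \<Xi> "c *\<^sub>R y + w"] norm_add_sq_le[of "c *\<^sub>R y" w]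
      unfolding add.assoc[of \<Xi>] by linarith
    also have "\<dots> \<le> X * (1 + (norm y)\<^sup>2 + (norm w)\<^sup>2)"
    proof -
      have "0 \<le> (norm \<Xi>)\<^sup>2 * (norm y)\<^sup>2" "0 \<le> (norm \<Xi>)\<^sup>2 * (norm w)\<^sup>2" by auto
      moreover have "0 \<le> (norm y)\<^sup>2" "0 \<le> (norm w)\<^sup>2" by auto
      ultimately show ?thesis unfolding X_def by (simp add: algebra_simps)
    qed
    also have "\<dots> \<le> X * ((1 + (norm y)\<^sup>2) * (1 + (norm w)\<^sup>2))"
      using X by (intro mult_left_mono) (auto simp: algebra_simps)
    finally show ?thesis .
  qed
  have nb0: "1 + (norm (\<Xi> + c *\<^sub>R y))\<^sup>2 \<le> X * (1 + (norm y)\<^sup>2)" if "\<bar>c\<bar> \<le> 1" for c and y :: 'a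
    using nb[OF that, of y 0] by simp
  have int1: "integrable gauss (\<lambda>v. \<phi> (\<Xi> + c *\<^sub>R v))" if "\<bar>c\<bar> \<le> 1" for c
  proof (rule integrable_gauss_poly[where c = "B * X" and k = 2])
    fix v :: 'a
    have "B * (1 + (norm (\<Xi> + c *\<^sub>R v))\<^sup>2) \<le> B * (X * (1 + (norm v)\<^sup>2))"
      by (intro mult_left_mono nb0 that B)
    then show "\<bar>\<phi> (\<Xi> + c *\<^sub>R v)\<bar> \<le> B * X * (1 + (norm v)\<^sup>2)"
      using \<phi>B[of "\<Xi> + c *\<^sub>R v"] \<phi>0[of "\<Xi> + c *\<^sub>R v"] by (simp add: mult.assoc)
  qed simp
  have int2: "integrable (gauss \<Otimes>\<^sub>M gauss) (\<lambda>x. \<phi> (\<Xi> + c *\<^sub>R fst x + d *\<^sub>R h (snd x)))"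
    if "\<bar>c\<bar> \<le> 1" "\<bar>d\<bar> \<le> 1" and [measurable]: "h \<in> borel_measurable borel" and h: "\<And>w. norm (h w) = norm w"
    for c d and h :: "'a \<Rightarrow> 'a"
  proof (rule integrable_gauss_pair_poly[where c = "B * X" and k = 2 and l = 2])
    fix y w :: 'a
    have "d\<^sup>2 \<le> 1" using that by (simp add: abs_square_le_1)
    then have "(norm (d *\<^sub>R h w))\<^sup>2 \<le> (norm w)\<^sup>2" by (simp add: power_mult_distrib mult_left_le_one_le h)
    then have "X * ((1 + (norm y)\<^sup>2) * (1 + (norm (d *\<^sub>R h w))\<^sup>2)) \<le> X * ((1 + (norm y)\<^sup>2) * (1 + (norm w)\<^sup>2))"
      using X by (intro mult_left_mono) auto
    then have "B * (1 + (norm (\<Xi> + c *\<^sub>R y + d *\<^sub>R h w))\<^sup>2) \<le> B * (X * ((1 + (norm y)\<^sup>2) * (1 + (norm w)\<^sup>2)))"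
      using nb[of c y "d *\<^sub>R h w"] that B by (intro mult_left_mono) auto
    then show "\<bar>\<phi> (\<Xi> + c *\<^sub>R fst (y, w) + d *\<^sub>R h (snd (y, w)))\<bar> \<le> B * X * ((1 + (norm y)\<^sup>2) * (1 + (norm w)\<^sup>2))"
      using \<phi>B[of "\<Xi> + c *\<^sub>R y + d *\<^sub>R h w"] \<phi>0[of "\<Xi> + c *\<^sub>R y + d *\<^sub>R h w"] by (simp add: mult.assoc)
  qed simp
  define a1 where "a1 = (\<integral>v. \<phi> (\<Xi> + v) \<partial>gauss)"
  define as where "as n = (\<integral>v. \<phi> (\<Xi> + s n *\<^sub>R v) \<partial>gauss)" for n
  define T where "T = (\<integral>y. g (\<Xi> + y) \<bullet> y \<partial>gauss)"
  define M1 where "M1 = (\<integral>y. (norm y)\<^sup>2 * (1 + (norm (\<Xi> + y))\<^sup>2) \<partial>gauss)"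
  define M2 where "M2 = (\<integral>x. norm (snd x) ^ 4 * (X * (1 + (norm (fst x))\<^sup>2)) \<partial>(gauss \<Otimes>\<^sub>M gauss :: ('a \<times> 'a) measure))"
  have intT: "integrable gauss (\<lambda>y. g (\<Xi> + y) \<bullet> y)"
  proof (rule integrable_gauss_poly[where c = K and k = 1])
    fix z
    have "\<bar>g (\<Xi> + z) \<bullet> z\<bar> \<le> norm (g (\<Xi> + z)) * norm z" by (rule Cauchy_Schwarz_ineq2)
    also have "\<dots> \<le> K * norm z" by (intro mult_right_mono gK) auto
    also have "\<dots> \<le> K * (1 + norm z ^ 1)" using order_trans[OF norm_ge_zero gK[of 0]] by (intro mult_left_mono) simp_all
    finally show "\<bar>g (\<Xi> + z) \<bullet> z\<bar> \<le> K * (1 + norm z ^ 1)" .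
  qed simp
  have intM1: "integrable gauss (\<lambda>y. (norm y)\<^sup>2 * (1 + (norm (\<Xi> + y))\<^sup>2))"
  proof (rule integrable_gauss_poly[where c = "2 * X" and k = 4])
    fix y :: 'a
    have "(norm y)\<^sup>2 * (1 + (norm (\<Xi> + y))\<^sup>2) \<le> (norm y)\<^sup>2 * (X * (1 + (norm y)\<^sup>2))"
      using nb0[of 1 y] by (intro mult_left_mono) auto
    also have "\<dots> = X * ((norm y)\<^sup>2 + norm y ^ 4)" by (simp add: algebra_simps power4_eq_xxxx power2_eq_square)
    also have "\<dots> \<le> X * (2 * (1 + norm y ^ 4))"
    proof (intro mult_left_mono)
      have "0 \<le> ((norm y)\<^sup>2 - 1)\<^sup>2" by simp
      then have 1: "2 * (norm y)\<^sup>2 \<le> 1 + norm y ^ 4" by (simp add: power2_diff flip: power_mult)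
      have aux: "a + b \<le> 2 * (1 + b)" if "2 * a \<le> 1 + b" "0 \<le> b" for a b :: real
        using that by simp
      show "(norm y)\<^sup>2 + norm y ^ 4 \<le> 2 * (1 + norm y ^ 4)" by (rule aux[OF 1]) simp
    qed (use X in simp)
    finally show "\<bar>(norm y)\<^sup>2 * (1 + (norm (\<Xi> + y))\<^sup>2)\<bar> \<le> 2 * X * (1 + norm y ^ 4)" by (simp add: algebra_simps)
  qed simp
  have M1: "M1 \<ge> 0" unfolding M1_def by (intro Bochner_Integration.integral_nonneg) simp
  have intM2: "integrable (gauss \<Otimes>\<^sub>M gauss) (\<lambda>x::'a \<times> 'a. norm (snd x) ^ 4 * (X * (1 + (norm (fst x))\<^sup>2)))"
  proof (rule integrable_gauss_pair_poly[where c = X and k = 2 and l = 4])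
    fix y w :: 'a
    have "norm w ^ 4 * (X * (1 + (norm y)\<^sup>2)) \<le> (1 + norm w ^ 4) * (X * (1 + (norm y)\<^sup>2))"
      using X by (intro mult_right_mono) auto
    then show "\<bar>norm (snd (y, w)) ^ 4 * (X * (1 + (norm (fst (y, w)))\<^sup>2))\<bar> \<le> X * ((1 + (norm y)\<^sup>2) * (1 + norm w ^ 4))"
      using X by (simp add: mult_ac)
  qed simp
  have step1: "a1 - as n \<le> (1 - s n) * T + C * (1 - s n)\<^sup>2 * M1" for n
  proof -
    have "AE y in gauss. \<forall>w. \<phi> (\<Xi> + y + w) \<ge> \<phi> (\<Xi> + y) + g (\<Xi> + y) \<bullet> w - C * (norm w)\<^sup>2 * (1 + (norm (\<Xi> + y))\<^sup>2)"
      unfolding AE_gauss_iff by (rule AE_lborel_translate[OF S1])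
    then have "AE y in gauss. \<phi> (\<Xi> + y) - (1 - s n) * (g (\<Xi> + y) \<bullet> y) - C * (1 - s n)\<^sup>2 * ((norm y)\<^sup>2 * (1 + (norm (\<Xi> + y))\<^sup>2))
      \<le> \<phi> (\<Xi> + s n *\<^sub>R y)"
    proof eventually_elim
      case (elim y)
      have "\<Xi> + y + (- (1 - s n)) *\<^sub>R y = \<Xi> + s n *\<^sub>R y" by (simp add: algebra_simps)
      moreover have "(norm ((- (1 - s n)) *\<^sub>R y))\<^sup>2 = (1 - s n)\<^sup>2 * (norm y)\<^sup>2"
        by (simp add: power_mult_distrib power2_commute)
      moreover have "g (\<Xi> + y) \<bullet> ((- (1 - s n)) *\<^sub>R y) = - ((1 - s n) * (g (\<Xi> + y) \<bullet> y))" by (simp add: algebra_simps)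
      ultimately show ?case using elim[rule_format, of "(- (1 - s n)) *\<^sub>R y"] by (simp only: mult.assoc)
    qed
    then have "(\<integral>y. \<phi> (\<Xi> + y) - (1 - s n) * (g (\<Xi> + y) \<bullet> y) - C * (1 - s n)\<^sup>2 * ((norm y)\<^sup>2 * (1 + (norm (\<Xi> + y))\<^sup>2)) \<partial>gauss) \<le> as n"
      unfolding as_def
      by (intro integral_mono_AE int1 Bochner_Integration.integrable_diff integrable_mult_right intT intM1 int1[of 1, simplified]) (use s[of n] in auto)
    then show ?thesis
      using int1[of 1] intT intM1 by (simp add: a1_def T_def M1_def)
  qed
  define Db where "Db n z w = ((\<Sum>j<4. \<phi> (z + R j (\<epsilon> n *\<^sub>R w))) / 4 - \<phi> z) / (\<epsilon> n)\<^sup>2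
      + C2 * (\<epsilon> n)\<^sup>2 * (norm w ^ 4 * (1 + (norm z)\<^sup>2))" for n z w
  have [measurable]: "case_prod (Db n) \<in> borel_measurable (borel \<Otimes>\<^sub>M borel)" for n
    unfolding Db_def split_def by measurable
  have [measurable]: "(\<lambda>x. Db n (f x) (h x)) \<in> borel_measurable M"
    if [measurable]: "f \<in> borel_measurable M" "h \<in> borel_measurable M" for n f h and M :: "'a measure"
    unfolding Db_def by measurable
  have [measurable]: "(\<lambda>x. Db n (f x) (h x)) \<in> borel_measurable M"
    if [measurable]: "f \<in> borel_measurable M" "h \<in> borel_measurable M" for n f h and M :: "('a \<times> 'a) measure"
    unfolding Db_def by measurable
  have Db0: "Db n z w \<ge> 0" for n z w
  proof -
    have "(\<Sum>j<4. \<phi> (z + R j (\<epsilon> n *\<^sub>R w))) / 4 - \<phi> z \<ge> - (C2 * (\<epsilon> n) ^ 4 * (norm w ^ 4 * (1 + (norm z)\<^sup>2)))"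
      using S2[of z "\<epsilon> n *\<^sub>R w"] \<epsilon>(1)[of n] by (simp add: power_mult_distrib mult_ac)
    then have "((\<Sum>j<4. \<phi> (z + R j (\<epsilon> n *\<^sub>R w))) / 4 - \<phi> z) / (\<epsilon> n)\<^sup>2 \<ge> - (C2 * (\<epsilon> n) ^ 4 * (norm w ^ 4 * (1 + (norm z)\<^sup>2))) / (\<epsilon> n)\<^sup>2"
      by (intro divide_right_mono) auto
    also have "- (C2 * (\<epsilon> n) ^ 4 * (norm w ^ 4 * (1 + (norm z)\<^sup>2))) / (\<epsilon> n)\<^sup>2 = - (C2 * (\<epsilon> n)\<^sup>2 * (norm w ^ 4 * (1 + (norm z)\<^sup>2)))"
      using \<epsilon>(1)[of n] by (simp add: power4_eq_xxxx power2_eq_square)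
    finally show ?thesis unfolding Db_def by linarith
  qed
  have pair_a1: "(\<integral>x. \<phi> (\<Xi> + s n *\<^sub>R fst x + \<epsilon> n *\<^sub>R R j (snd x)) \<partial>(gauss \<Otimes>\<^sub>M gauss)) = a1" for n j
  proof -
    have b: "\<bar>s n\<bar> \<le> 1" "\<bar>\<epsilon> n\<bar> \<le> 1" using s[of n] \<epsilon>[of n] by auto
    have "(\<integral>x. \<phi> (\<Xi> + s n *\<^sub>R fst x + \<epsilon> n *\<^sub>R R j (snd x)) \<partial>(gauss \<Otimes>\<^sub>M gauss))
      = (\<integral>y. \<integral>w. \<phi> (\<Xi> + s n *\<^sub>R y + \<epsilon> n *\<^sub>R R j w) \<partial>gauss \<partial>gauss)"
      using gauss_pair.integral_fst'[OF int2[OF b R Rn]] by simp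
    also have "\<dots> = (\<integral>y. \<integral>w. \<phi> (\<Xi> + s n *\<^sub>R y + \<epsilon> n *\<^sub>R w) \<partial>gauss \<partial>gauss)"
    proof (rule Bochner_Integration.integral_cong[OF refl])
      fix y :: 'a
      have "(\<integral>w. \<phi> (\<Xi> + s n *\<^sub>R y + \<epsilon> n *\<^sub>R w) \<partial>gauss) = (\<integral>w. \<phi> (\<Xi> + s n *\<^sub>R y + \<epsilon> n *\<^sub>R w) \<partial>distr gauss borel (R j))"
        by (simp add: Rd)
      also have "\<dots> = (\<integral>w. \<phi> (\<Xi> + s n *\<^sub>R y + \<epsilon> n *\<^sub>R R j w) \<partial>gauss)"
        by (rule integral_distr) auto
      finally show "(\<integral>w. \<phi> (\<Xi> + s n *\<^sub>R y + \<epsilon> n *\<^sub>R R j w) \<partial>gauss) = (\<integral>w. \<phi> (\<Xi> + s n *\<^sub>R y + \<epsilon> n *\<^sub>R w) \<partial>gauss)" ..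
    qed
    also have "\<dots> = (\<integral>x. \<phi> (\<Xi> + s n *\<^sub>R fst x + \<epsilon> n *\<^sub>R snd x) \<partial>(gauss \<Otimes>\<^sub>M gauss))"
      using gauss_pair.integral_fst'[OF int2[OF b, of "\<lambda>w. w"]] by simp
    also have "\<dots> = (\<integral>v. \<phi> (\<Xi> + v) \<partial>distr (gauss \<Otimes>\<^sub>M gauss) borel (\<lambda>(y, w). s n *\<^sub>R y + \<epsilon> n *\<^sub>R w))"
      by (subst integral_distr) (auto simp: split_def add.assoc)
    also have "\<dots> = a1"
      using \<epsilon>(1)[of n] s2[of n] by (subst distr_gauss_pair) (auto simp: a1_def)
    finally show ?thesis .
  qed
  have pair_as: "(\<integral>x. \<phi> (\<Xi> + s n *\<^sub>R fst x) \<partial>(gauss \<Otimes>\<^sub>M gauss :: ('a \<times> 'a) measure)) = as n"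
    and int_as: "integrable (gauss \<Otimes>\<^sub>M gauss) (\<lambda>x::'a \<times> 'a. \<phi> (\<Xi> + s n *\<^sub>R fst x))" for n
  proof -
    have b: "\<bar>s n\<bar> \<le> 1" using s[of n] by auto
    from int2[OF b, of 0 "\<lambda>w. w"] show I: "integrable (gauss \<Otimes>\<^sub>M gauss) (\<lambda>x::'a \<times> 'a. \<phi> (\<Xi> + s n *\<^sub>R fst x))" by simp
    show "(\<integral>x. \<phi> (\<Xi> + s n *\<^sub>R fst x) \<partial>(gauss \<Otimes>\<^sub>M gauss :: ('a \<times> 'a) measure)) = as n"
      using gauss_pair.integral_fst'[OF I] by (simp add: as_def gauss.prob_space[simplified])
  qed
  have intW: "integrable (gauss \<Otimes>\<^sub>M gauss) (\<lambda>x::'a\<times>'a. norm (snd x) ^ 4 * (1 + (norm (\<Xi> + s n *\<^sub>R fst x))\<^sup>2))" for n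
  proof (rule Bochner_Integration.integrable_bound[OF intM2], simp, intro AE_I2)
    fix x :: "'a \<times> 'a"
    have "norm (snd x) ^ 4 * (1 + (norm (\<Xi> + s n *\<^sub>R fst x))\<^sup>2) \<le> norm (snd x) ^ 4 * (X * (1 + (norm (fst x))\<^sup>2))"
      using s[of n] by (intro mult_left_mono nb0) auto
    then show "norm (norm (snd x) ^ 4 * (1 + (norm (\<Xi> + s n *\<^sub>R fst x))\<^sup>2)) \<le> norm (norm (snd x) ^ 4 * (X * (1 + (norm (fst x))\<^sup>2)))"
      using X by simp
  qed
  have b: "\<bar>s n\<bar> \<le> 1" "\<bar>\<epsilon> n\<bar> \<le> 1" for n using s[of n] \<epsilon>[of n] by auto
  have intE: "integrable (gauss \<Otimes>\<^sub>M gauss) (\<lambda>x. Db n (\<Xi> + s n *\<^sub>R fst x) (snd x))" for n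
    unfolding Db_def Rs
    by (intro Bochner_Integration.integrable_add integrable_divide Bochner_Integration.integrable_diff
        Bochner_Integration.integrable_sum int2 int_as integrable_mult_right intW b R Rn)
  define U where "U n = T / (1 + s n) + C * (\<epsilon> n)\<^sup>2 * M1 + C2 * (\<epsilon> n)\<^sup>2 * M2" for n
  have EU: "(\<integral>x. Db n (\<Xi> + s n *\<^sub>R fst x) (snd x) \<partial>(gauss \<Otimes>\<^sub>M gauss)) \<le> U n" for n
  proof -
    have "(\<integral>x. Db n (\<Xi> + s n *\<^sub>R fst x) (snd x) \<partial>(gauss \<Otimes>\<^sub>M gauss)) = (a1 - as n) / (\<epsilon> n)\<^sup>2
      + C2 * (\<epsilon> n)\<^sup>2 * (\<integral>x. norm (snd x) ^ 4 * (1 + (norm (\<Xi> + s n *\<^sub>R fst x))\<^sup>2) \<partial>(gauss \<Otimes>\<^sub>M gauss :: ('a \<times> 'a) measure))"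
      unfolding Db_def Rs
      using intW[of n] int_as[of n] int2[OF b R Rn]
      by (simp add: pair_a1 pair_as Bochner_Integration.integral_sum Bochner_Integration.integrable_sum)
    moreover have "C2 * (\<epsilon> n)\<^sup>2 * (\<integral>x. norm (snd x) ^ 4 * (1 + (norm (\<Xi> + s n *\<^sub>R fst x))\<^sup>2) \<partial>(gauss \<Otimes>\<^sub>M gauss :: ('a \<times> 'a) measure))
       \<le> C2 * (\<epsilon> n)\<^sup>2 * M2"
      unfolding M2_def
      using C2 b by (intro mult_left_mono integral_mono intW intM2 nb0) auto
    moreover have "(a1 - as n) / (\<epsilon> n)\<^sup>2 \<le> T / (1 + s n) + C * (\<epsilon> n)\<^sup>2 * M1"
    proof -
      have p: "1 - s n > 0" "1 + s n > 0" using \<epsilon>_eq[of n] \<epsilon>2(2)[of n] s[of n] by (auto simp: zero_less_mult_iff)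
      have "(a1 - as n) / (\<epsilon> n)\<^sup>2 \<le> ((1 - s n) * T + C * (1 - s n)\<^sup>2 * M1) / (\<epsilon> n)\<^sup>2"
        using step1 by (intro divide_right_mono) auto
      also have "\<dots> = T / (1 + s n) + C * ((1 - s n) / (1 + s n)) * M1"
      proof -
        have "(a * T + C * a\<^sup>2 * M1) / (a * b) = T / b + C * (a / b) * M1" if "a > 0" "b > 0" for a b
          using that by (simp add: field_simps power2_eq_square)
        then show ?thesis unfolding \<epsilon>_eq using p by blast
      qed
      also have "\<dots> \<le> T / (1 + s n) + C * (\<epsilon> n)\<^sup>2 * M1"
      proof -
        have "(1 - s n) / (1 + s n) \<le> (1 - s n) / 1" using p s[of n] by (intro divide_left_mono) auto
        also have "\<dots> \<le> (\<epsilon> n)\<^sup>2" using s_ge[of n] by simp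
        finally show ?thesis using C M1 by (intro add_left_mono mult_right_mono mult_left_mono)
      qed
      finally show ?thesis .
    qed
    ultimately show ?thesis unfolding U_def by linarith
  qed
  \<comment> \<open>The density that moves the scale \<open>s n\<close> from the argument to the measure.\<close>
  define r where "r n u = exp (- (norm u)\<^sup>2 * (1 / (s n)\<^sup>2 - 1)) / s n ^ N" for n and u :: 'a
  have r0: "r n u \<ge> 0" for n u using s[of n] by (simp add: r_def)
  have [measurable]: "r n \<in> borel_measurable borel" for n unfolding r_def by simp
  have I: "(\<integral>\<^sup>+u. \<integral>\<^sup>+w. ennreal (r n u * Db n (\<Xi> + u) w) \<partial>gauss \<partial>gauss) \<le> ennreal (U n)" for n
  proof -
    define h where "h u = (\<integral>\<^sup>+w. ennreal (Db n (\<Xi> + u) w) \<partial>gauss)" for u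
    have [measurable]: "h \<in> borel_measurable borel"
      unfolding h_def
      by (rule gauss.borel_measurable_nn_integral) (simp add: split_def)
    have "(\<integral>\<^sup>+u. \<integral>\<^sup>+w. ennreal (r n u * Db n (\<Xi> + u) w) \<partial>gauss \<partial>gauss) = (\<integral>\<^sup>+u. ennreal (r n u) * h u \<partial>gauss)"
      unfolding h_def
      by (intro nn_integral_cong) (simp add: nn_integral_cmult[symmetric] ennreal_mult r0 Db0)
    also have "\<dots> = (\<integral>\<^sup>+y. h (s n *\<^sub>R y) \<partial>gauss)"
      unfolding r_def N_def using s(1)[of n] by (intro nn_integral_gauss_scaled[symmetric]) auto
    also have "\<dots> = (\<integral>\<^sup>+x. ennreal (Db n (\<Xi> + s n *\<^sub>R fst x) (snd x)) \<partial>(gauss \<Otimes>\<^sub>M gauss))"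
      unfolding h_def by (subst gauss.nn_integral_fst[symmetric]) auto
    also have "\<dots> = ennreal (\<integral>x. Db n (\<Xi> + s n *\<^sub>R fst x) (snd x) \<partial>(gauss \<Otimes>\<^sub>M gauss))"
      by (rule nn_integral_eq_integral[OF intE]) (simp add: Db0)
    also have "\<dots> \<le> ennreal (U n)" by (intro ennreal_leI EU)
    finally show ?thesis .
  qed
  have U_lim: "U \<longlonglongrightarrow> T / 2"
  proof -
    have "U \<longlonglongrightarrow> T / (1 + 1) + C * 0\<^sup>2 * M1 + C2 * 0\<^sup>2 * M2"
      unfolding U_def by (intro tendsto_intros s_lim \<epsilon>_lim) auto
    then show ?thesis by simp
  qed
  have pt: "ennreal (q (\<Xi> + u) w) \<le> liminf (\<lambda>n. ennreal (r n u * Db n (\<Xi> + u) w))" for u w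
  proof -
    obtain f where f: "(f \<longlongrightarrow> q (\<Xi> + u) w) (at_right 0)"
      "\<forall>\<^sub>F \<epsilon> in at_right 0. \<epsilon>\<^sup>2 * f \<epsilon> \<le> (\<Sum>j<4. \<phi> (\<Xi> + u + R j (\<epsilon> *\<^sub>R w))) / 4 - \<phi> (\<Xi> + u)"
      using S3[of "\<Xi> + u" w] by blast
    have f1: "(\<lambda>n. f (\<epsilon> n)) \<longlonglongrightarrow> q (\<Xi> + u) w" using f(1) \<epsilon>_right by (rule filterlim_compose)
    have r1: "(\<lambda>n. r n u) \<longlonglongrightarrow> 1"
    proof -
      have "(\<lambda>n. r n u) \<longlonglongrightarrow> exp (- (norm u)\<^sup>2 * (1 / 1\<^sup>2 - 1)) / 1 ^ N"
        unfolding r_def by (intro tendsto_intros s_lim) auto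
      then show ?thesis by simp
    qed
    have "(\<lambda>n. ennreal (r n u * f (\<epsilon> n))) \<longlonglongrightarrow> ennreal (1 * q (\<Xi> + u) w)"
      by (intro tendsto_ennrealI tendsto_mult r1 f1)
    then have "ennreal (q (\<Xi> + u) w) = liminf (\<lambda>n. ennreal (r n u * f (\<epsilon> n)))"
      by (subst lim_imp_Liminf) auto
    also have "\<dots> \<le> liminf (\<lambda>n. ennreal (r n u * Db n (\<Xi> + u) w))"
    proof (rule Liminf_mono)
      have "\<forall>\<^sub>F n in sequentially. (\<epsilon> n)\<^sup>2 * f (\<epsilon> n) \<le> (\<Sum>j<4. \<phi> (\<Xi> + u + R j (\<epsilon> n *\<^sub>R w))) / 4 - \<phi> (\<Xi> + u)"
        using eventually_compose_filterlim[OF f(2) \<epsilon>_right] .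
      then show "\<forall>\<^sub>F n in sequentially. ennreal (r n u * f (\<epsilon> n)) \<le> ennreal (r n u * Db n (\<Xi> + u) w)"
      proof eventually_elim
        case (elim n)
        have "f (\<epsilon> n) \<le> ((\<Sum>j<4. \<phi> (\<Xi> + u + R j (\<epsilon> n *\<^sub>R w))) / 4 - \<phi> (\<Xi> + u)) / (\<epsilon> n)\<^sup>2"
          using elim \<epsilon>2(2)[of n] by (simp add: pos_le_divide_eq mult.commute)
        also have "\<dots> \<le> Db n (\<Xi> + u) w" unfolding Db_def using C2 by simp
        finally show ?case by (intro ennreal_leI mult_left_mono r0)
      qed
    qed
    finally show ?thesis .
  qed
  have "(\<integral>\<^sup>+u. ennreal (low (\<Xi> + u)) \<partial>gauss) \<le> (\<integral>\<^sup>+u. \<integral>\<^sup>+w. liminf (\<lambda>n. ennreal (r n u * Db n (\<Xi> + u) w)) \<partial>gauss \<partial>gauss)"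
  proof (rule nn_integral_mono)
    fix u :: 'a
    have "ennreal (low (\<Xi> + u)) \<le> (\<integral>\<^sup>+w. ennreal (q (\<Xi> + u) w) \<partial>gauss)" by (rule low)
    also have "\<dots> \<le> (\<integral>\<^sup>+w. liminf (\<lambda>n. ennreal (r n u * Db n (\<Xi> + u) w)) \<partial>gauss)"
      by (intro nn_integral_mono pt)
    finally show "ennreal (low (\<Xi> + u)) \<le> (\<integral>\<^sup>+w. liminf (\<lambda>n. ennreal (r n u * Db n (\<Xi> + u) w)) \<partial>gauss)" .
  qed
  also have "\<dots> \<le> (\<integral>\<^sup>+u. liminf (\<lambda>n. \<integral>\<^sup>+w. ennreal (r n u * Db n (\<Xi> + u) w) \<partial>gauss) \<partial>gauss)"
    by (rule nn_integral_mono, rule nn_integral_liminf) simp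
  also have "\<dots> \<le> liminf (\<lambda>n. \<integral>\<^sup>+u. \<integral>\<^sup>+w. ennreal (r n u * Db n (\<Xi> + u) w) \<partial>gauss \<partial>gauss)"
    by (rule nn_integral_liminf, rule gauss.borel_measurable_nn_integral) (simp add: split_def)
  also have "\<dots> \<le> liminf (\<lambda>n. ennreal (U n))"
    by (intro Liminf_mono always_eventually allI I)
  also have "\<dots> = ennreal (T / 2)"
    by (intro lim_imp_Liminf tendsto_ennrealI U_lim) simp
  finally show ?thesis unfolding T_def .
qed

section \<open>Lower bound for the minimax risk\<close>

lemma gauss_norm_second_moment: "(\<integral>y. (norm (y::'a::euclidean_space))\<^sup>2 \<partial>gauss) = DIM('a) / 2"
proof -
  have "linear (\<lambda>y::'a. y)" by (rule linearI) auto
  from gauss_linear_second_moment(2)[OF this] show ?thesis by simp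
qed

lemma emeasure_gauss_UNIV [simp]: "emeasure (gauss :: 'a::euclidean_space measure) UNIV = 1"
  using gauss.emeasure_space_1[where 'a = 'a] by simp

text \<open>Replacing \<open>v\<close> by \<open>- v\<close> and averaging removes the cross term.\<close>

lemma nn_integral_gauss_shifted_ge:
  fixes d :: "'a::euclidean_space"
  shows "ennreal (c\<^sup>2 * (DIM('a) / 2)) \<le> (\<integral>\<^sup>+v. ennreal ((norm (d - c *\<^sub>R v))\<^sup>2) \<partial>gauss)"
proof -
  have I: "integrable gauss (\<lambda>v. (norm (d - k *\<^sub>R v))\<^sup>2)" for k
  proof (rule integrable_gauss_poly[where c = "2 * (norm d)\<^sup>2 + 2 * k\<^sup>2" and k = 2])
    fix v :: 'a
    have "(norm (d - k *\<^sub>R v))\<^sup>2 \<le> 2 * (norm d)\<^sup>2 + 2 * (norm (- (k *\<^sub>R v)))\<^sup>2"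
      using norm_add_sq_le[of d "- (k *\<^sub>R v)"] by simp
    also have "\<dots> = 2 * (norm d)\<^sup>2 + 2 * k\<^sup>2 * (norm v)\<^sup>2" by (simp add: power_mult_distrib)
    also have "\<dots> \<le> (2 * (norm d)\<^sup>2 + 2 * k\<^sup>2) * (1 + (norm v)\<^sup>2)" by (simp add: algebra_simps)
    finally show "\<bar>(norm (d - k *\<^sub>R v))\<^sup>2\<bar> \<le> (2 * (norm d)\<^sup>2 + 2 * k\<^sup>2) * (1 + (norm v)\<^sup>2)" by simp
  qed simp
  define A where "A = (\<integral>v. (norm (d - c *\<^sub>R v))\<^sup>2 \<partial>gauss)"
  have "A = (\<integral>v. (norm (d - c *\<^sub>R v))\<^sup>2 \<partial>distr gauss borel uminus)"
    by (simp add: A_def distr_gauss_uminus)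
  also have "\<dots> = (\<integral>v. (norm (d - (- c) *\<^sub>R v))\<^sup>2 \<partial>gauss)" by (subst integral_distr) auto
  finally have "A + A = (\<integral>v. (norm (d - c *\<^sub>R v))\<^sup>2 + (norm (d - (- c) *\<^sub>R v))\<^sup>2 \<partial>gauss)"
    using I[of c] I[of "- c"] unfolding A_def by (subst Bochner_Integration.integral_add) auto
  also have "\<dots> = (\<integral>v. 2 * (norm d)\<^sup>2 + 2 * c\<^sup>2 * (norm (v::'a))\<^sup>2 \<partial>gauss)"
    unfolding power2_norm_eq_inner
    by (intro Bochner_Integration.integral_cong)
       (auto simp: inner_add_left inner_add_right inner_diff_left inner_diff_right inner_commute power2_eq_square)
  also have "\<dots> = 2 * (norm d)\<^sup>2 + 2 * c\<^sup>2 * (DIM('a) / 2)"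
    by (subst Bochner_Integration.integral_add) (auto simp: gauss_norm_second_moment gauss.prob_space[simplified])
  finally have "c\<^sup>2 * (DIM('a) / 2) \<le> A" using zero_le_power2[of "norm d"] by linarith
  moreover have "(\<integral>\<^sup>+v. ennreal ((norm (d - c *\<^sub>R v))\<^sup>2) \<partial>gauss) = ennreal A"
    unfolding A_def by (rule nn_integral_eq_integral[OF I]) simp
  ultimately show ?thesis by (simp add: ennreal_leI)
qed

text \<open>The Bayes risk for the Gaussian prior of scale \<open>\<tau>\<close>. Rotating the pair of
  noise and parameter turns the observation into a multiple of the first component and the
  parameter into a function of the observation plus \<open>\<tau>/\<surd>(1 +
  \<tau>\<^sup>2)\<close> times the second component, which is independent of the observation.\<close>

lemma sup_risk_ge_bayes:
  fixes \<delta> :: "'a::euclidean_space \<Rightarrow> 'a"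
  assumes [measurable]: "\<delta> \<in> borel_measurable borel" and \<tau>: "\<tau> > 0"
  shows "ennreal (\<tau>\<^sup>2 / (1 + \<tau>\<^sup>2) * (DIM('a) / 2)) \<le> (SUP \<Xi>. \<integral>\<^sup>+y. ennreal ((norm (\<delta> (\<Xi> + y) - \<Xi>))\<^sup>2) \<partial>gauss)"
proof -
  define \<sigma> where "\<sigma> = sqrt (1 + \<tau>\<^sup>2)"
  have \<sigma>: "\<sigma> > 0" "\<sigma>\<^sup>2 = 1 + \<tau>\<^sup>2" by (auto simp: \<sigma>_def add_pos_nonneg)
  define s where "s = 1 / \<sigma>"
  define \<epsilon> where "\<epsilon> = \<tau> / \<sigma>"
  have s: "s > 0" "s\<^sup>2 + \<epsilon>\<^sup>2 = 1" using \<sigma> by (auto simp: s_def \<epsilon>_def power_divide add_divide_distrib[symmetric] add_pos_nonneg less_imp_neq[symmetric])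
  have \<tau>\<epsilon>: "\<tau> * \<epsilon> + s = \<sigma>" "\<tau> * s = \<epsilon>" using \<sigma> by (auto simp: s_def \<epsilon>_def field_simps power2_eq_square)
  have \<epsilon>2: "\<epsilon>\<^sup>2 = \<tau>\<^sup>2 / (1 + \<tau>\<^sup>2)" using \<sigma> by (simp add: \<epsilon>_def power_divide)
  define F where "F y x = ennreal ((norm (\<delta> (\<tau> *\<^sub>R x + y) - \<tau> *\<^sub>R x))\<^sup>2)" for y x
  have F[measurable]: "case_prod F \<in> borel_measurable (borel \<Otimes>\<^sub>M borel)" unfolding F_def split_def by measurable
  have "ennreal (\<tau>\<^sup>2 / (1 + \<tau>\<^sup>2) * (DIM('a) / 2)) = (\<integral>\<^sup>+u. ennreal (\<epsilon>\<^sup>2 * (DIM('a) / 2)) \<partial>(gauss :: 'a measure))"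
    by (simp add: \<epsilon>2)
  also have "\<dots> \<le> (\<integral>\<^sup>+u. \<integral>\<^sup>+v. F (s *\<^sub>R u - \<epsilon> *\<^sub>R v) (\<epsilon> *\<^sub>R u + s *\<^sub>R v) \<partial>gauss \<partial>gauss)"
  proof (rule nn_integral_mono)
    fix u :: 'a
    have 1: "\<tau> *\<^sub>R (\<epsilon> *\<^sub>R u + s *\<^sub>R v) + (s *\<^sub>R u - \<epsilon> *\<^sub>R v) = \<sigma> *\<^sub>R u" for v :: 'a
    proof -
      have "\<tau> *\<^sub>R (\<epsilon> *\<^sub>R u + s *\<^sub>R v) + (s *\<^sub>R u - \<epsilon> *\<^sub>R v) = (\<tau> * \<epsilon> + s) *\<^sub>R u + (\<tau> * s - \<epsilon>) *\<^sub>R v"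
        by (simp add: algebra_simps)
      then show ?thesis by (simp add: \<tau>\<epsilon>)
    qed
    have "F (s *\<^sub>R u - \<epsilon> *\<^sub>R v) (\<epsilon> *\<^sub>R u + s *\<^sub>R v) = ennreal ((norm ((\<delta> (\<sigma> *\<^sub>R u) - (\<tau> * \<epsilon>) *\<^sub>R u) - \<epsilon> *\<^sub>R v))\<^sup>2)" for v
      unfolding F_def 1 by (simp add: scaleR_add_right \<tau>\<epsilon> algebra_simps)
    then show "ennreal (\<epsilon>\<^sup>2 * (DIM('a) / 2)) \<le> (\<integral>\<^sup>+v. F (s *\<^sub>R u - \<epsilon> *\<^sub>R v) (\<epsilon> *\<^sub>R u + s *\<^sub>R v) \<partial>gauss)"
      using nn_integral_gauss_shifted_ge[of \<epsilon> "\<delta> (\<sigma> *\<^sub>R u) - (\<tau> * \<epsilon>) *\<^sub>R u"] by simp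
  qed
  also have "\<dots> = (\<integral>\<^sup>+y. \<integral>\<^sup>+x. F y x \<partial>gauss \<partial>gauss)"
    by (rule nn_integral_gauss_rotation[OF F s])
  also have "\<dots> = (\<integral>\<^sup>+x. \<integral>\<^sup>+y. F y x \<partial>gauss \<partial>gauss)"
    by (rule gauss_pair.Fubini'[symmetric]) (simp add: F_def split_def)
  also have "\<dots> \<le> (\<integral>\<^sup>+x. (SUP \<Xi>. \<integral>\<^sup>+y. ennreal ((norm (\<delta> (\<Xi> + y) - \<Xi>))\<^sup>2) \<partial>gauss) \<partial>(gauss :: 'a measure))"
  proof (rule nn_integral_mono)
    fix x :: 'a
    show "(\<integral>\<^sup>+y. F y x \<partial>gauss) \<le> (SUP \<Xi>. \<integral>\<^sup>+y. ennreal ((norm (\<delta> (\<Xi> + y) - \<Xi>))\<^sup>2) \<partial>gauss)"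
      unfolding F_def by (rule SUP_upper2[of "\<tau> *\<^sub>R x"]) auto
  qed
  also have "\<dots> = (SUP \<Xi>. \<integral>\<^sup>+y. ennreal ((norm (\<delta> (\<Xi> + y) - \<Xi>))\<^sup>2) \<partial>gauss)"
    by simp
  finally show ?thesis .
qed

lemma sup_risk_ge:
  fixes \<delta> :: "'a::euclidean_space \<Rightarrow> 'a"
  assumes "\<delta> \<in> borel_measurable borel"
  shows "ennreal (DIM('a) / 2) \<le> (SUP \<Xi>. \<integral>\<^sup>+y. ennreal ((norm (\<delta> (\<Xi> + y) - \<Xi>))\<^sup>2) \<partial>gauss)"
proof (rule LIMSEQ_le_const2)
  define \<tau> where "\<tau> n = real n + 1" for n
  have "(\<lambda>n. inverse (\<tau> n)) \<longlonglongrightarrow> 0"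
    unfolding \<tau>_def using LIMSEQ_inverse_real_of_nat by (simp add: add.commute)
  then have "(\<lambda>n. 1 / (1 + (inverse (\<tau> n))\<^sup>2) * (DIM('a) / 2)) \<longlonglongrightarrow> 1 / (1 + 0\<^sup>2) * (DIM('a) / 2)"
    by (intro tendsto_intros) auto
  moreover have "1 / (1 + (inverse (\<tau> n))\<^sup>2) = (\<tau> n)\<^sup>2 / (1 + (\<tau> n)\<^sup>2)" for n
    by (simp add: \<tau>_def field_simps add_pos_nonneg)
  ultimately show "(\<lambda>n. ennreal ((\<tau> n)\<^sup>2 / (1 + (\<tau> n)\<^sup>2) * (DIM('a) / 2))) \<longlonglongrightarrow> ennreal (DIM('a) / 2)"
    by (intro tendsto_ennrealI) simp
  have "ennreal ((\<tau> n)\<^sup>2 / (1 + (\<tau> n)\<^sup>2) * (DIM('a) / 2)) \<le> (SUP \<Xi>. \<integral>\<^sup>+y. ennreal ((norm (\<delta> (\<Xi> + y) - \<Xi>))\<^sup>2) \<partial>gauss)" for n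
    by (rule sup_risk_ge_bayes[OF assms]) (simp add: \<tau>_def)
  then show "\<exists>N. \<forall>n\<ge>N. ennreal ((\<tau> n)\<^sup>2 / (1 + (\<tau> n)\<^sup>2) * (DIM('a) / 2)) \<le> (SUP \<Xi>. \<integral>\<^sup>+y. ennreal ((norm (\<delta> (\<Xi> + y) - \<Xi>))\<^sup>2) \<partial>gauss)"
    by blast
qed

section \<open>Risk bound from the Stein inequality\<close>

text \<open>Expanding the square, the mean is \<open>DIM/2 - E(g \<bullet> y) + E|g|\<^sup>2/4\<close>,
  and the hypothesis says that the last term does not exceed the middle one. Since extended
  nonnegative reals truncate, the case of a negative mean of \<open>g \<bullet> y\<close> has to
  be excluded separately.\<close>

lemma risk_le_dim:
  fixes g :: "'a::euclidean_space \<Rightarrow> 'a"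
  assumes [measurable]: "g \<in> borel_measurable borel" and K: "\<And>z. norm (g z) \<le> K"
    and le: "(\<integral>\<^sup>+u. ennreal ((norm (g (\<Xi> + u)))\<^sup>2 / 8) \<partial>gauss) \<le> ennreal ((\<integral>y. g (\<Xi> + y) \<bullet> y \<partial>gauss) / 2)"
  shows "(\<integral>\<^sup>+y. ennreal ((norm (y - (1 / 2) *\<^sub>R g (\<Xi> + y)))\<^sup>2) \<partial>gauss) \<le> ennreal (DIM('a) / 2)"
proof -
  define T where "T = (\<integral>y. g (\<Xi> + y) \<bullet> y \<partial>gauss)"
  define E where "E = (\<integral>y. (norm (g (\<Xi> + y)))\<^sup>2 \<partial>gauss)"
  have K0: "K \<ge> 0" using order_trans[OF norm_ge_zero K[of 0]] .
  have intT: "integrable gauss (\<lambda>y. g (\<Xi> + y) \<bullet> y)"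
  proof (rule integrable_gauss_poly[where c = K and k = 1])
    fix z
    have "\<bar>g (\<Xi> + z) \<bullet> z\<bar> \<le> norm (g (\<Xi> + z)) * norm z" by (rule Cauchy_Schwarz_ineq2)
    also have "\<dots> \<le> K * norm z" by (intro mult_right_mono K) auto
    also have "\<dots> \<le> K * (1 + norm z ^ 1)" using K0 by (intro mult_left_mono) simp_all
    finally show "\<bar>g (\<Xi> + z) \<bullet> z\<bar> \<le> K * (1 + norm z ^ 1)" .
  qed simp
  have intE: "integrable gauss (\<lambda>y. (norm (g (\<Xi> + y)))\<^sup>2)"
  proof (rule integrable_gauss_poly[where c = "K\<^sup>2" and k = 1])
    fix z
    have "(norm (g (\<Xi> + z)))\<^sup>2 \<le> K\<^sup>2" by (intro power_mono K) auto
    also have "\<dots> \<le> K\<^sup>2 * (1 + norm z ^ 1)" by (simp add: mult_le_cancel_left1)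
    finally show "\<bar>(norm (g (\<Xi> + z)))\<^sup>2\<bar> \<le> K\<^sup>2 * (1 + norm z ^ 1)" by simp
  qed simp
  have E0: "E \<ge> 0" unfolding E_def by (intro Bochner_Integration.integral_nonneg) simp
  have "(\<integral>\<^sup>+u. ennreal ((norm (g (\<Xi> + u)))\<^sup>2 / 8) \<partial>gauss) = ennreal (E / 8)"
    unfolding E_def using intE by (subst nn_integral_eq_integral) auto
  with le have le': "ennreal (E / 8) \<le> ennreal (T / 2)" by (simp add: T_def)
  have ET: "E / 4 \<le> T"
  proof (cases "T \<ge> 0")
    case True
    then show ?thesis using le' by (simp add: ennreal_le_iff)
  next
    case False
    then have "ennreal (T / 2) = 0" by (simp add: ennreal_neg)
    with le' have "E = 0" using E0 by (simp add: ennreal_eq_0_iff)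
    then have "AE y in gauss. (norm (g (\<Xi> + y)))\<^sup>2 = 0"
      unfolding E_def using intE by (subst (asm) integral_nonneg_eq_0_iff_AE) auto
    then have "AE y in gauss. g (\<Xi> + y) \<bullet> y = 0" by eventually_elim simp
    then have "T = 0" unfolding T_def by (rule integral_eq_zero_AE)
    with False show ?thesis by simp
  qed
  have eq: "(norm (y - (1 / 2) *\<^sub>R g (\<Xi> + y)))\<^sup>2 = (norm y)\<^sup>2 - g (\<Xi> + y) \<bullet> y + (norm (g (\<Xi> + y)))\<^sup>2 / 4" for y
    unfolding power2_norm_eq_inner by (simp add: inner_diff_left inner_diff_right inner_commute)
  have "(\<integral>\<^sup>+y. ennreal ((norm (y - (1 / 2) *\<^sub>R g (\<Xi> + y)))\<^sup>2) \<partial>gauss)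
    = ennreal (\<integral>y. (norm (y - (1 / 2) *\<^sub>R g (\<Xi> + y)))\<^sup>2 \<partial>gauss)"
  proof (rule nn_integral_eq_integral)
    show "integrable gauss (\<lambda>y. (norm (y - (1 / 2) *\<^sub>R g (\<Xi> + y)))\<^sup>2)"
      unfolding eq using intT intE by simp
  qed simp
  also have "(\<integral>y. (norm (y - (1 / 2) *\<^sub>R g (\<Xi> + y)))\<^sup>2 \<partial>gauss) = DIM('a) / 2 - T + E / 4"
    unfolding eq using intT intE by (simp add: T_def E_def gauss_norm_second_moment)
  also have "ennreal \<dots> \<le> ennreal (DIM('a) / 2)" using ET by (intro ennreal_leI) simp
  finally show ?thesis .
qed

section \<open>The complex matrix normal distribution\<close>

lemma sqrt_pi_power_DIM: "sqrt pi ^ DIM(complex^'p^'m) = pi ^ (CARD('m::finite) * CARD('p::finite))"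
proof -
  have "DIM(complex^'p^'m) = 2 * (CARD('m) * CARD('p))" by simp
  then show ?thesis by (simp only: power_mult) simp
qed

lemma complex_normal_eq: "complex_normal \<Xi> = density lebesgue (\<lambda>z. gauss_density (z - \<Xi>))"
  unfolding complex_normal_def sqrt_pi_power_DIM power2_norm_eq_inner inner_matrix_trace' ..

lemma risk_eq_gauss:
  fixes \<delta> \<delta>0 :: "complex^'p::finite^'m::finite \<Rightarrow> complex^'p^'m"
  assumes \<delta>[measurable]: "\<delta> \<in> borel_measurable lebesgue" and \<delta>0[measurable]: "\<delta>0 \<in> borel_measurable borel"
    and ae: "AE z in lborel. \<delta> z = \<delta>0 z"
  shows "risk \<delta> \<Xi> = (\<integral>\<^sup>+y. ennreal ((norm (\<delta>0 (\<Xi> + y) - \<Xi>))\<^sup>2) \<partial>gauss)"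
proof -
  have "risk \<delta> \<Xi> = (\<integral>\<^sup>+z. ennreal ((norm (\<delta> z - \<Xi>))\<^sup>2) \<partial>density lebesgue (\<lambda>z. gauss_density (z - \<Xi>)))"
    unfolding risk_def complex_normal_eq power2_norm_eq_inner inner_matrix_trace ..
  also have "\<dots> = (\<integral>\<^sup>+z. gauss_density (z - \<Xi>) * ennreal ((norm (\<delta> z - \<Xi>))\<^sup>2) \<partial>lebesgue)"
  proof (rule nn_integral_density)
    have "(\<lambda>z. gauss_density (z - \<Xi>)) \<in> borel_measurable lborel" by simp
    then show "(\<lambda>z. gauss_density (z - \<Xi>)) \<in> borel_measurable lebesgue" by (rule measurable_completion)
  qed measurable
  also have "\<dots> = (\<integral>\<^sup>+z. gauss_density (z - \<Xi>) * ennreal ((norm (\<delta> z - \<Xi>))\<^sup>2) \<partial>lborel)"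
    by (rule nn_integral_completion)
  also have "\<dots> = (\<integral>\<^sup>+z. gauss_density (z - \<Xi>) * ennreal ((norm (\<delta>0 z - \<Xi>))\<^sup>2) \<partial>lborel)"
    using ae by (intro nn_integral_cong_AE) (auto elim: eventually_mono)
  also have "\<dots> = (\<integral>\<^sup>+y. gauss_density y * ennreal ((norm (\<delta>0 (\<Xi> + y) - \<Xi>))\<^sup>2) \<partial>lborel)"
    by (subst nn_integral_lborel_affine[of _ 1 \<Xi>]) auto
  also have "\<dots> = (\<integral>\<^sup>+y. ennreal ((norm (\<delta>0 (\<Xi> + y) - \<Xi>))\<^sup>2) \<partial>gauss)"
    by (rule nn_integral_gauss[symmetric]) simp
  finally show ?thesis .
qed

lemma lebesgue_measurable_AE_borel:
  fixes f :: "'a::euclidean_space \<Rightarrow> 'b::euclidean_space"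
  assumes f: "f \<in> borel_measurable lebesgue"
  shows "\<exists>f0\<in>borel_measurable borel. AE z in lborel. f z = f0 z"
proof -
  have "\<exists>h\<in>borel_measurable lborel. AE z in lborel. f z \<bullet> b = h z" for b
    using f by (intro completion_ex_borel_measurable_real) simp
  then obtain h where h: "\<And>b. h b \<in> borel_measurable lborel" "\<And>b. AE z in lborel. f z \<bullet> b = h b z" by metis
  define f0 where "f0 z = (\<Sum>b\<in>Basis. h b z *\<^sub>R b)" for z
  have "AE z in lborel. \<forall>b\<in>Basis. f z \<bullet> b = h b z" by (intro AE_finite_allI h(2)) simp
  then have "AE z in lborel. f z = f0 z"
  proof eventually_elim
    case (elim z)
    then have "f0 z = (\<Sum>b\<in>Basis. (f z \<bullet> b) *\<^sub>R b)" unfolding f0_def by (intro sum.cong) auto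
    then show ?case by (simp add: euclidean_representation)
  qed
  moreover have "f0 \<in> borel_measurable borel"
    using h(1) unfolding f0_def by (intro borel_measurable_sum borel_measurable_scaleR) auto
  ultimately show ?thesis by blast
qed

lemma AE_borel_lebesgue_measurable:
  fixes f f0 :: "'a::euclidean_space \<Rightarrow> 'b::euclidean_space"
  assumes f0: "f0 \<in> borel_measurable borel" and ae: "AE z in lborel. f z = f0 z"
  shows "f \<in> borel_measurable lebesgue"
proof (rule measurableI)
  fix A :: "'b set" assume A: "A \<in> sets borel"
  have "f0 \<in> borel_measurable lborel" using f0 by simp
  then have "f0 \<in> borel_measurable lebesgue" by (rule measurable_completion)
  from measurable_sets[OF this A] have m: "f0 -` A \<inter> space lebesgue \<in> sets lebesgue" .
  have "AE z in lebesgue. f z = f0 z" using ae by (rule AE_completion)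
  then have "AE z in lebesgue. z \<in> f0 -` A \<inter> space lebesgue \<longleftrightarrow> z \<in> f -` A \<inter> space lebesgue"
    by eventually_elim auto
  from completion.in_sets_AE[OF this m] show "f -` A \<inter> space lebesgue \<in> sets lebesgue" by simp
qed simp

theorem sup_risk_ge_complex:
  fixes \<delta> :: "complex^'p::finite^'m::finite \<Rightarrow> complex^'p^'m"
  assumes "\<delta> \<in> estimators"
  shows "ennreal (real CARD('m) * real CARD('p)) \<le> (SUP \<Xi>. risk \<delta> \<Xi>)"
proof -
  have \<delta>: "\<delta> \<in> borel_measurable lebesgue" using assms by (simp add: estimators_def)
  obtain \<delta>0 where \<delta>0: "\<delta>0 \<in> borel_measurable borel" "AE z in lborel. \<delta> z = \<delta>0 z"
    using lebesgue_measurable_AE_borel[OF \<delta>] by blast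
  show ?thesis
    using sup_risk_ge[OF \<delta>0(1)] unfolding risk_eq_gauss[OF \<delta> \<delta>0] by simp
qed

section \<open>Second moments of linear images of a Gaussian matrix\<close>

lemma mult_axis_mult_nth:
  "((M::complex^'m^'r) ** axis i (axis j c) ** (K::complex^'s^'n)) $ a $ b = M $ a $ i * c * K $ j $ b"
proof -
  have 1: "(axis i (axis j c) ** K) $ x $ b = (if x = i then c * K $ j $ b else 0)" for x
  proof (cases "x = i")
    case True
    have "(\<Sum>k\<in>UNIV. axis j c $ k * K $ k $ b) = (\<Sum>k\<in>UNIV. if k = j then c * K $ j $ b else 0)"
      by (intro sum.cong) (auto simp: axis_def)
    then show ?thesis using True by (simp add: matrix_matrix_mult_def)
  qed (simp add: matrix_matrix_mult_def axis_def)
  have "(M ** (axis i (axis j c) ** K)) $ a $ b = (\<Sum>x\<in>UNIV. M $ a $ x * (if x = i then c * K $ j $ b else 0))"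
    by (subst matrix_matrix_mult_def) (simp add: 1)
  also have "\<dots> = (\<Sum>x\<in>UNIV. if x = i then M $ a $ i * c * K $ j $ b else 0)"
    by (intro sum.cong) auto
  finally show ?thesis by (simp add: matrix_mul_assoc)
qed

lemma norm_mult_axis_mult:
  "(norm ((M::complex^'m^'r) ** axis i (axis j c) ** (K::complex^'s^'n)))\<^sup>2
    = (\<Sum>a\<in>UNIV. (cmod (M $ a $ i))\<^sup>2) * ((cmod c)\<^sup>2 * (\<Sum>b\<in>UNIV. (cmod (K $ j $ b))\<^sup>2))"
  unfolding norm_matrix_sq mult_axis_mult_nth sum_distrib_left[of "(cmod c)\<^sup>2"] sum_product
  by (simp add: norm_mult power_mult_distrib mult_ac)

text \<open>Computed on the standard basis, whose elements have a single entry \<open>1\<close> or the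
  imaginary unit; the two choices account for the variance \<open>1/2\<close> of each real
  coordinate.\<close>

lemma gauss_second_moment_mult:
  fixes M :: "complex^'m::finite^'r::finite" and K :: "complex^'s::finite^'n::finite"
  shows "integrable gauss (\<lambda>y. (norm (M ** y ** K))\<^sup>2)"
    and "(\<integral>y. (norm (M ** y ** K))\<^sup>2 \<partial>gauss) = (norm M)\<^sup>2 * (norm K)\<^sup>2"
proof -
  define L where "L y = M ** y ** K" for y
  have L: "linear L"
    by (rule linearI) (simp_all add: L_def matrix_distribs)
  show "integrable gauss (\<lambda>y. (norm (M ** y ** K))\<^sup>2)"
    using gauss_linear_second_moment(1)[OF L] by (simp add: L_def)
  have B: "(Basis :: (complex^'n^'m) set) = (\<lambda>(i, j, c). axis i (axis j c)) ` (UNIV \<times> UNIV \<times> {1, \<i>})"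
    by (auto simp: Basis_vec_def Basis_complex_def image_iff; blast)
  have inj: "inj_on (\<lambda>(i, j, c). axis i (axis j c) :: complex^'n^'m) (UNIV \<times> UNIV \<times> {1, \<i>})"
    by (auto simp: inj_on_def axis_eq_axis)
  have "(\<Sum>b\<in>Basis. (norm (L b))\<^sup>2) = (\<Sum>(i, j, c)\<in>UNIV \<times> UNIV \<times> {1, \<i>}. (norm (L (axis i (axis j c))))\<^sup>2)"
    unfolding B by (subst sum.reindex[OF inj]) (simp add: split_def)
  also have "\<dots> = (\<Sum>i\<in>UNIV. \<Sum>j\<in>UNIV. \<Sum>c\<in>{1, \<i>}. (norm (L (axis i (axis j c))))\<^sup>2)"
    by (simp only: sum.cartesian_product split_def)
  also have "\<dots> = (\<Sum>i\<in>UNIV. \<Sum>j\<in>UNIV. 2 * ((\<Sum>a\<in>UNIV. (cmod (M $ a $ i))\<^sup>2) * (\<Sum>b\<in>UNIV. (cmod (K $ j $ b))\<^sup>2)))"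
    by (simp add: L_def norm_mult_axis_mult)
  also have "\<dots> = 2 * ((norm M)\<^sup>2 * (norm K)\<^sup>2)"
  proof -
    have "(\<Sum>i\<in>UNIV. \<Sum>j\<in>UNIV. 2 * (A i * C j)) = 2 * (sum A UNIV * sum C UNIV)"
      for A :: "'m \<Rightarrow> real" and C :: "'n \<Rightarrow> real"
      by (subst sum_product) (simp only: sum_distrib_left)
    then show ?thesis unfolding norm_matrix_sq'[of M] norm_matrix_sq[of K] .
  qed
  finally show "(\<integral>y. (norm (M ** y ** K))\<^sup>2 \<partial>gauss) = (norm M)\<^sup>2 * (norm K)\<^sup>2"
    using gauss_linear_second_moment(2)[OF L] by (simp add: L_def)
qed

section \<open>Invariance of the Gaussian under multiplication by the imaginary unit\<close>

lemma Basis_cmatrix: "(Basis :: (complex^'n^'m) set) = (\<lambda>(i, j, c). axis i (axis j c)) ` (UNIV \<times> UNIV \<times> {1, \<i>})"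
  by (auto simp: Basis_vec_def Basis_complex_def image_iff; blast)

lemma prod_Basis_cmatrix:
  "(\<Prod>b\<in>(Basis :: (complex^'n^'m) set). f b) = (\<Prod>i\<in>UNIV. \<Prod>j\<in>UNIV. f (axis i (axis j 1)) * f (axis i (axis j \<i>)))"
proof -
  have inj: "inj_on (\<lambda>(i, j, c). axis i (axis j c) :: complex^'n^'m) (UNIV \<times> UNIV \<times> {1, \<i>})"
    by (auto simp: inj_on_def axis_eq_axis)
  have "(\<Prod>b\<in>(Basis :: (complex^'n^'m) set). f b) = (\<Prod>(i, j, c)\<in>UNIV \<times> UNIV \<times> {1, \<i>}. f (axis i (axis j c)))"
    unfolding Basis_cmatrix by (subst prod.reindex[OF inj]) (simp add: split_def)
  also have "\<dots> = (\<Prod>i\<in>UNIV. \<Prod>j\<in>UNIV. \<Prod>c\<in>{1, \<i>}. f (axis i (axis j c)))"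
    by (simp only: prod.cartesian_product split_def)
  finally show ?thesis by simp
qed

lemma continuous_cscale: "continuous_on UNIV (cscale c :: complex^'n^'m \<Rightarrow> _)"
proof -
  have "linear (cscale c :: complex^'n^'m \<Rightarrow> complex^'n^'m)"
    by (rule linearI) (simp_all add: cscale_add cscale_scaleR)
  then show ?thesis by (simp add: linear_continuous_on linear_linear)
qed

text \<open>Multiplication by the imaginary unit permutes real coordinates up to sign, hence maps boxes to
  boxes of the same volume.\<close>

lemma distr_lborel_cscale_i: "distr lborel borel (cscale \<i>) = (lborel :: (complex^'n^'m) measure)"
proof (rule lborel_eqI[symmetric])
  have [measurable]: "(cscale \<i> :: complex^'n^'m \<Rightarrow> _) \<in> borel_measurable borel"
    by (rule borel_measurable_continuous_onI) (rule continuous_cscale)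
  fix l u :: "complex^'n^'m" assume le: "\<And>b. b \<in> Basis \<Longrightarrow> l \<bullet> b \<le> u \<bullet> b"
  define l' :: "complex^'n^'m" where "l' = (\<chi> i j. Complex (Im (l $ i $ j)) (- Re (u $ i $ j)))"
  define u' :: "complex^'n^'m" where "u' = (\<chi> i j. Complex (Im (u $ i $ j)) (- Re (l $ i $ j)))"
  have ball: "(\<forall>b\<in>Basis. P b) \<longleftrightarrow> (\<forall>i j. P (axis i (axis j 1)) \<and> P (axis i (axis j \<i>)))" for P :: "complex^'n^'m \<Rightarrow> bool"
    unfolding Basis_cmatrix by auto
  have le': "l' \<bullet> b \<le> u' \<bullet> b" if "b \<in> Basis" for b
  proof -
    have "\<forall>b\<in>Basis. l \<bullet> b \<le> u \<bullet> b" using le by blast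
    then have "\<forall>b\<in>Basis. l' \<bullet> b \<le> u' \<bullet> b"
      unfolding ball by (simp add: inner_axis l'_def u'_def inner_complex_def)
    then show ?thesis using that by blast
  qed
  have "cscale \<i> -` box l u = box l' u'"
    unfolding box_def ball
    by (auto simp: inner_axis l'_def u'_def cscale_def inner_complex_def) (metis neg_less_iff_less minus_minus)+
  then have "emeasure (distr lborel borel (cscale \<i>)) (box l u) = emeasure lborel (box l' u')"
    by (subst emeasure_distr) auto
  also have "\<dots> = (\<Prod>b\<in>Basis. (u' - l') \<bullet> b)" using le' by (rule emeasure_lborel_box)
  also have "(\<Prod>b\<in>Basis. (u' - l') \<bullet> b) = (\<Prod>b\<in>Basis. (u - l) \<bullet> b)"
    unfolding prod_Basis_cmatrix
    by (intro prod.cong) (auto simp: inner_axis l'_def u'_def inner_complex_def)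
  finally show "emeasure (distr lborel borel (cscale \<i>)) (box l u) = ennreal (\<Prod>b\<in>Basis. (u - l) \<bullet> b)" .
qed simp

lemma quarter_turn_measurable [measurable]: "(quarter_turn j :: complex^'n^'m \<Rightarrow> _) \<in> borel_measurable borel"
  unfolding quarter_turn_def by (rule borel_measurable_continuous_onI) (rule continuous_cscale)

lemma distr_gauss_quarter_turn: "distr gauss borel (quarter_turn j) = (gauss :: (complex^'n^'m) measure)"
proof (rule distr_gauss_isometry)
  show "distr lborel borel (quarter_turn j) = (lborel :: (complex^'n^'m) measure)"
  proof (induction j)
    case 0
    have "quarter_turn 0 = (\<lambda>x :: complex^'n^'m. x)" by (simp add: quarter_turn_def fun_eq_iff)
    then show ?case by (simp add: distr_id2)
  next
    case (Suc j)
    have [measurable]: "(cscale \<i> :: complex^'n^'m \<Rightarrow> _) \<in> borel_measurable borel"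
      by (rule borel_measurable_continuous_onI) (rule continuous_cscale)
    have eq: "quarter_turn (Suc j) = (\<lambda>x :: complex^'n^'m. cscale \<i> (quarter_turn j x))"
      by (simp add: quarter_turn_def fun_eq_iff cscale_cscale)
    have "distr lborel borel (quarter_turn (Suc j)) = distr (distr lborel borel (quarter_turn j)) borel (cscale \<i> :: complex^'n^'m \<Rightarrow> _)"
      unfolding eq by (subst distr_distr) (auto simp: comp_def)
    then show ?case by (simp add: Suc distr_lborel_cscale_i)
  qed
qed simp_all

section \<open>The regularised estimator\<close>

text \<open>The weights are the increments of the coefficients \<open>c\<^sub>k = m + n - 2k\<close>, and
  \<open>2 c\<^sub>k + c\<^sub>k\<^sub>+\<^sub>1\<^sup>2/2 = c\<^sub>k\<^sup>2/2 + 2\<close>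
  because \<open>c\<^sub>k = c\<^sub>k\<^sub>+\<^sub>1 + 2\<close>. The second inequality is the
  arithmetic reason why exactly these coefficients are admissible.\<close>

lemma weight_sums:
  fixes m n :: real and N :: nat
  assumes N: "n = real N" and j: "j \<le> N" and mn: "m \<ge> n"
  defines "w \<equiv> \<lambda>k. if k = N then m - n else 2"
  defines "c \<equiv> \<lambda>k. m + n - 2 * real k"
  shows "(\<Sum>k\<in>{j..N}. w k) = c j" and "(\<Sum>k\<in>{j..N}. w k * c k) \<ge> (c j)\<^sup>2 / 2"
proof -
  have "(\<Sum>k\<in>{j..N}. w k) = c j \<and> (\<Sum>k\<in>{j..N}. w k * c k) \<ge> (c j)\<^sup>2 / 2"
    using j
  proof (induction j rule: inc_induct)
    case base
    show ?case using N by (simp add: w_def c_def power2_eq_square)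
  next
    case (step k)
    have split: "{k..N} = insert k {Suc k..N}" using step.hyps by auto
    have c: "c k = c (Suc k) + 2" by (simp add: c_def)
    have wk: "w k = 2" using step.hyps by (simp add: w_def)
    have "(c k)\<^sup>2 / 2 \<le> 2 * c k + (c (Suc k))\<^sup>2 / 2" unfolding c by (simp add: power2_sum field_simps)
    then show ?case using step.IH c wk unfolding split by simp
  qed
  then show "(\<Sum>k\<in>{j..N}. w k) = c j" and "(\<Sum>k\<in>{j..N}. w k * c k) \<ge> (c j)\<^sup>2 / 2" by auto
qed

lemma sandwich_sum_rdiag:
  fixes A :: "complex^'n^'m" and B :: "complex^'k^'n"
  shows "(\<Sum>k\<in>I. w k *\<^sub>R (A ** rdiag (d k) ** B)) = A ** rdiag (\<lambda>i. \<Sum>k\<in>I. w k * d k i) ** B"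
proof (cases "finite I")
  case True
  then show ?thesis
  proof (induction I rule: finite_induct)
    case empty
    have "rdiag (\<lambda>i. 0) = (0 :: complex^'n^'n)" by (simp add: rdiag_def vec_eq_iff)
    then show ?case by simp
  next
    case (insert x F)
    have "rdiag (\<lambda>i. \<Sum>k\<in>insert x F. w k * d k i) = w x *\<^sub>R rdiag (d x) + rdiag (\<lambda>i. \<Sum>k\<in>F. w k * d k i)"
      using insert by (simp add: rdiag_scaleR rdiag_add)
    then show ?case using insert by (simp add: matrix_distribs)
  qed
next
  case False
  have "rdiag (\<lambda>i. 0) = (0 :: complex^'n^'n)" by (simp add: rdiag_def vec_eq_iff)
  with False show ?thesis by simp
qed

text \<open>The estimator with \<open>l\<^sub>k + e\<close> in place of \<open>l\<^sub>k\<close> is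
  \<open>Z - g/2\<close> for a subgradient \<open>g\<close> of \<open>\<Sum> w\<^sub>k
  \<psi>\<^sub>k\<close>, where \<open>\<psi>\<^sub>k\<close> is the logarithm of the product of
  the \<open>k\<close> largest numbers \<open>l\<^sub>i + e\<close>. The second-order bounds of
  the \<open>\<psi>\<^sub>k\<close> add up to at least \<open>|g|\<^sup>2/8\<close>.\<close>

lemma regularized_estimator:
  fixes pos :: "'p::finite \<Rightarrow> nat"
    and U :: "complex^'p^'m::finite \<Rightarrow> complex^'p^'p"
    and l :: "complex^'p^'m \<Rightarrow> nat \<Rightarrow> real"
  assumes mp: "CARD('m) > CARD('p)"
    and pos: "bij_betw pos UNIV {1..CARD('p)}"
    and U: "\<And>Z. unitary_matrix (U Z)"
    and sp: "\<And>Z. Z\<^sup>\<dagger> ** Z = U Z ** rdiag (\<lambda>i. l Z (pos i)) ** (U Z)\<^sup>\<dagger>"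
    and anti: "\<And>Z. antimono_on {1..CARD('p)} (l Z)"
    and l0: "\<And>Z i. l Z (pos i) \<ge> 0"
    and e: "e > 0"
  shows "\<exists>g\<in>borel_measurable borel.
     (AE Z in lborel. (1 / 2) *\<^sub>R g Z = Z ** U Z ** rdiag (\<lambda>i. (real CARD('m) + real CARD('p) - 2 * real (pos i)) / (l Z (pos i) + e)) ** (U Z)\<^sup>\<dagger>)
   \<and> (\<forall>\<Xi>. (\<integral>\<^sup>+y. ennreal ((norm (y - (1 / 2) *\<^sub>R g (\<Xi> + y)))\<^sup>2) \<partial>gauss) \<le> ennreal (DIM(complex^'p^'m) / 2))"
proof -
  define n where "n = CARD('p)"
  define m where "m = CARD('m)"
  have posn: "pos i \<in> {1..n}" for i using pos by (auto simp: bij_betw_def n_def)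
  define S where "S k = {i. pos i \<le> k}" for k
  define a where "a Z i = l Z (pos i) + e" for Z i
  define c where "c k = real m + real n - 2 * real k" for k
  define w where "w k = (if k = n then real m - real n else 2)" for k
  have w0: "w k \<ge> 0" for k using mp by (simp add: w_def m_def n_def)
  \<comment> \<open>Weighting the \<open>k\<close>-th potential by \<open>w k\<close> puts the total weight \<open>c (pos i)\<close> on the \<open>i\<close>-th eigenvalue.\<close>
  have wsum: "(\<Sum>k\<in>{j..n}. w k) = c j" and wcsum: "(\<Sum>k\<in>{j..n}. w k * c k) \<ge> (c j)\<^sup>2 / 2" if "j \<le> n" for j
    using weight_sums[of "real n" n j "real m"] that mp unfolding w_def c_def m_def n_def by auto
  have cardS: "card (S k) = k" if "k \<in> {1..n}" for k
  proof -
    have "pos ` S k = {1..k}"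
    proof
      show "{1..k} \<subseteq> pos ` S k"
      proof
        fix x assume x: "x \<in> {1..k}"
        then have "x \<in> pos ` UNIV" using pos that by (auto simp: bij_betw_def n_def)
        then show "x \<in> pos ` S k" using x by (auto simp: S_def)
      qed
    qed (use posn in \<open>auto simp: S_def\<close>)
    moreover have "inj_on pos (S k)" using pos by (auto simp: bij_betw_def intro: inj_on_subset)
    ultimately show ?thesis by (metis card_image card_atLeastAtMost diff_Suc_1)
  qed
  have te: "top_eigenvalues e (S k) U a" for k
  proof
    fix Z i j
    show "(U Z)\<^sup>\<dagger> ** U Z = mat 1" "U Z ** (U Z)\<^sup>\<dagger> = mat 1" using U[of Z] by (auto simp: unitary_matrix_def)
    show "Z\<^sup>\<dagger> ** Z = U Z ** rdiag (\<lambda>i. a Z i - e) ** (U Z)\<^sup>\<dagger>" by (simp add: a_def sp)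
    show "a Z i \<ge> e" using l0[of Z i] by (simp add: a_def)
    show "a Z j \<le> a Z i" if "i \<in> S k" "j \<notin> S k"
      using that anti[of Z] posn[of i] posn[of j] by (auto simp: S_def a_def n_def monotone_on_def)
  qed (rule e)
  let ?log_top = "\<lambda>k. top_eigenvalues.log_top (S k) a"
  let ?hg = "\<lambda>k. top_eigenvalues.half_gradient (S k) U a"
  let ?rg = "\<lambda>k. top_eigenvalues.rot_gradient (S k) U a"
  let ?so = "\<lambda>k. top_eigenvalues.second_order (S k) U a"
  obtain C1 where C1: "\<And>k. C1 k \<ge> 0" "\<And>k Z W. ?log_top k (Z + W) \<ge> ?log_top k Z + 2 * (?hg k Z \<bullet> W) - C1 k * (norm W)\<^sup>2 * (1 + (norm Z)\<^sup>2)"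
    using top_eigenvalues.log_top_subgradient[OF te] by metis
  obtain C2 where C2: "\<And>k. C2 k \<ge> 0" "\<And>k Z W. (\<Sum>j<4. ?log_top k (Z + quarter_turn j W)) / 4 \<ge> ?log_top k Z - C2 k * norm W ^ 4 * (1 + (norm Z)\<^sup>2)"
    using top_eigenvalues.log_top_quarter_turns_ge[OF te] by metis
  define \<phi> where "\<phi> Z = (\<Sum>k\<in>{1..n}. w k * (?log_top k Z - real (card (S k)) * ln e))" for Z
  define g where "g Z = (\<Sum>k\<in>{1..n}. (2 * w k) *\<^sub>R ?hg k Z)" for Z
  define D1 where "D1 = (\<Sum>k\<in>{1..n}. w k * C1 k)"
  define D2 where "D2 = (\<Sum>k\<in>{1..n}. w k * C2 k)"
  define B where "B = (\<Sum>k\<in>{1..n}. w k / e)"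
  define K where "K = (\<Sum>k\<in>{1..n}. 2 * w k * sqrt (real CARD('p) / e))"
  have D: "D1 \<ge> 0" "D2 \<ge> 0" using C1(1) C2(1) w0 by (auto simp: D1_def D2_def intro!: sum_nonneg mult_nonneg_nonneg)
  have \<phi>0: "\<phi> Z \<ge> 0" for Z
    unfolding \<phi>_def using top_eigenvalues.log_top_ge[OF te] w0 by (intro sum_nonneg mult_nonneg_nonneg) auto
  have \<phi>B: "\<phi> Z \<le> B * (1 + (norm Z)\<^sup>2)" for Z
  proof -
    have "\<phi> Z \<le> (\<Sum>k\<in>{1..n}. w k * ((norm Z)\<^sup>2 / e))"
      unfolding \<phi>_def using w0 top_eigenvalues.log_top_le[OF te, where Z = Z]
      by (intro sum_mono mult_left_mono) (auto simp: algebra_simps)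
    also have "\<dots> = B * (norm Z)\<^sup>2" by (simp add: B_def sum_distrib_right)
    also have "\<dots> \<le> B * (1 + (norm Z)\<^sup>2)"
      using w0 e by (intro mult_left_mono) (auto simp: B_def intro!: sum_nonneg divide_nonneg_nonneg)
    finally show ?thesis .
  qed
  have gK: "norm (g Z) \<le> K" for Z
    unfolding g_def K_def
  proof (intro sum_norm_le)
    fix k
    have "norm (?hg k Z) \<le> sqrt (real CARD('p) / e)"
      using top_eigenvalues.norm_half_gradient[OF te] top_eigenvalues.norm_rot_gradient_le[OF te] by metis
    then show "norm ((2 * w k) *\<^sub>R ?hg k Z) \<le> 2 * w k * sqrt (real CARD('p) / e)"
      using w0[of k] by (simp add: mult_left_mono)
  qed
  have S1: "\<phi> (Z + W) \<ge> \<phi> Z + g Z \<bullet> W - D1 * (norm W)\<^sup>2 * (1 + (norm Z)\<^sup>2)" for Z W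
  proof -
    have "\<phi> Z + g Z \<bullet> W - D1 * (norm W)\<^sup>2 * (1 + (norm Z)\<^sup>2)
      = (\<Sum>k\<in>{1..n}. w k * ((?log_top k Z + 2 * (?hg k Z \<bullet> W) - C1 k * (norm W)\<^sup>2 * (1 + (norm Z)\<^sup>2)) - real (card (S k)) * ln e))"
      unfolding \<phi>_def g_def D1_def inner_sum_left sum_distrib_right sum.distrib[symmetric] sum_subtractf[symmetric]
      by (intro sum.cong) (auto simp: algebra_simps)
    also have "\<dots> \<le> \<phi> (Z + W)"
      unfolding \<phi>_def using w0 C1(2) by (intro sum_mono mult_left_mono diff_right_mono) auto
    finally show ?thesis .
  qed
  have S2: "(\<Sum>j<(4::nat). \<phi> (Z + quarter_turn j W)) / 4 \<ge> \<phi> Z - D2 * norm W ^ 4 * (1 + (norm Z)\<^sup>2)" for Z W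
  proof -
    have "\<phi> Z - D2 * norm W ^ 4 * (1 + (norm Z)\<^sup>2)
      = (\<Sum>k\<in>{1..n}. w k * ((?log_top k Z - C2 k * norm W ^ 4 * (1 + (norm Z)\<^sup>2)) - real (card (S k)) * ln e))"
      unfolding \<phi>_def D2_def sum_distrib_right sum_subtractf[symmetric]
      by (intro sum.cong) (auto simp: algebra_simps)
    also have "\<dots> \<le> (\<Sum>k\<in>{1..n}. w k * ((\<Sum>j<4. ?log_top k (Z + quarter_turn j W)) / 4 - real (card (S k)) * ln e))"
      using w0 C2(2) by (intro sum_mono mult_left_mono diff_right_mono) auto
    also have "\<dots> = (\<Sum>j<4. \<phi> (Z + quarter_turn j W)) / 4"
      unfolding \<phi>_def sum_lessThan_4 sum.distrib[symmetric] sum_divide_distrib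
      by (intro sum.cong) (auto simp: field_simps)
    finally show ?thesis .
  qed
  define q where "q Z W = (\<Sum>k\<in>{1..n}. w k * ?so k Z W)" for Z W
  have S3: "\<exists>f. (f \<longlongrightarrow> q Z W) (at_right 0)
        \<and> (\<forall>\<^sub>F \<epsilon> in at_right 0. \<epsilon>\<^sup>2 * f \<epsilon> \<le> (\<Sum>j<(4::nat). \<phi> (Z + quarter_turn j (\<epsilon> *\<^sub>R W))) / 4 - \<phi> Z)" for Z W
  proof -
    have "\<forall>k. \<exists>f. (f \<longlongrightarrow> ?so k Z W) (at_right 0)
       \<and> (\<forall>\<^sub>F \<epsilon> in at_right 0. \<epsilon>\<^sup>2 * f \<epsilon> \<le> (\<Sum>j<4. ?log_top k (Z + quarter_turn j (\<epsilon> *\<^sub>R W))) / 4 - ?log_top k Z)"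
      by (rule allI) (rule top_eigenvalues.log_top_second_order[OF te])
    from choice[OF this] obtain f where f: "\<And>k. (f k \<longlongrightarrow> ?so k Z W) (at_right 0)"
      "\<And>k. \<forall>\<^sub>F \<epsilon> in at_right 0. \<epsilon>\<^sup>2 * f k \<epsilon> \<le> (\<Sum>j<4. ?log_top k (Z + quarter_turn j (\<epsilon> *\<^sub>R W))) / 4 - ?log_top k Z"
      by blast
    have "((\<lambda>\<epsilon>. \<Sum>k\<in>{1..n}. w k * f k \<epsilon>) \<longlongrightarrow> q Z W) (at_right 0)"
      unfolding q_def by (intro tendsto_intros f)
    moreover have "\<forall>\<^sub>F \<epsilon> in at_right 0. \<forall>k\<in>{1..n}. \<epsilon>\<^sup>2 * f k \<epsilon> \<le> (\<Sum>j<4. ?log_top k (Z + quarter_turn j (\<epsilon> *\<^sub>R W))) / 4 - ?log_top k Z"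
      using f(2) by (intro eventually_ball_finite) auto
    then have "\<forall>\<^sub>F \<epsilon> in at_right 0. \<epsilon>\<^sup>2 * (\<Sum>k\<in>{1..n}. w k * f k \<epsilon>) \<le> (\<Sum>j<(4::nat). \<phi> (Z + quarter_turn j (\<epsilon> *\<^sub>R W))) / 4 - \<phi> Z"
    proof eventually_elim
      case (elim \<epsilon>)
      have "\<epsilon>\<^sup>2 * (\<Sum>k\<in>{1..n}. w k * f k \<epsilon>) = (\<Sum>k\<in>{1..n}. w k * (\<epsilon>\<^sup>2 * f k \<epsilon>))"
        by (simp add: sum_distrib_left mult_ac)
      also have "\<dots> \<le> (\<Sum>k\<in>{1..n}. w k * ((\<Sum>j<4. ?log_top k (Z + quarter_turn j (\<epsilon> *\<^sub>R W))) / 4 - ?log_top k Z))"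
        using elim w0 by (intro sum_mono mult_left_mono) auto
      also have "\<dots> = (\<Sum>j<(4::nat). \<phi> (Z + quarter_turn j (\<epsilon> *\<^sub>R W))) / 4 - \<phi> Z"
        unfolding \<phi>_def sum_lessThan_4 sum.distrib[symmetric] sum_divide_distrib sum_subtractf[symmetric]
        by (intro sum.cong) (auto simp: field_simps)
      finally show ?case .
    qed
    ultimately show ?thesis by blast
  qed
  define low where "low Z = (\<Sum>k\<in>{1..n}. w k * (c k * (norm (?rg k Z))\<^sup>2))" for Z
  have low: "ennreal (low Z) \<le> (\<integral>\<^sup>+W. ennreal (q Z W) \<partial>gauss)" for Z
  proof -
    define M where "M k = (?rg k Z)\<^sup>\<dagger>" for k
    define N where "N k = U Z ** top_eigenvalues.rest_proj (S k)" for k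
    define M' where "M' k = mat 1 - ?rg k Z ** rdiag (a Z) ** (?rg k Z)\<^sup>\<dagger>" for k
    define N' where "N' k = U Z ** top_eigenvalues.top_proj (S k) ** top_eigenvalues.inv_sqrt_top (S k) a Z" for k
    have so: "?so k Z W \<ge> (norm (M k ** W ** N k))\<^sup>2 + (norm (M' k ** W ** N' k))\<^sup>2" for k W
      unfolding M_def N_def M'_def N'_def by (rule top_eigenvalues.second_order_ge[OF te])
    have const: "(norm (M k))\<^sup>2 * (norm (N k))\<^sup>2 + (norm (M' k))\<^sup>2 * (norm (N' k))\<^sup>2
          \<ge> (real CARD('p) + real CARD('m) - 2 * real (card (S k))) * (norm (?rg k Z))\<^sup>2" for k
      unfolding M_def N_def M'_def N'_def by (rule top_eigenvalues.second_order_constant_ge[OF te])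
    have I: "integrable gauss (\<lambda>W. \<Sum>k\<in>{1..n}. w k * ((norm (M k ** W ** N k))\<^sup>2 + (norm (M' k ** W ** N' k))\<^sup>2))"
      by (intro Bochner_Integration.integrable_sum integrable_mult_right Bochner_Integration.integrable_add gauss_second_moment_mult)
    have "low Z \<le> (\<Sum>k\<in>{1..n}. w k * ((norm (M k))\<^sup>2 * (norm (N k))\<^sup>2 + (norm (M' k))\<^sup>2 * (norm (N' k))\<^sup>2))"
      unfolding low_def
    proof (intro sum_mono mult_left_mono w0)
      fix k assume "k \<in> {1..n}"
      then have "c k = real CARD('p) + real CARD('m) - 2 * real (card (S k))" by (simp add: cardS c_def n_def m_def)
      then show "c k * (norm (?rg k Z))\<^sup>2 \<le> (norm (M k))\<^sup>2 * (norm (N k))\<^sup>2 + (norm (M' k))\<^sup>2 * (norm (N' k))\<^sup>2"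
        using const[of k] by simp
    qed
    also have "\<dots> = (\<integral>W. (\<Sum>k\<in>{1..n}. w k * ((norm (M k ** W ** N k))\<^sup>2 + (norm (M' k ** W ** N' k))\<^sup>2)) \<partial>gauss)"
      by (simp add: Bochner_Integration.integral_sum gauss_second_moment_mult)
    finally have "ennreal (low Z) \<le> ennreal (\<integral>W. (\<Sum>k\<in>{1..n}. w k * ((norm (M k ** W ** N k))\<^sup>2 + (norm (M' k ** W ** N' k))\<^sup>2)) \<partial>gauss)"
      by (rule ennreal_leI)
    also have "\<dots> = (\<integral>\<^sup>+W. ennreal (\<Sum>k\<in>{1..n}. w k * ((norm (M k ** W ** N k))\<^sup>2 + (norm (M' k ** W ** N' k))\<^sup>2)) \<partial>gauss)"
      by (rule nn_integral_eq_integral[OF I, symmetric]) (auto intro!: sum_nonneg mult_nonneg_nonneg w0)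
    also have "\<dots> \<le> (\<integral>\<^sup>+W. ennreal (q Z W) \<partial>gauss)"
      unfolding q_def using so w0 by (intro nn_integral_mono ennreal_leI sum_mono mult_left_mono) auto
    finally show ?thesis .
  qed
  have gsum: "(1 / 2) *\<^sub>R g Z = Z ** U Z ** rdiag (\<lambda>i. c (pos i) / a Z i) ** (U Z)\<^sup>\<dagger>" for Z
  proof -
    have "(1 / 2) *\<^sub>R g Z = (\<Sum>k\<in>{1..n}. w k *\<^sub>R (Z ** U Z ** rdiag (\<lambda>i. if i \<in> S k then 1 / a Z i else 0) ** (U Z)\<^sup>\<dagger>))"
      unfolding g_def top_eigenvalues.half_gradient_def[OF te] top_eigenvalues.rot_gradient_def[OF te] top_eigenvalues.inv_top_def[OF te]
      by (simp add: scaleR_sum_right)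
    also have "\<dots> = Z ** U Z ** rdiag (\<lambda>i. \<Sum>k\<in>{1..n}. w k * (if i \<in> S k then 1 / a Z i else 0)) ** (U Z)\<^sup>\<dagger>"
      by (rule sandwich_sum_rdiag)
    also have "(\<lambda>i. \<Sum>k\<in>{1..n}. w k * (if i \<in> S k then 1 / a Z i else 0)) = (\<lambda>i. c (pos i) / a Z i)"
    proof
      fix i
      have "(\<Sum>k\<in>{1..n}. w k * (if i \<in> S k then 1 / a Z i else 0)) = (\<Sum>k\<in>{pos i..n}. w k * (1 / a Z i))"
        by (rule sum.mono_neutral_cong_right) (use posn[of i] in \<open>auto simp: S_def\<close>)
      also have "\<dots> = c (pos i) / a Z i"
        using wsum[of "pos i"] posn[of i] by (simp flip: sum_divide_distrib)
      finally show "(\<Sum>k\<in>{1..n}. w k * (if i \<in> S k then 1 / a Z i else 0)) = c (pos i) / a Z i" .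
    qed
    finally show ?thesis .
  qed
  have low_ge: "(norm (g Z))\<^sup>2 / 8 \<le> low Z" for Z
  proof -
    define t where "t i = (a Z i - e) / (a Z i)\<^sup>2" for i
    have t0: "t i \<ge> 0" for i using l0[of Z i] by (simp add: t_def a_def)
    have UU: "(U Z)\<^sup>\<dagger> ** U Z = mat 1" using U[of Z] by (simp add: unitary_matrix_def)
    define A where "A = Z ** U Z ** rdiag (\<lambda>i. c (pos i) / a Z i)"
    have "(norm ((1 / 2) *\<^sub>R g Z))\<^sup>2 = (norm A)\<^sup>2"
      unfolding gsum A_def[symmetric] by (subst norm_unitary_right) (simp_all add: UU)
    also have "\<dots> = Re (trace (rdiag (\<lambda>i. c (pos i) / a Z i) ** ((Z ** U Z)\<^sup>\<dagger> ** (Z ** U Z)) ** rdiag (\<lambda>i. c (pos i) / a Z i)))"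
      unfolding power2_norm_eq_inner inner_matrix_trace A_def by (simp add: ct_mult matrix_mul_assoc)
    also have "\<dots> = (\<Sum>i\<in>UNIV. (c (pos i))\<^sup>2 * t i)"
      unfolding top_eigenvalues.base_gram[OF te] rdiag_mult trace_rdiag
      by (simp add: t_def power2_eq_square mult_ac)
    finally have g2: "(norm (g Z))\<^sup>2 / 4 = (\<Sum>i\<in>UNIV. (c (pos i))\<^sup>2 * t i)" by (simp add: power_divide)
    have "low Z = (\<Sum>k\<in>{1..n}. \<Sum>i\<in>{i \<in> UNIV. pos i \<le> k}. w k * c k * t i)"
      unfolding low_def top_eigenvalues.norm_rot_gradient_sq[OF te] t_def[symmetric]
      by (simp add: S_def sum_distrib_left mult.assoc)
    also have "\<dots> = (\<Sum>i\<in>UNIV. \<Sum>k\<in>{k \<in> {1..n}. pos i \<le> k}. w k * c k * t i)"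
      by (rule sum.swap_restrict) auto
    also have "\<dots> = (\<Sum>i\<in>UNIV. (\<Sum>k\<in>{pos i..n}. w k * c k) * t i)"
    proof -
      have "{k \<in> {1..n}. pos i \<le> k} = {pos i..n}" for i using posn[of i] by auto
      then show ?thesis by (simp only: sum_distrib_right)
    qed
    also have "\<dots> \<ge> (\<Sum>i\<in>UNIV. (c (pos i))\<^sup>2 / 2 * t i)"
      using posn by (intro sum_mono mult_right_mono wcsum t0) auto
    finally have "low Z \<ge> (\<Sum>i\<in>UNIV. (c (pos i))\<^sup>2 / 2 * t i)" .
    moreover have "(\<Sum>i\<in>UNIV. (c (pos i))\<^sup>2 / 2 * t i) = (norm (g Z))\<^sup>2 / 4 / 2"
      unfolding g2 by (simp add: sum_divide_distrib)
    ultimately show ?thesis by simp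
  qed
  have \<phi>m: "\<phi> \<in> borel_measurable borel" by (rule borel_measurable_quadratic_lower_bound[OF S1])
  obtain g0 where g0: "g0 \<in> borel_measurable borel" "AE Z in lborel. g Z = g0 Z" "\<And>Z. norm (g0 Z) \<le> K"
    using subgradient_AE_borel[OF S1 \<phi>0 \<phi>B gK D(1)] by blast
  have S1': "AE Z in lborel. \<forall>W. \<phi> (Z + W) \<ge> \<phi> Z + g0 Z \<bullet> W - D1 * (norm W)\<^sup>2 * (1 + (norm Z)\<^sup>2)"
    using g0(2) by eventually_elim (use S1 in metis)
  have qs: "quarter_turn j (r *\<^sub>R W) = r *\<^sub>R quarter_turn j W" for j r and W :: "complex^'p^'m"
    by (simp add: quarter_turn_def cscale_scaleR)
  have risk: "(\<integral>\<^sup>+y. ennreal ((norm (y - (1 / 2) *\<^sub>R g0 (\<Xi> + y)))\<^sup>2) \<partial>gauss) \<le> ennreal (DIM(complex^'p^'m) / 2)" for \<Xi>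
  proof (rule risk_le_dim[OF g0(1,3)])
    have "(\<integral>\<^sup>+u. ennreal ((norm (g0 (\<Xi> + u)))\<^sup>2 / 8) \<partial>gauss) = (\<integral>\<^sup>+u. ennreal ((norm (g (\<Xi> + u)))\<^sup>2 / 8) \<partial>gauss)"
    proof (rule nn_integral_cong_AE)
      have "AE u in gauss. g (\<Xi> + u) = g0 (\<Xi> + u)" unfolding AE_gauss_iff by (rule AE_lborel_translate[OF g0(2)])
      then show "AE u in gauss. ennreal ((norm (g0 (\<Xi> + u)))\<^sup>2 / 8) = ennreal ((norm (g (\<Xi> + u)))\<^sup>2 / 8)"
        by eventually_elim simp
    qed
    also have "\<dots> \<le> (\<integral>\<^sup>+u. ennreal (low (\<Xi> + u)) \<partial>gauss)"
      by (intro nn_integral_mono ennreal_leI low_ge)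
    also have "\<dots> \<le> ennreal ((\<integral>y. g0 (\<Xi> + y) \<bullet> y \<partial>gauss) / 2)"
      by (rule stein_lower_bound[OF \<phi>m g0(1) \<phi>0 \<phi>B g0(3) S1' D(1) quarter_turn_measurable
          distr_gauss_quarter_turn norm_quarter_turn qs S2 D(2) S3 low])
    finally show "(\<integral>\<^sup>+u. ennreal ((norm (g0 (\<Xi> + u)))\<^sup>2 / 8) \<partial>gauss) \<le> ennreal ((\<integral>y. g0 (\<Xi> + y) \<bullet> y \<partial>gauss) / 2)" .
  qed
  have "AE Z in lborel. (1 / 2) *\<^sub>R g0 Z = Z ** U Z ** rdiag (\<lambda>i. (real CARD('m) + real CARD('p) - 2 * real (pos i)) / (l Z (pos i) + e)) ** (U Z)\<^sup>\<dagger>"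
    using g0(2)
  proof eventually_elim
    case (elim Z)
    then show ?case using gsum[of Z] by (simp add: c_def a_def m_def n_def)
  qed
  with g0(1) risk show ?thesis by blast
qed

section \<open>Minimaxity\<close>

theorem proposition2:
  fixes pos :: "'p::finite \<Rightarrow> nat"
    and U :: "complex^'p^'m::finite \<Rightarrow> complex^'p^'p"
    and l :: "complex^'p^'m \<Rightarrow> nat \<Rightarrow> real"
    and h :: "nat \<Rightarrow> (nat \<Rightarrow> real) \<Rightarrow> real"
  assumes "CARD('m) > CARD('p)"
    and "bij_betw pos UNIV {1..CARD('p)}"
    and "\<And>Z. unitary_matrix (U Z)"
    and "\<And>Z. conj_transpose Z ** Z
               = U Z ** diag_matrix pos (l Z) ** conj_transpose (U Z)"
    and "\<And>Z. antimono_on {1..CARD('p)} (l Z)"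
    and "\<And>k L. k \<in> {1..CARD('p)} \<Longrightarrow>
           h k L = - (real CARD('m) + real CARD('p) - 2 * real k) / L k"
  shows "minimax (\<lambda>Z. Z ** (mat 1 +
           U Z ** diag_matrix pos (\<lambda>k. h k (l Z)) ** conj_transpose (U Z)))"
proof -
  define c where "c i = real CARD('m) + real CARD('p) - 2 * real (pos i)" for i
  have posn: "pos i \<in> {1..CARD('p)}" for i using assms(2) by (auto simp: bij_betw_def)
  have sp: "Z\<^sup>\<dagger> ** Z = U Z ** rdiag (\<lambda>i. l Z (pos i)) ** (U Z)\<^sup>\<dagger>" for Z
    using assms(4)[of Z] by (simp add: diag_matrix_eq_rdiag)
  have gram: "(Z ** U Z)\<^sup>\<dagger> ** (Z ** U Z) = rdiag (\<lambda>i. l Z (pos i))" for Z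
  proof -
    have "(U Z)\<^sup>\<dagger> ** U Z = mat 1" using assms(3)[of Z] by (simp add: unitary_matrix_def)
    moreover have "(Z ** U Z)\<^sup>\<dagger> ** (Z ** U Z) = ((U Z)\<^sup>\<dagger> ** U Z) ** rdiag (\<lambda>i. l Z (pos i)) ** ((U Z)\<^sup>\<dagger> ** U Z)"
    proof -
      have "(Z ** U Z)\<^sup>\<dagger> ** (Z ** U Z) = (U Z)\<^sup>\<dagger> ** (Z\<^sup>\<dagger> ** Z) ** U Z" by (simp add: ct_mult matrix_mul_assoc)
      then show ?thesis unfolding sp by (simp add: matrix_mul_assoc)
    qed
    ultimately show ?thesis by simp
  qed
  have col: "l Z (pos j) = (\<Sum>i\<in>UNIV. (cmod ((Z ** U Z) $ i $ j))\<^sup>2)" for Z j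
  proof -
    have "complex_of_real (l Z (pos j)) = rdiag (\<lambda>i. l Z (pos i)) $ j $ j" by (simp add: rdiag_def)
    also have "\<dots> = of_real (\<Sum>i\<in>UNIV. (cmod ((Z ** U Z) $ i $ j))\<^sup>2)" unfolding gram[symmetric] by (rule gram_diag)
    finally show ?thesis by (simp only: of_real_eq_iff)
  qed
  have l0: "l Z (pos i) \<ge> 0" for Z i unfolding col by (simp add: sum_nonneg)
  define e where "e n = 1 / (real n + 1)" for n
  have e: "e n > 0" for n by (simp add: e_def)
  have e_lim: "e \<longlonglongrightarrow> 0"
    using LIMSEQ_inverse_real_of_nat by (simp add: e_def[abs_def] inverse_eq_divide add.commute)
  define \<delta> where "\<delta> Z = Z ** (mat 1 + U Z ** diag_matrix pos (\<lambda>k. h k (l Z)) ** (U Z)\<^sup>\<dagger>)" for Z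
  define H where "H n Z = Z ** U Z ** rdiag (\<lambda>i. c i / (l Z (pos i) + e n)) ** (U Z)\<^sup>\<dagger>" for n Z
  have H_lim: "(\<lambda>n. Z - H n Z) \<longlonglongrightarrow> \<delta> Z" for Z
  proof -
    have "(\<lambda>n. Z ** U Z ** rdiag (\<lambda>i. c i / (l Z (pos i) + e n))) \<longlonglongrightarrow> Z ** U Z ** rdiag (\<lambda>i. - h (pos i) (l Z))"
    proof (rule vec_tendstoI, rule vec_tendstoI)
      fix i j
      \<comment> \<open>A zero eigenvalue belongs to a zero column of \<open>Z ** U Z\<close>, which absorbs the value \<open>0\<close> of the division by zero in \<open>h\<close>.\<close>
      show "(\<lambda>n. (Z ** U Z ** rdiag (\<lambda>i. c i / (l Z (pos i) + e n))) $ i $ j) \<longlonglongrightarrow> (Z ** U Z ** rdiag (\<lambda>i. - h (pos i) (l Z))) $ i $ j"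
      proof (cases "l Z (pos j) = 0")
        case True
        then have "(\<Sum>i\<in>UNIV. (cmod ((Z ** U Z) $ i $ j))\<^sup>2) = 0" using col[of Z j] by simp
        then have "(Z ** U Z) $ i $ j = 0" by (subst (asm) sum_nonneg_eq_0_iff) auto
        then show ?thesis by (simp add: mult_rdiag_nth)
      next
        case False
        have "(\<lambda>n. (Z ** U Z) $ i $ j * of_real (c j / (l Z (pos j) + e n))) \<longlonglongrightarrow> (Z ** U Z) $ i $ j * of_real (c j / (l Z (pos j) + 0))"
          using False by (intro tendsto_intros e_lim) auto
        moreover have "c j / (l Z (pos j) + 0) = - h (pos j) (l Z)"
        proof -
          have "x / (y + 0) = - (- x / y)" for x y :: real by simp
          then show ?thesis unfolding assms(6)[OF posn[of j]] c_def .
        qed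
        ultimately show ?thesis by (simp only: mult_rdiag_nth)
      qed
    qed
    then have "(\<lambda>n. Z - H n Z) \<longlonglongrightarrow> Z - Z ** U Z ** rdiag (\<lambda>i. - h (pos i) (l Z)) ** (U Z)\<^sup>\<dagger>"
      unfolding H_def by (intro tendsto_diff tendsto_const tendsto_matrix_mult[OF _ tendsto_const])
    moreover have "Z - Z ** U Z ** rdiag (\<lambda>i. - h (pos i) (l Z)) ** (U Z)\<^sup>\<dagger> = \<delta> Z"
    proof -
      have "rdiag (\<lambda>i. - h (pos i) (l Z)) = (- 1) *\<^sub>R rdiag (\<lambda>i. h (pos i) (l Z))" by (simp add: rdiag_scaleR)
      then have "Z ** U Z ** rdiag (\<lambda>i. - h (pos i) (l Z)) ** (U Z)\<^sup>\<dagger>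
          = (- 1) *\<^sub>R (Z ** U Z ** rdiag (\<lambda>i. h (pos i) (l Z)) ** (U Z)\<^sup>\<dagger>)"
        by (simp only: matrix_scaleR_left matrix_scaleR_right)
      then show ?thesis
        by (simp add: \<delta>_def diag_matrix_eq_rdiag matrix_add_ldistrib matrix_mul_assoc)
    qed
    ultimately show ?thesis by simp
  qed
  have "\<forall>n. \<exists>g. g \<in> borel_measurable borel \<and> (AE Z in lborel. (1 / 2) *\<^sub>R g Z = H n Z)
     \<and> (\<forall>\<Xi>. (\<integral>\<^sup>+y. ennreal ((norm (y - (1 / 2) *\<^sub>R g (\<Xi> + y)))\<^sup>2) \<partial>gauss) \<le> ennreal (DIM(complex^'p^'m) / 2))"
    unfolding H_def c_def
    by (intro allI regularized_estimator[OF assms(1,2,3) sp assms(5) l0 e, unfolded Bex_def])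
  from choice[OF this] obtain g where g[measurable]: "\<And>n. g n \<in> borel_measurable borel" and gH: "\<And>n. AE Z in lborel. (1 / 2) *\<^sub>R g n Z = H n Z"
    and gr: "\<And>n \<Xi>. (\<integral>\<^sup>+y. ennreal ((norm (y - (1 / 2) *\<^sub>R g n (\<Xi> + y)))\<^sup>2) \<partial>gauss) \<le> ennreal (DIM(complex^'p^'m) / 2)"
    by blast
  define \<delta>0 where "\<delta>0 Z = lim (\<lambda>n. Z - (1 / 2) *\<^sub>R g n Z)" for Z
  have \<delta>0[measurable]: "\<delta>0 \<in> borel_measurable borel" unfolding \<delta>0_def by measurable
  have "AE Z in lborel. \<forall>n. (1 / 2) *\<^sub>R g n Z = H n Z" using gH by (simp add: AE_all_countable)
  then have lim: "AE Z in lborel. \<delta> Z = \<delta>0 Z \<and> (\<lambda>n. Z - (1 / 2) *\<^sub>R g n Z) \<longlonglongrightarrow> \<delta>0 Z"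
  proof eventually_elim
    case (elim Z)
    then have 1: "(\<lambda>n. Z - (1 / 2) *\<^sub>R g n Z) \<longlonglongrightarrow> \<delta> Z" using H_lim[of Z] by simp
    then have "\<delta>0 Z = \<delta> Z" unfolding \<delta>0_def by (rule limI)
    with 1 show ?case by simp
  qed
  then have ae: "AE Z in lborel. \<delta> Z = \<delta>0 Z" by eventually_elim simp
  have meas: "\<delta> \<in> borel_measurable lebesgue" by (rule AE_borel_lebesgue_measurable[OF \<delta>0 ae])
  have risk: "risk \<delta> \<Xi> \<le> ennreal (real CARD('m) * real CARD('p))" for \<Xi>
  proof -
    have "risk \<delta> \<Xi> = (\<integral>\<^sup>+y. ennreal ((norm (\<delta>0 (\<Xi> + y) - \<Xi>))\<^sup>2) \<partial>gauss)"
      by (rule risk_eq_gauss[OF meas \<delta>0 ae])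
    also have "\<dots> = (\<integral>\<^sup>+y. liminf (\<lambda>n. ennreal ((norm (y - (1 / 2) *\<^sub>R g n (\<Xi> + y)))\<^sup>2)) \<partial>gauss)"
    proof (rule nn_integral_cong_AE)
      have "AE y in gauss. \<delta> (\<Xi> + y) = \<delta>0 (\<Xi> + y) \<and> (\<lambda>n. \<Xi> + y - (1 / 2) *\<^sub>R g n (\<Xi> + y)) \<longlonglongrightarrow> \<delta>0 (\<Xi> + y)"
        unfolding AE_gauss_iff by (rule AE_lborel_translate[OF lim])
      then show "AE y in gauss. ennreal ((norm (\<delta>0 (\<Xi> + y) - \<Xi>))\<^sup>2) = liminf (\<lambda>n. ennreal ((norm (y - (1 / 2) *\<^sub>R g n (\<Xi> + y)))\<^sup>2))"
      proof eventually_elim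
        case (elim y)
        then have "(\<lambda>n. \<Xi> + y - (1 / 2) *\<^sub>R g n (\<Xi> + y) - \<Xi>) \<longlonglongrightarrow> \<delta>0 (\<Xi> + y) - \<Xi>" by (intro tendsto_diff tendsto_const) auto
        then have "(\<lambda>n. ennreal ((norm (\<Xi> + y - (1 / 2) *\<^sub>R g n (\<Xi> + y) - \<Xi>))\<^sup>2)) \<longlonglongrightarrow> ennreal ((norm (\<delta>0 (\<Xi> + y) - \<Xi>))\<^sup>2)"
          by (intro tendsto_ennrealI tendsto_power tendsto_norm)
        moreover have "\<Xi> + y - (1 / 2) *\<^sub>R g n (\<Xi> + y) - \<Xi> = y - (1 / 2) *\<^sub>R g n (\<Xi> + y)" for n by simp
        ultimately have "(\<lambda>n. ennreal ((norm (y - (1 / 2) *\<^sub>R g n (\<Xi> + y)))\<^sup>2)) \<longlonglongrightarrow> ennreal ((norm (\<delta>0 (\<Xi> + y) - \<Xi>))\<^sup>2)"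
          by (simp only:)
        from lim_imp_Liminf[OF sequentially_bot this] show ?case by (rule sym)
      qed
    qed
    also have "\<dots> \<le> liminf (\<lambda>n. \<integral>\<^sup>+y. ennreal ((norm (y - (1 / 2) *\<^sub>R g n (\<Xi> + y)))\<^sup>2) \<partial>gauss)"
      by (rule nn_integral_liminf) simp
    also have "\<dots> \<le> ennreal (DIM(complex^'p^'m) / 2)"
      by (rule Liminf_le[OF sequentially_bot]) (intro always_eventually allI gr)
    finally show ?thesis by simp
  qed
  have est: "\<delta> \<in> estimators" using meas by (simp add: estimators_def)
  have lower: "ennreal (real CARD('m) * real CARD('p)) \<le> (INF \<delta>'\<in>(estimators :: (complex^'p^'m \<Rightarrow> complex^'p^'m) set). SUP \<Xi>. risk \<delta>' \<Xi>)"
    by (intro INF_greatest sup_risk_ge_complex)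
  have "(SUP \<Xi>. risk \<delta> \<Xi>) \<le> ennreal (real CARD('m) * real CARD('p))" by (intro SUP_least risk)
  also note lower
  finally have "(SUP \<Xi>. risk \<delta> \<Xi>) \<le> (INF \<delta>'\<in>(estimators :: (complex^'p^'m \<Rightarrow> complex^'p^'m) set). SUP \<Xi>. risk \<delta>' \<Xi>)" .
  moreover have "(INF \<delta>'\<in>(estimators :: (complex^'p^'m \<Rightarrow> complex^'p^'m) set). SUP \<Xi>. risk \<delta>' \<Xi>) \<le> (SUP \<Xi>. risk \<delta> \<Xi>)"
    by (rule INF_lower[OF est])
  ultimately have "minimax \<delta>" using est unfolding minimax_def by (auto intro: antisym)
  then show ?thesis unfolding \<delta>_def .
qed

end
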